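(* Let $\{G_\theta:\theta\in\Omega\}$, $\Omega\subseteq\mathbb{R}^p$, be a parametric model with densities $g_\theta$ with respect to a common measure, and let $K_\theta(x,y)$ be bounded, symmetric, conditionally nonnegative definite kernels. Let $X_1,\ldots,X_n$ be i.i.d. from $G_\theta$, with empirical distribution $\hat F$, and let $\hat\theta$ be the maximum likelihood estimator, solving $\sum_{i=1}^n\mathbf{u}(X_i;\hat\theta)=\mathbf 0$. Let $K^\theta_{\mathrm{scen}}$ be the score-centered kernel (defined in the context). Assume: (i) $\sqrt n(\hat\theta-\theta)$ converges in distribution under $G_\theta$; (ii) $\theta'\mapsto K^{\theta'}_{\mathrm{scen}}(x,y)$ is three times differentiable in a neighborhood of $\theta$, and differentiation with respect to the parameter may be interchanged with integration (twice) in the identities $\int K^{\theta'}_{\mathrm{scen}}(x,y)\,dG_{\theta'}(y)=0$, so that $\int \nabla_\theta K^\theta_{\mathrm{scen}}(x,y)\,dG_\theta(y)=\mathbf 0$ and $\iint\nabla^2_\theta K^\theta_{\mathrm{scen}}(x,y)\,dG_\theta(x)\,dG_\theta(y)=\mathbf 0$; (iii) for $X,Y$ independent with distribution $G_\theta$, the entries of $\nabla_\theta K^\theta_{\mathrm{scen}}(X,Y)$, $\nabla^2_\theta K^\theta_{\mathrm{scen}}(X,Y)$, $\nabla_\theta K^\theta_{\mathrm{scen}}(X,X)$ and $\nabla^2_\theta K^\theta_{\mathrm{scen}}(X,X)$ have finite variance; (iv) for $\theta^*$ in a neighborhood of $\theta$, the entries of the arrays of third derivatives $\nabla^3 K^{\theta^*}_{\mathrm{scen}}(X,Y)$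 and $\nabla^3K^{\theta^*}_{\mathrm{scen}}(X,X)$ are bounded in absolute value by functions, not depending on $\theta^*$, with finite expectation under $G_\theta$. Then, under $G_\theta$, as $n\to\infty$, $$n\left[d_K(\hat F,G_{\hat\theta})-\iint K^\theta_{\mathrm{scen}}(x,y)\,d\hat F(x)\,d\hat F(y)\right]\longrightarrow 0\quad\text{in probability}.$$ If moreover $K^\theta_{\mathrm{scen}}$ has a spectral decomposition $\sum_i\lambda_i\phi_i(x)\phi_i(y)$ under the baseline measure $G_\theta$ with finite trace, then $$n\,d_K(\hat F,G_{\hat\theta})\longrightarrow \chi^*(\lambda)\quad\text{in distribution},$$ where $\lambda=(\lambda_1,\lambda_2,\ldots)$ are the eigenvalues of the spectral decomposition of $K^\theta_{\mathrm{scen}}$.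
   Context: A symmetric kernel $K$ on $\mathcal S\times\mathcal S$ is conditionally nonnegative definite if $\iint K(s,t)\,d\sigma(s)\,d\sigma(t)\ge0$ for all bounded signed measures $\sigma$ with $\int d\sigma=0$. The quadratic distance is $d_K(F,G_\theta)=\iint K_\theta(s,t)\,d(F-G_\theta)(s)\,d(F-G_\theta)(t)$, where the kernel $K_\theta$ may depend on $G_\theta$. Scores: $\mathbf u_\theta(x)=\mathbf u(x;\theta)=\nabla_\theta\log g_\theta(x)\in\mathbb R^p$, satisfying $E_\theta[\mathbf u(X;\theta)]=\mathbf 0$; the extended score is $\mathbf u^*_\theta=(1,\mathbf u_\theta^T)^T$, and the extended information matrix is $\mathbb J^*_\theta=E_\theta[\mathbf u^*_\theta\mathbf u^{*T}_\theta]$ (assumed finite and invertible). Put $P^*_\theta(x,y)=\mathbf u^*_\theta(x)^T\,\mathbb J_\theta^{*-1}\,\mathbf u^*_\theta(y)$. The score-centered kernel is $$\begin{aligned}K^\theta_{\mathrm{scen}}(x,y)=K_\theta(x,y)&-\int P^*_\theta(x,z)K_\theta(z,y)\,dG_\theta(z)-\int K_\theta(x,z)P^*_\theta(z,y)\,dG_\theta(z)\\&+\iint P^*_\theta(x,z)K_\theta(z,w)P^*_\theta(w,y)\,dG_\theta(z)\,dG_\theta(w).\end{aligned}$$ A spectral decomposition of a kernel $K$ under a baseline probability measure $M$ is $K(x,y)=\sum_i\lambda_i\phi_i(x)\phi_i(y)$, where the $\phi_i$ are orthonormal in $L_2(M)$ and are eigenfunctions with eigenvalues $\lambda_i$ of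 the operator $g\mapsto\int K(\cdot,y)g(y)\,dM(y)$. Finite trace means $\mathrm{trace}_M(K)=\sum_i\lambda_i=\int K(x,x)\,dM(x)<\infty$. Finally, $\chi^*(\lambda)$ denotes the distribution of $\sum_i\lambda_iZ_i^2$ with $Z_1,Z_2,\ldots$ independent standard normal. *)

theory Defs
  imports "HOL-Probability.Probability"
begin

definition dint :: "('a \<Rightarrow> 'a \<Rightarrow> real) \<Rightarrow> 'a measure \<Rightarrow> 'a measure \<Rightarrow> real" where
  "dint k P Q = (\<integral>x. (\<integral>y. k x y \<partial>Q) \<partial>P)"

text \<open>The double integral of \<open>k\<close> against the product of the signed measure \<open>P - Q\<close> with itself,
  expanded by bilinearity (finite signed measures are not in the library).\<close>

definition qdist :: "('a \<Rightarrow> 'a \<Rightarrow> real) \<Rightarrow> 'a measure \<Rightarrow> 'a measure \<Rightarrow> real" where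
  "qdist k P Q = dint k P P - dint k P Q - dint k Q P + dint k Q Q"

text \<open>By the Jordan decomposition, the bounded signed measures of total mass zero are exactly the
  differences \<open>P - Q\<close> of finite measures of equal total mass.\<close>

definition cond_nonneg_definite :: "'a measure \<Rightarrow> ('a \<Rightarrow> 'a \<Rightarrow> real) \<Rightarrow> bool" where
  "cond_nonneg_definite S k \<longleftrightarrow>
    (\<forall>P Q. finite_measure P \<and> finite_measure Q \<and> sets P = sets S \<and> sets Q = sets S \<and>
           measure P (space S) = measure Q (space S) \<longrightarrow> 0 \<le> qdist k P Q)"

definition empirical :: "'a measure \<Rightarrow> nat \<Rightarrow> (nat \<Rightarrow> 'a) \<Rightarrow> 'a measure" where
  "empirical S n x = distr (uniform_count_measure {..<n}) S x"

text \<open>In the following definitions \<open>M\<close>, \<open>v\<close> and \<open>k\<close> stand for the model distribution, the score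
  and the kernel at one fixed parameter value.  The extended score lives in the coordinate space
  indexed by \<open>'p option\<close>, with \<open>None\<close> for the leading constant coordinate.\<close>

definition ext_score :: "('a \<Rightarrow> real^'p) \<Rightarrow> 'a \<Rightarrow> real^('p option)" where
  "ext_score v x = (\<chi> i. case i of None \<Rightarrow> 1 | Some j \<Rightarrow> v x $ j)"

definition ext_info :: "'a measure \<Rightarrow> ('a \<Rightarrow> real^'p) \<Rightarrow> real^('p option)^('p option)" where
  "ext_info M v = (\<chi> i j. \<integral>x. ext_score v x $ i * ext_score v x $ j \<partial>M)"

definition proj_kernel :: "'a measure \<Rightarrow> ('a \<Rightarrow> real^'p) \<Rightarrow> 'a \<Rightarrow> 'a \<Rightarrow> real" where
  "proj_kernel M v x y = ext_score v x \<bullet> (matrix_inv (ext_info M v) *v ext_score v y)"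

definition scen_kernel ::
  "'a measure \<Rightarrow> ('a \<Rightarrow> real^'p) \<Rightarrow> ('a \<Rightarrow> 'a \<Rightarrow> real) \<Rightarrow> 'a \<Rightarrow> 'a \<Rightarrow> real" where
  "scen_kernel M v k x y =
     k x y
     - (\<integral>z. proj_kernel M v x z * k z y \<partial>M)
     - (\<integral>z. k x z * proj_kernel M v z y \<partial>M)
     + (\<integral>z. (\<integral>w. proj_kernel M v x z * k z w * proj_kernel M v w y \<partial>M) \<partial>M)"

definition scen ::
  "('t \<Rightarrow> 'a measure) \<Rightarrow> ('t \<Rightarrow> 'a \<Rightarrow> real^'p) \<Rightarrow> ('t \<Rightarrow> 'a \<Rightarrow> 'a \<Rightarrow> real) \<Rightarrow>
   't \<Rightarrow> 'a \<Rightarrow> 'a \<Rightarrow> real" where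
  "scen G u K t = scen_kernel (G t) (u t) (K t)"

definition is_mle ::
  "'t set \<Rightarrow> ('t \<Rightarrow> 'a \<Rightarrow> real) \<Rightarrow> nat \<Rightarrow> (nat \<Rightarrow> 'a) \<Rightarrow> 't \<Rightarrow> bool" where
  "is_mle \<Omega> g n x t \<longleftrightarrow> t \<in> \<Omega> \<and> (\<forall>s\<in>\<Omega>. (\<Prod>i<n. g s (x i)) \<le> (\<Prod>i<n. g t (x i)))"

text \<open>\<^const>\<open>frechet_derivative\<close> is unspecified where \<open>f\<close> is not differentiable, so these arrays of
  partial derivatives are used together with differentiability hypotheses only.\<close>

definition grad :: "(real^'p \<Rightarrow> real) \<Rightarrow> real^'p \<Rightarrow> real^'p" where
  "grad f t = (\<chi> i. frechet_derivative f (at t) (axis i 1))"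

definition grad2 :: "(real^'p \<Rightarrow> real) \<Rightarrow> real^'p \<Rightarrow> real^'p^'p" where
  "grad2 f t = (\<chi> i. grad (\<lambda>s. grad f s $ i) t)"

definition grad3 :: "(real^'p \<Rightarrow> real) \<Rightarrow> real^'p \<Rightarrow> real^'p^'p^'p" where
  "grad3 f t = (\<chi> i j. grad (\<lambda>s. grad2 f s $ i $ j) t)"

definition three_times_differentiable_on :: "(real^'p \<Rightarrow> real) \<Rightarrow> (real^'p) set \<Rightarrow> bool" where
  "three_times_differentiable_on f U \<longleftrightarrow>
    (\<forall>t\<in>U. f differentiable (at t) \<and>
           (\<forall>i. (\<lambda>s. grad f s $ i) differentiable (at t)) \<and>
           (\<forall>i j. (\<lambda>s. grad2 f s $ i $ j) differentiable (at t)))"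

text \<open>On a probability space, finite variance is the same as square integrability.\<close>

definition finite_variance :: "'a measure \<Rightarrow> ('a \<Rightarrow> real) \<Rightarrow> bool" where
  "finite_variance M f \<longleftrightarrow> f \<in> borel_measurable M \<and> integrable M (\<lambda>x. (f x)\<^sup>2)"

definition converges_in_probability ::
  "'w measure \<Rightarrow> (nat \<Rightarrow> 'w \<Rightarrow> 'b::metric_space) \<Rightarrow> ('w \<Rightarrow> 'b) \<Rightarrow> bool" where
  "converges_in_probability M Y Z \<longleftrightarrow>
    (\<forall>\<epsilon>>0. (\<lambda>n. measure M {w \<in> space M. dist (Y n w) (Z w) > \<epsilon>}) \<longlonglongrightarrow> 0)"

text \<open>Weak convergence for vector-valued random variables; \<^const>\<open>weak_conv_m\<close> covers
  real-valued ones only.\<close>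

definition converges_in_distribution ::
  "'w measure \<Rightarrow> (nat \<Rightarrow> 'w \<Rightarrow> 'b::euclidean_space) \<Rightarrow> 'b measure \<Rightarrow> bool" where
  "converges_in_distribution M Y L \<longleftrightarrow>
    prob_space L \<and> sets L = sets borel \<and> (\<forall>n. Y n \<in> borel_measurable M) \<and>
    (\<forall>f :: 'b \<Rightarrow> real. continuous_on UNIV f \<and> bounded (range f) \<longrightarrow>
       (\<lambda>n. \<integral>w. f (Y n w) \<partial>M) \<longlonglongrightarrow> (\<integral>z. f z \<partial>L))"

text \<open>The index set \<open>I\<close> may be finite or infinite, so that kernels of finite rank and
  finite-dimensional spaces of square-integrable functions are covered.  Eigenfunctions are
  elements of a space of classes modulo null sets, hence identities hold almost everywhere.\<close>

definition spectral_decomposition ::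
  "'a measure \<Rightarrow> ('a \<Rightarrow> 'a \<Rightarrow> real) \<Rightarrow> nat set \<Rightarrow> (nat \<Rightarrow> real) \<Rightarrow> (nat \<Rightarrow> 'a \<Rightarrow> real) \<Rightarrow> bool" where
  "spectral_decomposition M k I lam \<phi> \<longleftrightarrow>
    (\<forall>i\<in>I. \<phi> i \<in> borel_measurable M \<and> integrable M (\<lambda>x. (\<phi> i x)\<^sup>2)) \<and>
    (\<forall>i\<in>I. \<forall>j\<in>I. (\<integral>x. \<phi> i x * \<phi> j x \<partial>M) = (if i = j then 1 else 0)) \<and>
    (\<forall>i\<in>I. AE x in M. integrable M (\<lambda>y. k x y * \<phi> i y) \<and>
                       (\<integral>y. k x y * \<phi> i y \<partial>M) = lam i * \<phi> i x) \<and>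
    (AE (x, y) in M \<Otimes>\<^sub>M M. ((\<lambda>i. lam i * \<phi> i x * \<phi> i y) has_sum k x y) I)"

definition finite_trace ::
  "'a measure \<Rightarrow> ('a \<Rightarrow> 'a \<Rightarrow> real) \<Rightarrow> nat set \<Rightarrow> (nat \<Rightarrow> real) \<Rightarrow> bool" where
  "finite_trace M k I lam \<longleftrightarrow>
    integrable M (\<lambda>x. k x x) \<and> (lam has_sum (\<integral>x. k x x \<partial>M)) I"

text \<open>\<^const>\<open>infsum\<close> is zero where the family is not summable; for nonnegative summable \<open>lam\<close> this
  happens only on a null set.\<close>

definition chi_star :: "nat set \<Rightarrow> (nat \<Rightarrow> real) \<Rightarrow> real measure" where
  "chi_star I lam =
    distr (PiM I (\<lambda>_. std_normal_distribution)) borel (\<lambda>z. \<Sum>\<^sub>\<infinity>i\<in>I. lam i * (z i)\<^sup>2)"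

end

theory Submission
  imports Defs
begin

text \<open>Fix a parameter value \<open>t\<close>. The score-centered kernel is obtained from \<open>K t\<close> by projecting, in
  each argument separately, onto the orthogonal complement in \<open>L\<^sub>2(G t)\<close> of the span of the
  constant function and the score coordinates; \<open>proj_kernel\<close> is the kernel of the projection
  onto that span. Everything rests on two consequences.

  First, if the scores of a sample add up to zero, then integrating \<open>proj_kernel\<close> in one
  argument against the empirical distribution gives the constant 1, just as integrating against
  \<open>G t\<close> does. Hence the double integral of the score-centered kernel against the empirical
  distribution collapses to the quadratic distance (\<open>qdist_empirical_eq_scen\<close>). At the maximum
  likelihood estimator the statistic is therefore a V-statistic with an estimated parameter in
  its kernel, and the claim compares it with the V-statistic at the true parameter.

  Second, the kernel integrates to zero against 1 and against the score
  (\<open>scen_kernel_score_orthogonal\<close>). Differentiating \<open>\<integral> scen t x y dG\<^sub>t(y) = 0\<close> in \<open>t\<close> produces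
  the integral of the gradient of the kernel plus the integral of the kernel times the score;
  the latter vanishes, so the gradient kernel is again degenerate, and one further
  differentiation shows that the Hessian kernel has mean zero. In a third order Taylor expansion
  the estimation error has size \<open>n\<^sup>-\<^sup>1\<^sup>/\<^sup>2\<close>, the V-statistic of the degenerate gradient has size
  \<open>n\<^sup>-\<^sup>1\<close>, that of the mean-zero Hessian tends to 0, and that of the third derivatives is
  bounded. After multiplication by \<open>n\<close> all three terms vanish in probability
  (\<open>V_statistic_plug_in\<close>).

  It remains to find the limit law at the true parameter, \<open>degenerate_V_statistic_char_limit\<close>.
  The diagonal part of the V-statistic converges to the trace by the law of large numbers. The
  off-diagonal part is, uniformly in \<open>n\<close>, close in \<open>L\<^sub>2\<close> to the one built from finitely many
  terms of the spectral decomposition, and a finite-rank V-statistic is a quadratic form in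
  normalized sums of the eigenfunctions. The functions \<open>\<phi> i\<close> with \<open>lam i \<noteq> 0\<close> are centered and
  orthonormal, so every linear combination of these sums is asymptotically normal;
  \<open>product_weak_convergence\<close> upgrades this to the characteristic function of the quadratic form.
  Levy's continuity theorem concludes.\<close>

section \<open>Square-integrable functions\<close>

text \<open>The measurability of \<open>f\<close> matters: the empirical distribution is an image measure on the
  sigma-algebra of \<open>S\<close>, so an integral over it is an average only for functions measurable
  there.\<close>
lemma integral_empirical:
  fixes f :: "'a \<Rightarrow> real"
  assumes x: "\<And>i. i < n \<Longrightarrow> x i \<in> space S" and f: "f \<in> borel_measurable S"
  shows "(\<integral>z. f z \<partial>empirical S n x) = (\<Sum>i<n. f (x i)) / n"
proof -
  have "x \<in> uniform_count_measure {..<n} \<rightarrow>\<^sub>M S"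
    using x by (auto simp: measurable_def uniform_count_measure_def point_measure_def)
  then show ?thesis
    using f by (simp add: empirical_def integral_distr integral_uniform_count_measure)
qed

lemma finite_variance_integrable_mult:
  assumes "finite_variance N f" "finite_variance N h"
  shows "integrable N (\<lambda>x. f x * h x)"
proof (rule Bochner_Integration.integrable_bound[of _ "\<lambda>x. (f x)\<^sup>2 + (h x)\<^sup>2"])
  have "\<bar>f x * h x\<bar> \<le> (f x)\<^sup>2 + (h x)\<^sup>2" for x
    using sum_squares_bound[of "\<bar>f x\<bar>" "\<bar>h x\<bar>"] abs_ge_zero[of "f x * h x"]
    unfolding abs_mult[symmetric] mult.assoc power2_abs by linarith
  then show "AE x in N. norm (f x * h x) \<le> norm ((f x)\<^sup>2 + (h x)\<^sup>2)"
    unfolding real_norm_def by (intro AE_I2 order_trans[OF _ abs_ge_self])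
qed (use assms in \<open>auto simp: finite_variance_def\<close>)

lemma finite_variance_add:
  assumes "finite_variance N f" "finite_variance N h"
  shows "finite_variance N (\<lambda>x. f x + h x)"
proof -
  have "(f x + h x)\<^sup>2 = (f x)\<^sup>2 + (h x)\<^sup>2 + 2 * (f x * h x)" for x
    by (simp add: power2_sum)
  then show ?thesis
    using assms finite_variance_integrable_mult[OF assms] by (auto simp: finite_variance_def)
qed

lemma finite_variance_cmult:
  assumes "finite_variance N f"
  shows "finite_variance N (\<lambda>x. c * f x)"
  using assms by (auto simp: finite_variance_def power_mult_distrib)

lemma finite_variance_diff:
  assumes "finite_variance N f" "finite_variance N h"
  shows "finite_variance N (\<lambda>x. f x - h x)"
  using finite_variance_add[OF assms(1) finite_variance_cmult[OF assms(2), of "-1"]] by simp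

lemma finite_variance_sum:
  assumes "\<And>i. i \<in> A \<Longrightarrow> finite_variance N (f i)"
  shows "finite_variance N (\<lambda>x. \<Sum>i\<in>A. f i x)"
  using assms
proof (induction A rule: infinite_finite_induct)
  case (insert i A)
  then show ?case by (simp add: finite_variance_add)
qed (simp_all add: finite_variance_def)

lemma finite_variance_cong:
  assumes "finite_variance N f" "\<And>x. x \<in> space N \<Longrightarrow> f x = h x"
  shows "finite_variance N h"
  using assms
  by (auto simp: finite_variance_def cong: measurable_cong_simp Bochner_Integration.integrable_cong)

lemma (in prob_space) finite_variance_bounded:
  assumes "f \<in> borel_measurable M" "\<And>x. x \<in> space M \<Longrightarrow> \<bar>f x\<bar> \<le> B"
  shows "finite_variance M f"
proof -
  have "(f x)\<^sup>2 \<le> B\<^sup>2" if "x \<in> space M" for x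
    using power_mono[OF assms(2)[OF that], of 2] by simp
  then show ?thesis
    using assms unfolding finite_variance_def
    by (auto intro!: integrable_const_bound[of _ "B\<^sup>2"])
qed

lemma (in prob_space) finite_variance_integrable:
  "finite_variance M f \<Longrightarrow> integrable M f"
  unfolding finite_variance_def by (auto intro: square_integrable_imp_integrable)

text \<open>Tensor products are the building blocks of the finite-rank kernels below; their \<open>L\<^sub>2\<close> norm
  factorizes by Fubini.\<close>
lemma (in pair_prob_space) finite_variance_product:
  assumes "finite_variance M1 f" "finite_variance M2 h"
  shows "finite_variance (M1 \<Otimes>\<^sub>M M2) (\<lambda>(x, y). f x * h y)"
    and "(\<integral>z. (case z of (x, y) \<Rightarrow> f x * h y)\<^sup>2 \<partial>(M1 \<Otimes>\<^sub>M M2)) = (\<integral>x. (f x)\<^sup>2 \<partial>M1) * (\<integral>y. (h y)\<^sup>2 \<partial>M2)"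
proof -
  have [measurable]: "f \<in> borel_measurable M1" "h \<in> borel_measurable M2"
    and [simp]: "integrable M1 (\<lambda>x. (f x)\<^sup>2)" "integrable M2 (\<lambda>x. (h x)\<^sup>2)"
    using assms by (auto simp: finite_variance_def)
  have int: "integrable (M1 \<Otimes>\<^sub>M M2) (\<lambda>(x, y). (f x)\<^sup>2 * (h y)\<^sup>2)"
  proof (rule Fubini_integrable)
    show "integrable M1 (\<lambda>x. \<integral>y. norm (case (x, y) of (x, y) \<Rightarrow> (f x)\<^sup>2 * (h y)\<^sup>2) \<partial>M2)"
      by (simp add: abs_mult)
    show "AE x in M1. integrable M2 (\<lambda>y. case (x, y) of (x, y) \<Rightarrow> (f x)\<^sup>2 * (h y)\<^sup>2)"
      by simp
  qed measurable
  have eq: "(case z of (x, y) \<Rightarrow> f x * h y)\<^sup>2 = (case z of (x, y) \<Rightarrow> (f x)\<^sup>2 * (h y)\<^sup>2)" for z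
    by (auto simp: power_mult_distrib split: prod.split)
  show "finite_variance (M1 \<Otimes>\<^sub>M M2) (\<lambda>(x, y). f x * h y)"
    unfolding finite_variance_def eq using int by simp
  show "(\<integral>z. (case z of (x, y) \<Rightarrow> f x * h y)\<^sup>2 \<partial>(M1 \<Otimes>\<^sub>M M2)) = (\<integral>x. (f x)\<^sup>2 \<partial>M1) * (\<integral>y. (h y)\<^sup>2 \<partial>M2)"
    unfolding eq by (subst integral_fst'[OF int, symmetric]) simp
qed

section \<open>The score-centered kernel\<close>

text \<open>One parameter value is fixed: \<open>M\<close> is the model distribution, \<open>v\<close> the score and \<open>k\<close> the kernel.
  The quantities below are coordinates with respect to the extended score \<open>e\<close>: \<open>dual_score\<close> is
  its dual basis in \<open>L\<^sub>2(M)\<close>, so the projection onto the span of \<open>e\<close> is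
  \<open>f \<mapsto> \<Sum>i. dual_score i * \<integral> e i * f dM\<close>; the functions \<open>kernel_score\<close> and the matrix
  \<open>kernel_info\<close> are the coordinates of the kernel projected in one and in both arguments.\<close>
locale score_model = prob_space M for M :: "'a measure" +
  fixes v :: "'a \<Rightarrow> real^'p" and k :: "'a \<Rightarrow> 'a \<Rightarrow> real"
  assumes v_measurable [measurable]: "v \<in> borel_measurable M"
    and v_integrable: "integrable M v"
    and v_mean: "(\<integral>x. v x \<partial>M) = 0"
    and info_integrable:
      "\<And>i j. integrable M (\<lambda>x. ext_score v x $ i * ext_score v x $ j)"
    and info_invertible: "invertible (ext_info M v)"
    and k_measurable [measurable]: "(\<lambda>(x, y). k x y) \<in> borel_measurable (M \<Otimes>\<^sub>M M)"
    and k_bounded: "\<exists>B. \<forall>x\<in>space M. \<forall>y\<in>space M. \<bar>k x y\<bar> \<le> B"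
    and k_sym: "\<And>x y. x \<in> space M \<Longrightarrow> y \<in> space M \<Longrightarrow> k x y = k y x"
begin

abbreviation e :: "'p option \<Rightarrow> 'a \<Rightarrow> real" where
  "e i x \<equiv> ext_score v x $ i"

definition dual_score :: "'p option \<Rightarrow> 'a \<Rightarrow> real" where
  "dual_score i x = (matrix_inv (ext_info M v) *v ext_score v x) $ i"

definition kernel_score :: "'p option \<Rightarrow> 'a \<Rightarrow> real" where
  "kernel_score i y = (\<integral>z. k z y * e i z \<partial>M)"

definition kernel_info :: "'p option \<Rightarrow> 'p option \<Rightarrow> real" where
  "kernel_info i j = (\<integral>z. e i z * kernel_score j z \<partial>M)"

lemma e_simps [simp]: "e None x = 1" "e (Some i) x = v x $ i"
  by (simp_all add: ext_score_def)

lemma v_nth_measurable [measurable]: "(\<lambda>x. v x $ i) \<in> borel_measurable M"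
  proof -
  have "(\<lambda>z :: real^'p. z $ i) \<in> borel_measurable borel"
    by (intro borel_measurable_continuous_onI continuous_intros)
  from measurable_compose[OF v_measurable this] show ?thesis .
qed

lemma e_measurable [measurable]: "e i \<in> borel_measurable M"
  by (cases i) simp_all

lemma e_integrable: "integrable M (e i)"
  using info_integrable[of i None] by simp

lemma e_mean: "(\<integral>x. e i x \<partial>M) = (if i = None then 1 else 0)"
proof (cases i)
  case None
  then show ?thesis by (simp add: prob_space)
next
  case (Some j)
  have "(\<integral>x. v x $ j \<partial>M) = (\<integral>x. v x \<partial>M) $ j"
    by (rule integral_bounded_linear[OF bounded_linear_vec_nth v_integrable])
  then show ?thesis using Some v_mean by simp
qed

lemma ext_info_symmetric: "ext_info M v $ i $ j = ext_info M v $ j $ i"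
  by (simp add: ext_info_def mult.commute)

lemma inverse_info:
  "matrix_inv (ext_info M v) ** ext_info M v = mat 1"
  "ext_info M v ** matrix_inv (ext_info M v) = mat 1"
  using someI_ex[OF info_invertible[unfolded invertible_def]] unfolding matrix_inv_def by auto

text \<open>The inverse of a symmetric matrix is symmetric: its transpose is also a right inverse.\<close>
lemma inverse_info_symmetric:
  "matrix_inv (ext_info M v) $ i $ j = matrix_inv (ext_info M v) $ j $ i"
proof -
  let ?J = "ext_info M v" and ?A = "matrix_inv (ext_info M v)"
  have tJ: "transpose ?J = ?J"
    by (simp add: vec_eq_iff transpose_def ext_info_symmetric)
  have "?J ** transpose ?A = mat 1"
    using arg_cong[OF inverse_info(1), of transpose] by (simp add: matrix_transpose_mul tJ transpose_mat)
  then have "?A ** (?J ** transpose ?A) = ?A" by simp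
  then have "transpose ?A = ?A"
    by (simp add: matrix_mul_assoc inverse_info)
  from arg_cong[OF this, of "\<lambda>B. B $ j $ i"] show ?thesis by (simp add: transpose_def)
qed

lemma dual_score_sum: "dual_score i x = (\<Sum>j\<in>UNIV. matrix_inv (ext_info M v) $ i $ j * e j x)"
  by (simp add: dual_score_def matrix_vector_mult_def)

lemma dual_score_measurable [measurable]: "dual_score i \<in> borel_measurable M"
  unfolding dual_score_sum[abs_def] by measurable

lemma e_dual_integrable: "integrable M (\<lambda>x. dual_score i x * e j x)"
  unfolding dual_score_sum sum_distrib_right mult.assoc
  by (intro Bochner_Integration.integrable_sum integrable_mult_right info_integrable)

text \<open>Biorthogonality is the equation \<open>J\<^sup>-\<^sup>1 J = 1\<close> read coordinatewise.\<close>
lemma dual_integral: "(\<integral>x. dual_score i x * e j x \<partial>M) = (if i = j then 1 else 0)"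
proof -
  have "(\<integral>x. dual_score i x * e j x \<partial>M) =
      (\<Sum>l\<in>UNIV. matrix_inv (ext_info M v) $ i $ l * ext_info M v $ l $ j)"
    unfolding dual_score_sum sum_distrib_right mult.assoc
    by (subst Bochner_Integration.integral_sum)
       (auto intro!: integrable_mult_right info_integrable simp: ext_info_def)
  also have "\<dots> = (matrix_inv (ext_info M v) ** ext_info M v) $ i $ j"
    by (simp add: matrix_matrix_mult_def)
  finally show ?thesis by (simp add: inverse_info mat_def)
qed

lemma dual_square_integrable: "integrable M (\<lambda>x. (dual_score i x)\<^sup>2)"
proof -
  have "(dual_score i x)\<^sup>2 = (\<Sum>j\<in>UNIV. matrix_inv (ext_info M v) $ i $ j * (dual_score i x * e j x))" for x
    unfolding power2_eq_square
    by (subst (2) dual_score_sum) (simp add: sum_distrib_left mult.left_commute)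
  then show ?thesis
    by (auto intro!: Bochner_Integration.integrable_sum integrable_mult_right e_dual_integrable)
qed

text \<open>Both forms are needed, since the projection acts on the left argument of the kernel through
  one and on the right argument through the other; they agree because the inverse information is
  symmetric.\<close>
lemma proj_kernel_expand:
  "proj_kernel M v x z = (\<Sum>i\<in>UNIV. e i x * dual_score i z)"
  "proj_kernel M v x z = (\<Sum>i\<in>UNIV. dual_score i x * e i z)"
proof -
  show "proj_kernel M v x z = (\<Sum>i\<in>UNIV. e i x * dual_score i z)"
    by (simp add: proj_kernel_def inner_vec_def dual_score_def)
  also have "\<dots> = (\<Sum>i\<in>UNIV. \<Sum>j\<in>UNIV. matrix_inv (ext_info M v) $ i $ j * e i x * e j z)"
    by (intro sum.cong refl) (simp add: dual_score_sum sum_distrib_left mult.assoc mult.left_commute)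
  also have "\<dots> = (\<Sum>j\<in>UNIV. \<Sum>i\<in>UNIV. matrix_inv (ext_info M v) $ i $ j * e i x * e j z)"
    by (rule sum.swap)
  also have "\<dots> = (\<Sum>j\<in>UNIV. \<Sum>i\<in>UNIV. matrix_inv (ext_info M v) $ j $ i * e i x * e j z)"
    by (intro sum.cong refl) (simp add: inverse_info_symmetric)
  also have "\<dots> = (\<Sum>i\<in>UNIV. dual_score i x * e i z)"
    by (intro sum.cong refl) (simp only: dual_score_sum sum_distrib_right)
  finally show "proj_kernel M v x z = (\<Sum>i\<in>UNIV. dual_score i x * e i z)" .
qed

lemma k_bound: "\<exists>B\<ge>0. \<forall>x\<in>space M. \<forall>y\<in>space M. \<bar>k x y\<bar> \<le> B"
proof -
  obtain B where "\<forall>x\<in>space M. \<forall>y\<in>space M. \<bar>k x y\<bar> \<le> B" using k_bounded by blast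
  then show ?thesis
    by (intro exI[of _ "\<bar>B\<bar>"]) (meson abs_ge_self abs_ge_zero order_trans)
qed

lemma k_section_measurable [measurable]:
  "x \<in> space M \<Longrightarrow> k x \<in> borel_measurable M"
  "y \<in> space M \<Longrightarrow> (\<lambda>x. k x y) \<in> borel_measurable M"
  using measurable_Pair2[OF k_measurable, of x] measurable_Pair1[OF k_measurable, of y] by simp_all

lemma k_mult_integrable:
  fixes f :: "'a \<Rightarrow> real"
  assumes "integrable M f" "y \<in> space M"
  shows "integrable M (\<lambda>z. k z y * f z)"
proof -
  obtain B where B: "0 \<le> B" "\<And>x y. x \<in> space M \<Longrightarrow> y \<in> space M \<Longrightarrow> \<bar>k x y\<bar> \<le> B"
    using k_bound by blast
  have [measurable]: "f \<in> borel_measurable M" using assms by auto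
  show ?thesis
  proof (rule Bochner_Integration.integrable_bound[of M "\<lambda>z. B * f z"])
    show "AE z in M. norm (k z y * f z) \<le> norm (B * f z)"
      using B assms(2) by (auto simp: abs_mult intro!: mult_right_mono)
    show "(\<lambda>z. k z y * f z) \<in> borel_measurable M" using assms(2) by measurable
  qed (use assms in auto)
qed

lemma kernel_score_measurable [measurable]: "kernel_score i \<in> borel_measurable M"
  unfolding kernel_score_def[abs_def] by measurable

lemma kernel_score_bounded: "\<exists>C. \<forall>y\<in>space M. \<bar>kernel_score i y\<bar> \<le> C"
proof -
  obtain B where B: "0 \<le> B" "\<And>x y. x \<in> space M \<Longrightarrow> y \<in> space M \<Longrightarrow> \<bar>k x y\<bar> \<le> B"
    using k_bound by blast
  have "\<bar>kernel_score i y\<bar> \<le> (\<integral>z. B * \<bar>e i z\<bar> \<partial>M)" if y: "y \<in> space M" for y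
  proof -
    have "\<bar>kernel_score i y\<bar> \<le> (\<integral>z. \<bar>k z y * e i z\<bar> \<partial>M)"
      unfolding kernel_score_def by (rule integral_abs_bound)
    also have "\<dots> \<le> (\<integral>z. B * \<bar>e i z\<bar> \<partial>M)"
      using B y e_integrable by (intro integral_mono integrable_abs k_mult_integrable)
        (auto simp: abs_mult intro!: mult_right_mono)
    finally show ?thesis .
  qed
  then show ?thesis by blast
qed

lemma kernel_score_mult_integrable:
  fixes f :: "'a \<Rightarrow> real"
  assumes "integrable M f"
  shows "integrable M (\<lambda>z. kernel_score i z * f z)"
proof -
  obtain B where B: "\<forall>y\<in>space M. \<bar>kernel_score i y\<bar> \<le> B" using kernel_score_bounded by blast
  have [measurable]: "f \<in> borel_measurable M" using assms by auto
  show ?thesis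
  proof (rule Bochner_Integration.integrable_bound[of M "\<lambda>z. B * f z"])
    show "AE z in M. norm (kernel_score i z * f z) \<le> norm (B * f z)"
      using B by (auto simp: abs_mult intro!: mult_right_mono AE_I2 intro: order_trans[OF _ abs_ge_self])
  qed (use assms in auto)
qed

lemma k_product_integrable:
  fixes f h :: "'a \<Rightarrow> real"
  assumes "integrable M f" "integrable M h"
  shows "integrable (M \<Otimes>\<^sub>M M) (\<lambda>(x, y). k x y * (f x * h y))"
proof -
  interpret MM: pair_prob_space M M ..
  obtain B where B: "0 \<le> B" "\<And>x y. x \<in> space M \<Longrightarrow> y \<in> space M \<Longrightarrow> \<bar>k x y\<bar> \<le> B"
    using k_bound by blast
  have [measurable]: "f \<in> borel_measurable M" "h \<in> borel_measurable M" using assms by auto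
  have "integrable (M \<Otimes>\<^sub>M M) (\<lambda>(x, y). f x * h y)"
  proof (rule MM.Fubini_integrable)
    show "integrable M (\<lambda>x. \<integral>y. norm (case (x, y) of (x, y) \<Rightarrow> f x * h y) \<partial>M)"
      using assms by (simp add: abs_mult)
    show "AE x in M. integrable M (\<lambda>y. case (x, y) of (x, y) \<Rightarrow> f x * h y)"
      using assms by simp
  qed auto
  then have "integrable (M \<Otimes>\<^sub>M M) (\<lambda>z. B * (case z of (x, y) \<Rightarrow> f x * h y))"
    by (rule integrable_mult_right)
  then show ?thesis
  proof (rule Bochner_Integration.integrable_bound)
    show "AE z in M \<Otimes>\<^sub>M M. norm (case z of (x, y) \<Rightarrow> k x y * (f x * h y))
        \<le> norm (B * (case z of (x, y) \<Rightarrow> f x * h y))"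
      using B by (auto simp: space_pair_measure abs_mult intro!: mult_right_mono AE_I2)
  qed measurable
qed

lemma kernel_info_symmetric: "kernel_info i j = kernel_info j i"
proof -
  interpret MM: pair_prob_space M M ..
  have int: "integrable (M \<Otimes>\<^sub>M M) (\<lambda>(x, y). k x y * (e j x * e i y))"
    by (intro k_product_integrable e_integrable)
  have "kernel_info i j = (\<integral>y. (\<integral>x. k x y * (e j x * e i y) \<partial>M) \<partial>M)"
    unfolding kernel_info_def kernel_score_def
    by (intro Bochner_Integration.integral_cong refl) (simp add: mult_ac flip: integral_mult_right_zero)
  also have "\<dots> = (\<integral>x. (\<integral>y. k x y * (e j x * e i y) \<partial>M) \<partial>M)"
    using MM.Fubini_integral[OF int] by simp
  also have "\<dots> = (\<integral>x. (\<integral>y. e j x * (k y x * e i y) \<partial>M) \<partial>M)"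
    by (intro Bochner_Integration.integral_cong refl) (simp add: k_sym mult_ac)
  also have "\<dots> = kernel_info j i"
    unfolding kernel_info_def kernel_score_def by simp
  finally show ?thesis .
qed

text \<open>All four integrals defining the score-centered kernel are finite sums of products of functions
  of one variable. This separated form makes measurability, symmetry, square integrability and
  the orthogonality relations accessible.\<close>
lemma scen_kernel_expand:
  assumes x: "x \<in> space M" and y: "y \<in> space M"
  shows "scen_kernel M v k x y = k x y
    - (\<Sum>i\<in>UNIV. dual_score i x * kernel_score i y)
    - (\<Sum>i\<in>UNIV. kernel_score i x * dual_score i y)
    + (\<Sum>i\<in>UNIV. \<Sum>j\<in>UNIV. dual_score i x * kernel_info i j * dual_score j y)"
proof -
  have left: "(\<integral>z. proj_kernel M v x' z * k z y' \<partial>M) = (\<Sum>i\<in>UNIV. dual_score i x' * kernel_score i y')"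
    if "y' \<in> space M" for x' y'
  proof -
    have "(\<integral>z. proj_kernel M v x' z * k z y' \<partial>M)
        = (\<integral>z. (\<Sum>i\<in>UNIV. dual_score i x' * (k z y' * e i z)) \<partial>M)"
      by (simp add: proj_kernel_expand(2) sum_distrib_right sum_distrib_left mult_ac)
    also have "\<dots> = (\<Sum>i\<in>UNIV. dual_score i x' * kernel_score i y')"
      unfolding kernel_score_def using that
      by (subst Bochner_Integration.integral_sum)
         (auto intro!: integrable_mult_right k_mult_integrable e_integrable)
    finally show ?thesis .
  qed
  have right: "(\<integral>z. k x' z * proj_kernel M v z y' \<partial>M) = (\<Sum>i\<in>UNIV. kernel_score i x' * dual_score i y')"
    if "x' \<in> space M" for x' y'
  proof -
    have "(\<integral>z. k x' z * proj_kernel M v z y' \<partial>M)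
        = (\<integral>z. (\<Sum>i\<in>UNIV. (k z x' * e i z) * dual_score i y') \<partial>M)"
      using that by (intro Bochner_Integration.integral_cong refl)
        (simp add: proj_kernel_expand(1) sum_distrib_left k_sym[of x'] mult_ac)
    also have "\<dots> = (\<Sum>i\<in>UNIV. kernel_score i x' * dual_score i y')"
      unfolding kernel_score_def using that
      by (subst Bochner_Integration.integral_sum)
         (auto intro!: integrable_mult_left k_mult_integrable e_integrable)
    finally show ?thesis .
  qed
  have "(\<integral>z. (\<integral>w. proj_kernel M v x z * k z w * proj_kernel M v w y \<partial>M) \<partial>M)
      = (\<integral>z. proj_kernel M v x z * (\<integral>w. k z w * proj_kernel M v w y \<partial>M) \<partial>M)"
    by (simp add: mult.assoc)
  also have "\<dots> = (\<integral>z. (\<Sum>i\<in>UNIV. \<Sum>j\<in>UNIV. dual_score i x * dual_score j y * (e i z * kernel_score j z)) \<partial>M)"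
    by (intro Bochner_Integration.integral_cong refl)
       (simp only: right, simp add: proj_kernel_expand(2) sum_product mult_ac)
  also have "\<dots> = (\<Sum>i\<in>UNIV. \<Sum>j\<in>UNIV. dual_score i x * dual_score j y * kernel_info i j)"
  proof -
    have "integrable M (\<lambda>z. e i z * kernel_score j z)" for i j
      using kernel_score_mult_integrable[OF e_integrable, of j i] by (simp add: mult.commute)
    then show ?thesis
      unfolding kernel_info_def
      by (simp add: Bochner_Integration.integral_sum Bochner_Integration.integrable_sum)
  qed
  also have "\<dots> = (\<Sum>i\<in>UNIV. \<Sum>j\<in>UNIV. dual_score i x * kernel_info i j * dual_score j y)"
    by (simp add: mult_ac)
  finally show ?thesis
    by (simp add: scen_kernel_def left[OF y] right[OF x])
qed

lemma scen_kernel_measurable: "(\<lambda>(x, y). scen_kernel M v k x y) \<in> borel_measurable (M \<Otimes>\<^sub>M M)"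
proof -
  have "(\<lambda>(x, y). k x y
    - (\<Sum>i\<in>UNIV. dual_score i x * kernel_score i y)
    - (\<Sum>i\<in>UNIV. kernel_score i x * dual_score i y)
    + (\<Sum>i\<in>UNIV. \<Sum>j\<in>UNIV. dual_score i x * kernel_info i j * dual_score j y)) \<in> borel_measurable (M \<Otimes>\<^sub>M M)"
    by measurable
  then show ?thesis
    by (rule measurable_cong[THEN iffD1, rotated]) (auto simp: scen_kernel_expand space_pair_measure)
qed

lemma scen_kernel_sym:
  assumes "x \<in> space M" "y \<in> space M"
  shows "scen_kernel M v k x y = scen_kernel M v k y x"
proof -
  have "(\<Sum>i\<in>UNIV. \<Sum>j\<in>UNIV. dual_score i x * kernel_info i j * dual_score j y) =
        (\<Sum>j\<in>UNIV. \<Sum>i\<in>UNIV. dual_score i x * kernel_info i j * dual_score j y)"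
    by (rule sum.swap)
  also have "\<dots> = (\<Sum>j\<in>UNIV. \<Sum>i\<in>UNIV. dual_score j y * kernel_info j i * dual_score i x)"
    by (intro sum.cong refl) (simp add: mult.commute mult.left_commute kernel_info_symmetric)
  finally show ?thesis
    unfolding scen_kernel_expand[OF assms] scen_kernel_expand[OF assms(2) assms(1)]
    using k_sym[OF assms] by (simp add: mult.commute)
qed

lemma finite_variance_e: "finite_variance M (e i)"
  using info_integrable[of i i] by (simp add: finite_variance_def power2_eq_square)

lemma finite_variance_dual: "finite_variance M (dual_score i)"
  using dual_square_integrable by (simp add: finite_variance_def)

lemma finite_variance_kernel_score: "finite_variance M (kernel_score i)"
  using kernel_score_bounded[of i] by (auto intro: finite_variance_bounded)

lemma finite_variance_scen_kernel:
  "finite_variance (M \<Otimes>\<^sub>M M) (\<lambda>(x, y). scen_kernel M v k x y)"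
proof -
  interpret MM: pair_prob_space M M ..
  obtain B where B: "\<And>x y. x \<in> space M \<Longrightarrow> y \<in> space M \<Longrightarrow> \<bar>k x y\<bar> \<le> B"
    using k_bound by blast
  have "finite_variance (M \<Otimes>\<^sub>M M) (\<lambda>z. (case z of (x, y) \<Rightarrow> k x y)
    - (\<Sum>i\<in>UNIV. case z of (x, y) \<Rightarrow> dual_score i x * kernel_score i y)
    - (\<Sum>i\<in>UNIV. case z of (x, y) \<Rightarrow> kernel_score i x * dual_score i y)
    + (\<Sum>i\<in>UNIV. \<Sum>j\<in>UNIV. kernel_info i j * (case z of (x, y) \<Rightarrow> dual_score i x * dual_score j y)))"
    by (intro finite_variance_add finite_variance_diff finite_variance_sum finite_variance_cmult
        MM.finite_variance_product finite_variance_dual finite_variance_kernel_score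
        MM.P.finite_variance_bounded[of _ B])
       (auto simp: space_pair_measure B)
  then show ?thesis
    by (rule finite_variance_cong) (auto simp: scen_kernel_expand space_pair_measure mult_ac)
qed

lemma finite_variance_scen_section:
  assumes x: "x \<in> space M"
  shows "finite_variance M (scen_kernel M v k x)"
proof -
  obtain B where B: "\<And>x y. x \<in> space M \<Longrightarrow> y \<in> space M \<Longrightarrow> \<bar>k x y\<bar> \<le> B"
    using k_bound by blast
  have "finite_variance M (\<lambda>y. k x y
    - (\<Sum>i\<in>UNIV. dual_score i x * kernel_score i y)
    - (\<Sum>i\<in>UNIV. kernel_score i x * dual_score i y)
    + (\<Sum>i\<in>UNIV. \<Sum>j\<in>UNIV. (dual_score i x * kernel_info i j) * dual_score j y))"
    using x by (intro finite_variance_add finite_variance_diff finite_variance_sum finite_variance_cmult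
        finite_variance_dual finite_variance_kernel_score finite_variance_bounded[of _ B])
       (auto simp: B)
  then show ?thesis
    by (rule finite_variance_cong) (auto simp: scen_kernel_expand x)
qed

text \<open>Projecting away the span of the extended score leaves something orthogonal to it. In
  coordinates the first and third terms of the expansion cancel, and the second and fourth
  cancel by symmetry of \<open>kernel_info\<close>.\<close>
lemma scen_kernel_score_orthogonal:
  assumes x: "x \<in> space M"
  shows "(\<integral>y. scen_kernel M v k x y * e i y \<partial>M) = 0"
proof -
  have ks: "integrable M (\<lambda>y. kernel_score j y * e i y)" for j
    by (intro kernel_score_mult_integrable e_integrable)
  have kx: "integrable M (\<lambda>y. k x y * e i y)"
    using k_mult_integrable[OF e_integrable x, of i]
    by (rule Bochner_Integration.integrable_cong[THEN iffD1, rotated 2]) (auto simp: k_sym x)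
  have kxi: "(\<integral>y. k x y * e i y \<partial>M) = kernel_score i x"
    unfolding kernel_score_def by (intro Bochner_Integration.integral_cong refl) (simp add: k_sym x)
  have ksi: "(\<integral>y. kernel_score j y * e i y \<partial>M) = kernel_info i j" for j
    by (simp add: kernel_info_def mult.commute)
  have "(\<integral>y. scen_kernel M v k x y * e i y \<partial>M) =
    (\<integral>y. k x y * e i y
    - (\<Sum>j\<in>UNIV. dual_score j x * (kernel_score j y * e i y))
    - (\<Sum>j\<in>UNIV. kernel_score j x * (dual_score j y * e i y))
    + (\<Sum>j\<in>UNIV. \<Sum>l\<in>UNIV. dual_score j x * kernel_info j l * (dual_score l y * e i y)) \<partial>M)"
    by (intro Bochner_Integration.integral_cong refl)
       (simp add: scen_kernel_expand x algebra_simps sum_distrib_left sum_distrib_right)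
  also have "\<dots> = kernel_score i x
    - (\<Sum>j\<in>UNIV. dual_score j x * kernel_info i j)
    - (\<Sum>j\<in>UNIV. kernel_score j x * (if j = i then 1 else 0))
    + (\<Sum>j\<in>UNIV. \<Sum>l\<in>UNIV. dual_score j x * kernel_info j l * (if l = i then 1 else 0))"
    using kx ks e_dual_integrable
    by (simp add: Bochner_Integration.integral_sum Bochner_Integration.integrable_sum
        Bochner_Integration.integral_add Bochner_Integration.integral_diff
        Bochner_Integration.integrable_add Bochner_Integration.integrable_diff kxi ksi dual_integral)
  also have "\<dots> = 0"
    by (simp add: kernel_info_symmetric[of i] if_distrib[of "(*) _"] cong: if_cong)
  finally show ?thesis .
qed

lemma scen_kernel_centred:
  assumes "x \<in> space M"
  shows "(\<integral>y. scen_kernel M v k x y \<partial>M) = 0"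
  using scen_kernel_score_orthogonal[OF assms, of None] by simp

text \<open>When the scores add up to zero, the sample sums of \<open>e\<close> are \<open>n\<close> times the first column of the
  information matrix, which is the first unit vector. Applying the inverse keeps that vector.\<close>
lemma sum_dual_score:
  assumes "(\<Sum>a<n. v (x a)) = 0"
  shows "(\<Sum>a<n. dual_score i (x a)) = (if i = None then real n else 0)"
proof -
  have J: "ext_info M v $ j $ None = (if j = None then 1 else 0)" for j
    using e_mean[of j] by (simp add: ext_info_def)
  have se: "(\<Sum>a<n. e j (x a)) = real n * ext_info M v $ j $ None" for j
  proof (cases j)
    case (Some l)
    have "(\<Sum>a<n. v (x a) $ l) = (\<Sum>a<n. v (x a)) $ l" by simp
    then show ?thesis using Some assms J by simp
  qed (simp add: J)
  have "(\<Sum>a<n. dual_score i (x a)) = (\<Sum>j\<in>UNIV. matrix_inv (ext_info M v) $ i $ j * (\<Sum>a<n. e j (x a)))"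
    unfolding dual_score_sum sum_distrib_left by (rule sum.swap)
  also have "\<dots> = real n * (\<Sum>j\<in>UNIV. matrix_inv (ext_info M v) $ i $ j * ext_info M v $ j $ None)"
    by (simp add: se sum_distrib_left mult.left_commute)
  also have "\<dots> = real n * (matrix_inv (ext_info M v) ** ext_info M v) $ i $ None"
    by (simp add: matrix_matrix_mult_def)
  finally show ?thesis by (simp add: inverse_info mat_def)
qed

text \<open>By \<open>sum_dual_score\<close> only the constant coordinate of each projection term survives the
  summation, and the constant coordinates are the integrals of \<open>k\<close> against \<open>M\<close> in one or both
  arguments. These are exactly the mixed terms and the last term of the quadratic distance.\<close>
lemma qdist_empirical_eq_scen:
  assumes n: "0 < n" and S: "sets S = sets M"
    and x: "\<And>a. a < n \<Longrightarrow> x a \<in> space M" and score: "(\<Sum>a<n. v (x a)) = 0"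
  shows "qdist k (empirical S n x) M = (\<Sum>a<n. \<Sum>b<n. scen_kernel M v k (x a) (x b)) / (real n)\<^sup>2"
proof -
  have sp: "space S = space M" using S by (rule sets_eq_imp_space_eq)
  have xS: "\<And>a. a < n \<Longrightarrow> x a \<in> space S" using x sp by simp
  have meas: "f \<in> borel_measurable M \<Longrightarrow> f \<in> borel_measurable S" for f :: "'a \<Rightarrow> real"
    using S by (simp cong: measurable_cong_sets)
  note emp = integral_empirical[OF xS meas]
  have k_right: "(\<integral>y. k z y \<partial>empirical S n x) = (\<Sum>b<n. k z (x b)) / n" if "z \<in> space M" for z
    using that by (intro emp) auto
  have k_M: "(\<integral>y. k z y \<partial>M) = kernel_score None z" if "z \<in> space M" for z
    unfolding kernel_score_def using that by (intro Bochner_Integration.integral_cong refl) (simp add: k_sym)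
  have emp_cong: "(\<integral>z. f z \<partial>empirical S n x) = (\<Sum>a<n. h (x a)) / n"
    if "\<And>z. z \<in> space M \<Longrightarrow> f z = h z" "h \<in> borel_measurable M" for f h :: "'a \<Rightarrow> real"
  proof -
    have "(\<integral>z. f z \<partial>empirical S n x) = (\<integral>z. h z \<partial>empirical S n x)"
      by (intro Bochner_Integration.integral_cong refl) (simp add: that(1) empirical_def sp)
    then show ?thesis using that(2) by (simp add: emp)
  qed
  have EE: "dint k (empirical S n x) (empirical S n x) = (\<Sum>a<n. \<Sum>b<n. k (x a) (x b)) / (real n)\<^sup>2"
    unfolding dint_def
    using x by (subst emp_cong[of _ "\<lambda>z. (\<Sum>b<n. k z (x b)) / n"])
      (auto simp: k_right sum_divide_distrib power2_eq_square)
  have EM: "dint k (empirical S n x) M = (\<Sum>a<n. kernel_score None (x a)) / n"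
    unfolding dint_def by (rule emp_cong) (auto simp: k_M)
  have k_int: "integrable M (\<lambda>z. k z y)" if "y \<in> space M" for y
    using k_mult_integrable[OF e_integrable that, of None] by simp
  have "dint k M (empirical S n x) = (\<integral>z. (\<Sum>b<n. k z (x b)) / n \<partial>M)"
    unfolding dint_def by (intro Bochner_Integration.integral_cong refl k_right)
  also have "\<dots> = (\<Sum>b<n. \<integral>z. k z (x b) \<partial>M) / n"
    using x by (simp add: k_int)
  finally have ME: "dint k M (empirical S n x) = (\<Sum>a<n. kernel_score None (x a)) / n"
    by (simp add: kernel_score_def)
  have "dint k M M = (\<integral>z. kernel_score None z \<partial>M)"
    unfolding dint_def by (intro Bochner_Integration.integral_cong refl k_M)
  then have MM: "dint k M M = kernel_info None None"
    by (simp add: kernel_info_def)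
  have delta: "(\<Sum>a<n. \<Sum>b<n. \<Sum>i\<in>UNIV. dual_score i (x a) * kernel_score i (x b)) =
      real n * (\<Sum>b<n. kernel_score None (x b))"
  proof -
    have "(\<Sum>a<n. \<Sum>b<n. \<Sum>i\<in>UNIV. dual_score i (x a) * kernel_score i (x b)) =
        (\<Sum>i\<in>UNIV. (\<Sum>a<n. dual_score i (x a)) * (\<Sum>b<n. kernel_score i (x b)))"
      by (simp add: sum_product sum.swap[of _ UNIV])
    also have "\<dots> = (\<Sum>i\<in>UNIV. if i = None then real n * (\<Sum>b<n. kernel_score i (x b)) else 0)"
      by (intro sum.cong refl) (simp add: sum_dual_score[OF score])
    finally show ?thesis by simp
  qed
  have delta': "(\<Sum>a<n. \<Sum>b<n. \<Sum>i\<in>UNIV. kernel_score i (x a) * dual_score i (x b)) =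
      real n * (\<Sum>b<n. kernel_score None (x b))"
    by (subst sum.swap) (simp only: mult.commute[of "kernel_score _ _"] delta)
  have delta2: "(\<Sum>a<n. \<Sum>b<n. \<Sum>i\<in>UNIV. \<Sum>j\<in>UNIV. dual_score i (x a) * kernel_info i j * dual_score j (x b))
      = (real n)\<^sup>2 * kernel_info None None"
  proof -
    have "(\<Sum>a<n. \<Sum>b<n. \<Sum>i\<in>UNIV. \<Sum>j\<in>UNIV. dual_score i (x a) * kernel_info i j * dual_score j (x b)) =
        (\<Sum>i\<in>UNIV. \<Sum>j\<in>UNIV. (\<Sum>a<n. dual_score i (x a)) * kernel_info i j * (\<Sum>b<n. dual_score j (x b)))"
      (is "(\<Sum>a<n. \<Sum>b<n. \<Sum>i\<in>UNIV. \<Sum>j\<in>UNIV. ?T a b i j) = _")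
    proof -
      have "(\<Sum>a<n. \<Sum>b<n. \<Sum>i\<in>UNIV. \<Sum>j\<in>UNIV. ?T a b i j) = (\<Sum>a<n. \<Sum>i\<in>UNIV. \<Sum>b<n. \<Sum>j\<in>UNIV. ?T a b i j)"
        by (intro sum.cong refl sum.swap)
      also have "\<dots> = (\<Sum>i\<in>UNIV. \<Sum>a<n. \<Sum>b<n. \<Sum>j\<in>UNIV. ?T a b i j)"
        by (rule sum.swap)
      also have "\<dots> = (\<Sum>i\<in>UNIV. \<Sum>a<n. \<Sum>j\<in>UNIV. \<Sum>b<n. ?T a b i j)"
        by (intro sum.cong refl sum.swap)
      also have "\<dots> = (\<Sum>i\<in>UNIV. \<Sum>j\<in>UNIV. \<Sum>a<n. \<Sum>b<n. ?T a b i j)"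
        by (intro sum.cong refl sum.swap)
      also have "\<dots> = (\<Sum>i\<in>UNIV. \<Sum>j\<in>UNIV. (\<Sum>a<n. dual_score i (x a)) * kernel_info i j *
          (\<Sum>b<n. dual_score j (x b)))"
        by (simp only: sum_distrib_left sum_distrib_right) (intro sum.cong refl sum.swap)
      finally show ?thesis .
    qed
    also have "\<dots> = (\<Sum>i\<in>UNIV. if i = None then (\<Sum>j\<in>UNIV. if j
        = None then real n * kernel_info i j * real n else 0) else 0)"
      by (intro sum.cong refl) (auto simp: sum_dual_score[OF score] if_distrib[of "(*) _"] cong: if_cong)
    finally show ?thesis
      by (simp add: power2_eq_square)
  qed
  have total: "(\<Sum>a<n. \<Sum>b<n. scen_kernel M v k (x a) (x b)) =
      (\<Sum>a<n. \<Sum>b<n. k (x a) (x b)) - 2 * (real n * (\<Sum>b<n. kernel_score None (x b)))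
      + (real n)\<^sup>2 * kernel_info None None"
    using x by (simp add: scen_kernel_expand sum.distrib sum_subtractf delta delta' delta2)
  show ?thesis
    unfolding qdist_def EE EM ME MM total using n
    by (simp add: add_divide_distrib diff_divide_distrib power2_eq_square)
qed

end

section \<open>Moments and limit theorems for independent samples\<close>

text \<open>The variance of \<open>\<bar>f\<bar>\<close> is nonnegative.\<close>
lemma (in prob_space) integral_abs_le_sqrt:
  fixes f :: "'a \<Rightarrow> real"
  assumes "finite_variance M f"
  shows "(\<integral>x. \<bar>f x\<bar> \<partial>M) \<le> sqrt (\<integral>x. (f x)\<^sup>2 \<partial>M)"
proof -
  have "integrable M f" by (rule finite_variance_integrable[OF assms])
  then have "variance (\<lambda>x. \<bar>f x\<bar>) = (\<integral>x. (f x)\<^sup>2 \<partial>M) - (\<integral>x. \<bar>f x\<bar> \<partial>M)\<^sup>2"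
    using assms by (subst variance_eq) (auto simp: finite_variance_def)
  then have "(\<integral>x. \<bar>f x\<bar> \<partial>M)\<^sup>2 \<le> (\<integral>x. (f x)\<^sup>2 \<partial>M)"
    using variance_positive[of "\<lambda>x. \<bar>f x\<bar>"] by linarith
  then show ?thesis by (rule real_le_rsqrt)
qed

text \<open>The law \<open>D\<close> doubles as the measurable space of the observations, so that \<open>law\<close> reads as an
  equation between measures on the same sigma-algebra.\<close>
locale iid_sample = prob_space M for M :: "'w measure" +
  fixes D :: "'a measure" and X :: "nat \<Rightarrow> 'w \<Rightarrow> 'a"
  assumes indep: "indep_vars (\<lambda>_. D) X UNIV"
    and law: "\<And>i. distr M D (X i) = D"
begin

lemma X_measurable [measurable]: "X i \<in> M \<rightarrow>\<^sub>M D"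
  using indep by (auto simp: indep_vars_def)

sublocale D: prob_space D
  using prob_space_distr[OF X_measurable[of 0]] by (simp add: law)

sublocale DD: pair_prob_space D D ..

lemma pair_law:
  assumes "a \<noteq> b"
  shows "distr M (D \<Otimes>\<^sub>M D) (\<lambda>w. (X a w, X b w)) = D \<Otimes>\<^sub>M D"
proof -
  have "indep_var (PiM {a} (\<lambda>_. D)) (\<lambda>w. restrict (\<lambda>i. X i w) {a}) (PiM {b} (\<lambda>_. D))
      (\<lambda>w. restrict (\<lambda>i. X i w) {b})"
    using assms by (intro indep_var_restrict[OF indep]) auto
  then have "indep_var D ((\<lambda>f. f a) \<circ> (\<lambda>w. restrict (\<lambda>i. X i w) {a})) D
      ((\<lambda>f. f b) \<circ> (\<lambda>w. restrict (\<lambda>i. X i w) {b}))"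
    by (rule indep_var_compose) measurable
  then have "indep_var D (X a) D (X b)" by (simp add: comp_def)
  then show ?thesis
    by (simp add: indep_var_distribution_eq law)
qed

lemma integrable_single:
  fixes f :: "'a \<Rightarrow> real"
  assumes "integrable D f"
  shows "integrable M (\<lambda>w. f (X a w))" and "(\<integral>w. f (X a w) \<partial>M) = (\<integral>x. f x \<partial>D)"
proof -
  have [measurable]: "f \<in> borel_measurable D" using assms by simp
  have "integrable (distr M D (X a)) f" using assms by (simp add: law)
  then show "integrable M (\<lambda>w. f (X a w))" by (subst (asm) integrable_distr_eq) auto
  show "(\<integral>w. f (X a w) \<partial>M) = (\<integral>x. f x \<partial>D)"
    using integral_distr[OF X_measurable[of a], of f] by (simp add: law)
qed

lemma integrable_pair:
  fixes f :: "'a \<times> 'a \<Rightarrow> real"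
  assumes "integrable (D \<Otimes>\<^sub>M D) f" "a \<noteq> b"
  shows "integrable M (\<lambda>w. f (X a w, X b w))"
    and "(\<integral>w. f (X a w, X b w) \<partial>M) = (\<integral>z. f z \<partial>(D \<Otimes>\<^sub>M D))"
proof -
  have [measurable]: "f \<in> borel_measurable (D \<Otimes>\<^sub>M D)" using assms by simp
  have "integrable (distr M (D \<Otimes>\<^sub>M D) (\<lambda>w. (X a w, X b w))) f" using assms by (simp add: pair_law)
  then show "integrable M (\<lambda>w. f (X a w, X b w))" by (subst (asm) integrable_distr_eq) auto
  have "(\<lambda>w. (X a w, X b w)) \<in> M \<rightarrow>\<^sub>M D \<Otimes>\<^sub>M D" by measurable
  from integral_distr[OF this, of f]
  show "(\<integral>w. f (X a w, X b w) \<partial>M) = (\<integral>z. f z \<partial>(D \<Otimes>\<^sub>M D))"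
    using assms(2) by (simp add: pair_law)
qed

lemma AE_single:
  assumes "AE x in D. P x"
  shows "AE w in M. P (X a w)"
  by (rule AE_distrD[OF X_measurable[of a], unfolded law, OF assms])

lemma AE_pair:
  assumes "AE z in D \<Otimes>\<^sub>M D. P z" "a \<noteq> b"
  shows "AE w in M. P (X a w, X b w)"
proof -
  have "(\<lambda>w. (X a w, X b w)) \<in> M \<rightarrow>\<^sub>M D \<Otimes>\<^sub>M D" by measurable
  from AE_distrD[OF this, unfolded pair_law[OF assms(2)], OF assms(1)] show ?thesis .
qed

lemma finite_variance_single:
  assumes "finite_variance D f"
  shows "finite_variance M (\<lambda>w. f (X a w))"
  using assms integrable_single(1)[of "\<lambda>x. (f x)\<^sup>2" a] by (auto simp: finite_variance_def)

lemma finite_variance_pair: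
  assumes "finite_variance (D \<Otimes>\<^sub>M D) f" "a \<noteq> b"
  shows "finite_variance M (\<lambda>w. f (X a w, X b w))"
proof -
  have [measurable]: "f \<in> borel_measurable (D \<Otimes>\<^sub>M D)"
    using assms by (simp add: finite_variance_def)
  show ?thesis
    using assms integrable_pair(1)[of "\<lambda>z. (f z)\<^sup>2" a b] by (auto simp: finite_variance_def)
qed

text \<open>Conditionally on the observations indexed by \<open>J\<close>, the variable \<open>X d\<close> still has law \<open>D\<close>, and
  the degenerate kernel integrates to zero over it. This kills every mixed moment in which some
  index occurs only once.\<close>
lemma orthogonal_fresh_variable:
  fixes F :: "(nat \<Rightarrow> 'a) \<Rightarrow> real" and r :: "'a \<times> 'a \<Rightarrow> real"
  assumes J: "finite J" "c \<in> J" "d \<notin> J"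
    and [measurable]: "F \<in> borel_measurable (PiM J (\<lambda>_. D))" "r \<in> borel_measurable (D \<Otimes>\<^sub>M D)"
    and degenerate: "\<And>x. x \<in> space D \<Longrightarrow> (\<integral>y. r (x, y) \<partial>D) = 0"
    and int: "integrable M (\<lambda>w. F (restrict (\<lambda>i. X i w) J) * r (X c w, X d w))"
  shows "(\<integral>w. F (restrict (\<lambda>i. X i w) J) * r (X c w, X d w) \<partial>M) = 0"
proof -
  let ?XJ = "\<lambda>w. restrict (\<lambda>i. X i w) J" and ?PJ = "PiM J (\<lambda>_. D)"
  let ?Xd = "\<lambda>w. restrict (\<lambda>i. X i w) {d}" and ?Pd = "PiM {d} (\<lambda>_. D)"
  have [measurable]: "?XJ \<in> M \<rightarrow>\<^sub>M ?PJ" by measurable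
  have [measurable]: "(\<lambda>z. z c) \<in> ?PJ \<rightarrow>\<^sub>M D" using J by measurable
  have "indep_var ?PJ ?XJ ?Pd ?Xd"
    using J by (intro indep_var_restrict[OF indep]) auto
  then have eq: "distr M (?PJ \<Otimes>\<^sub>M ?Pd) (\<lambda>w. (?XJ w, ?Xd w)) = distr M ?PJ ?XJ \<Otimes>\<^sub>M distr M ?Pd ?Xd"
    by (simp add: indep_var_distribution_eq)
  interpret P: prob_space "distr M ?PJ ?XJ" by (rule prob_space_distr) measurable
  interpret Pd: prob_space "distr M ?Pd ?Xd" by (rule prob_space_distr) measurable
  interpret Q: pair_prob_space "distr M ?PJ ?XJ" "distr M ?Pd ?Xd" ..
  let ?h = "\<lambda>(z, y). F z * r (z c, y d)"
  have h [measurable]: "?h \<in> borel_measurable (?PJ \<Otimes>\<^sub>M ?Pd)" by measurable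
  have inner: "(\<integral>y. r (x, y d) \<partial>distr M ?Pd ?Xd) = 0" if x: "x \<in> space D" for x
  proof -
    have [measurable]: "(\<lambda>y. r (x, y)) \<in> borel_measurable D" using x by measurable
    have "(\<integral>y. r (x, y d) \<partial>distr M ?Pd ?Xd) = (\<integral>w. r (x, X d w) \<partial>M)"
      by (subst integral_distr) auto
    also have "\<dots> = (\<integral>y. r (x, y) \<partial>D)"
      using integral_distr[OF X_measurable[of d], of "\<lambda>y. r (x, y)"] by (simp add: law)
    finally show ?thesis by (simp add: degenerate[OF x])
  qed
  have "integrable (distr M (?PJ \<Otimes>\<^sub>M ?Pd) (\<lambda>w. (?XJ w, ?Xd w))) ?h"
    using int J by (subst integrable_distr_eq) auto
  then have "integrable (distr M ?PJ ?XJ \<Otimes>\<^sub>M distr M ?Pd ?Xd) ?h" by (simp only: eq)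
  then have "(\<integral>u. ?h u \<partial>(distr M ?PJ ?XJ \<Otimes>\<^sub>M distr M ?Pd ?Xd)) =
      (\<integral>z. (\<integral>y. F z * r (z c, y d) \<partial>distr M ?Pd ?Xd) \<partial>distr M ?PJ ?XJ)"
    by (subst Q.integral_fst'[symmetric]) auto
  also have "\<dots> = (\<integral>z. 0 \<partial>distr M ?PJ ?XJ)"
    using J by (intro Bochner_Integration.integral_cong refl)
        (auto simp: space_PiM inner[OF PiE_mem[OF _ J(2)]])
  finally have "(\<integral>u. ?h u \<partial>distr M (?PJ \<Otimes>\<^sub>M ?Pd) (\<lambda>w. (?XJ w, ?Xd w))) = 0"
    by (simp add: eq)
  then show ?thesis
    using J by (subst (asm) integral_distr) auto
qed

lemma integral_disjoint_pairs:
  fixes r :: "'a \<times> 'a \<Rightarrow> real"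
  assumes r: "integrable (D \<Otimes>\<^sub>M D) r" and ab: "a \<noteq> b" and cd: "c \<noteq> d" and disj: "{a, b} \<inter> {c, d} = {}"
  shows "(\<integral>w. r (X a w, X b w) * r (X c w, X d w) \<partial>M) = (\<integral>z. r z \<partial>(D \<Otimes>\<^sub>M D))\<^sup>2"
proof -
  have [measurable]: "r \<in> borel_measurable (D \<Otimes>\<^sub>M D)" using r by simp
  have "indep_var (PiM {a, b} (\<lambda>_. D)) (\<lambda>w. restrict (\<lambda>i. X i w) {a, b}) (PiM {c, d} (\<lambda>_. D))
      (\<lambda>w. restrict (\<lambda>i. X i w) {c, d})"
    using disj by (intro indep_var_restrict[OF indep]) auto
  then have "indep_var borel ((\<lambda>f. r (f a, f b)) \<circ> (\<lambda>w. restrict (\<lambda>i. X i w) {a, b}))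
      borel ((\<lambda>f. r (f c, f d)) \<circ> (\<lambda>w. restrict (\<lambda>i. X i w) {c, d}))"
    by (rule indep_var_compose) measurable
  then have "indep_var borel (\<lambda>w. r (X a w, X b w)) borel (\<lambda>w. r (X c w, X d w))"
    by (simp add: comp_def)
  from indep_var_lebesgue_integral[OF this integrable_pair(1)[OF r ab] integrable_pair(1)[OF r cd]]
  show ?thesis
    by (simp add: integrable_pair(2)[OF r ab] integrable_pair(2)[OF r cd] power2_eq_square)
qed

text \<open>The part of the V-statistic over pairs of distinct, hence independent, observations: only
  there do assumptions on the product law \<open>D \<Otimes>\<^sub>M D\<close> say anything, because the diagonal may be a
  null set of it.\<close>
definition off_diag :: "('a \<times> 'a \<Rightarrow> real) \<Rightarrow> nat \<Rightarrow> 'w \<Rightarrow> real" where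
  "off_diag r n w = (\<Sum>a<n. \<Sum>b<n. if a = b then 0 else r (X a w, X b w))"

lemma sum_pairs_split:
  "(\<Sum>a<n. \<Sum>b<n. r (X a w, X b w)) = (\<Sum>a<n. r (X a w, X a w)) + off_diag r n w"
proof -
  have "(\<Sum>b<n. r (X a w, X b w)) = r (X a w, X a w) + (\<Sum>b<n. if a = b then 0 else r (X a w, X b w))"
    if "a < n" for a
    using that by (subst (1 2) sum.remove[of _ a]) (auto intro!: sum.cong)
  then show ?thesis by (simp add: off_diag_def sum.distrib)
qed

lemma finite_variance_off_diag:
  assumes "finite_variance (D \<Otimes>\<^sub>M D) r"
  shows "finite_variance M (off_diag r n)"
  unfolding off_diag_def[abs_def]
proof (intro finite_variance_sum)
  fix a b
  show "finite_variance M (\<lambda>w. if a = b then 0 else r (X a w, X b w))"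
    using finite_variance_pair[OF assms] by (cases "a = b") (auto simp: finite_variance_def)
qed

lemma integral_pair_product_le:
  assumes r: "finite_variance (D \<Otimes>\<^sub>M D) r" and ab: "a \<noteq> b" and cd: "c \<noteq> d"
  shows "(\<integral>w. r (X a w, X b w) * r (X c w, X d w) \<partial>M) \<le> (\<integral>z. (r z)\<^sup>2 \<partial>(D \<Otimes>\<^sub>M D))"
proof -
  have r2: "integrable (D \<Otimes>\<^sub>M D) (\<lambda>z. (r z)\<^sup>2)" using r by (simp add: finite_variance_def)
  note I = integrable_pair[OF r2]
  have "(\<integral>w. r (X a w, X b w) * r (X c w, X d w) \<partial>M)
      \<le> (\<integral>w. ((r (X a w, X b w))\<^sup>2 + (r (X c w, X d w))\<^sup>2) / 2 \<partial>M)"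
    using I(1)[OF ab] I(1)[OF cd] sum_squares_bound[of "r (X a _, X b _)" "r (X c _, X d _)"]
    by (intro integral_mono finite_variance_integrable_mult finite_variance_pair r ab cd)
       (auto simp: mult_ac)
  also have "\<dots> = (\<integral>z. (r z)\<^sup>2 \<partial>(D \<Otimes>\<^sub>M D))"
    using I(1)[OF ab] I(1)[OF cd] I(2)[OF ab] I(2)[OF cd] by simp
  finally show ?thesis .
qed

text \<open>Expanding the square gives a sum over quadruples of indices. Each term is at most the second
  moment of the kernel, so it suffices to count the quadruples for which the term need not
  vanish; \<open>P\<close> describes them and \<open>N\<close> dominates their indicator by something easy to sum.\<close>
lemma off_diag_second_moment:
  assumes r: "finite_variance (D \<Otimes>\<^sub>M D) r"
    and zero: "\<And>a b c d. a \<noteq> b \<Longrightarrow> c \<noteq> d \<Longrightarrow> \<not> P a b c d \<Longrightarrow>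
      (\<integral>w. r (X a w, X b w) * r (X c w, X d w) \<partial>M) = 0"
    and count: "\<And>a b c d. P a b c d \<Longrightarrow> 1 \<le> (N a b c d :: real)"
    and N: "\<And>a b c d. 0 \<le> N a b c d"
  shows "(\<integral>w. (off_diag r n w)\<^sup>2 \<partial>M) \<le>
    (\<Sum>a<n. \<Sum>b<n. \<Sum>c<n. \<Sum>d<n. N a b c d) * (\<integral>z. (r z)\<^sup>2 \<partial>(D \<Otimes>\<^sub>M D))"
proof -
  let ?r = "\<lambda>a b w. if a = b then 0 else r (X a w, X b w)"
  let ?V = "\<integral>z. (r z)\<^sup>2 \<partial>(D \<Otimes>\<^sub>M D)"
  have fv: "finite_variance M (?r a b)" for a b
    using finite_variance_pair[OF r] by (cases "a = b") (auto simp: finite_variance_def)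
  have le: "(\<integral>w. ?r a b w * ?r c d w \<partial>M) \<le> N a b c d * ?V" for a b c d
  proof (cases "a \<noteq> b \<and> c \<noteq> d \<and> P a b c d")
    case True
    then have "(\<integral>w. ?r a b w * ?r c d w \<partial>M) \<le> ?V"
      using integral_pair_product_le[OF r, of a b c d] by simp
    also have "\<dots> \<le> N a b c d * ?V"
      using mult_right_mono[OF count[of a b c d], of ?V] True by simp
    finally show ?thesis .
  next
    case False
    then have "(\<integral>w. ?r a b w * ?r c d w \<partial>M) = 0"
      using zero[of a b c d] by (cases "a = b"; cases "c = d") auto
    then show ?thesis using N[of a b c d] by simp
  qed
  have "(off_diag r n w)\<^sup>2 = (\<Sum>a<n. \<Sum>b<n. \<Sum>c<n. \<Sum>d<n. ?r a b w * ?r c d w)" for w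
    unfolding off_diag_def power2_eq_square
    by (simp only: sum_distrib_right) (simp only: sum_distrib_left)
  then have "(\<integral>w. (off_diag r n w)\<^sup>2 \<partial>M) = (\<Sum>a<n. \<Sum>b<n. \<Sum>c<n. \<Sum>d<n. \<integral>w. ?r a b w * ?r c d w \<partial>M)"
    using finite_variance_integrable_mult[OF fv fv]
    by (simp add: Bochner_Integration.integral_sum Bochner_Integration.integrable_sum)
  also have "\<dots> \<le> (\<Sum>a<n. \<Sum>b<n. \<Sum>c<n. \<Sum>d<n. N a b c d * ?V)"
    by (intro sum_mono le)
  finally show ?thesis by (simp add: sum_distrib_right)
qed

text \<open>For a mean-zero kernel two disjoint pairs are independent and contribute nothing, so the pairs
  must share an index: at most \<open>4 n\<^sup>3\<close> quadruples.\<close>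
lemma off_diag_centred_second_moment:
  assumes r: "finite_variance (D \<Otimes>\<^sub>M D) r" and mean: "(\<integral>z. r z \<partial>(D \<Otimes>\<^sub>M D)) = 0"
  shows "(\<integral>w. (off_diag r n w)\<^sup>2 \<partial>M) \<le> 4 * real n ^ 3 * (\<integral>z. (r z)\<^sup>2 \<partial>(D \<Otimes>\<^sub>M D))"
proof -
  let ?N = "\<lambda>a b c d. of_bool (a = c) + of_bool (a = d) + of_bool (b = c) + (of_bool (b = d) :: real)"
  have "(\<integral>w. (off_diag r n w)\<^sup>2 \<partial>M) \<le>
      (\<Sum>a<n. \<Sum>b<n. \<Sum>c<n. \<Sum>d<n. ?N a b c d) * (\<integral>z. (r z)\<^sup>2 \<partial>(D \<Otimes>\<^sub>M D))"
  proof (rule off_diag_second_moment[OF r, where P = "\<lambda>a b c d. a = c \<or> a = d \<or> b = c \<or> b = d"])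
    fix a b c d :: nat
    assume "a \<noteq> b" "c \<noteq> d" "\<not> (a = c \<or> a = d \<or> b = c \<or> b = d)"
    then show "(\<integral>w. r (X a w, X b w) * r (X c w, X d w) \<partial>M) = 0"
      using integral_disjoint_pairs[of r a b c d] DD.P.finite_variance_integrable[OF r] mean by auto
  qed auto
  also have "(\<Sum>a<n. \<Sum>b<n. \<Sum>c<n. \<Sum>d<n. ?N a b c d) = 4 * real n ^ 3"
  proof -
    have delta: "(\<Sum>c<n. of_bool (a = c)) = (1::real)" if "a < n" for a
      using that by (simp add: of_bool_def)
    have 1: "(\<Sum>c<n. \<Sum>d<n. of_bool (a = c)) = real n" if "a < n" for a
      using delta[OF that] by (simp flip: sum_distrib_left)
    have 2: "(\<Sum>c<n. \<Sum>d<n. of_bool (a = d)) = real n" if "a < n" for a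
      using delta[OF that] by simp
    have "(\<Sum>a<n. \<Sum>b<n. \<Sum>c<n. \<Sum>d<n. ?N a b c d) = (\<Sum>a<n. \<Sum>b<n. 4 * real n)"
      by (intro sum.cong refl) (simp only: sum.distrib 1 2 lessThan_iff)
    then show ?thesis by (simp add: power3_eq_cube)
  qed
  finally show ?thesis .
qed

text \<open>For a degenerate kernel a quadruple contributes only if the two pairs coincide as sets, since
  otherwise one index occurs once; this leaves \<open>2 n\<^sup>2\<close> quadruples.\<close>
lemma off_diag_degenerate_second_moment:
  assumes r: "finite_variance (D \<Otimes>\<^sub>M D) r"
    and sym: "\<And>x y. x \<in> space D \<Longrightarrow> y \<in> space D \<Longrightarrow> r (x, y) = r (y, x)"
    and degenerate: "\<And>x. x \<in> space D \<Longrightarrow> (\<integral>y. r (x, y) \<partial>D) = 0"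
  shows "(\<integral>w. (off_diag r n w)\<^sup>2 \<partial>M) \<le> 2 * (real n)\<^sup>2 * (\<integral>z. (r z)\<^sup>2 \<partial>(D \<Otimes>\<^sub>M D))"
proof -
  have rm [measurable]: "r \<in> borel_measurable (D \<Otimes>\<^sub>M D)" using r by (simp add: finite_variance_def)
  have fresh: "(\<integral>w. r (X a w, X b w) * r (X c w, X d w) \<partial>M) = 0"
    if "a \<noteq> b" "c \<noteq> d" "d \<noteq> a" "d \<noteq> b" for a b c d
  proof -
    have "(\<integral>w. (\<lambda>z. r (z a, z b)) (restrict (\<lambda>i. X i w) {a, b, c}) * r (X c w, X d w) \<partial>M) = 0"
      using that finite_variance_integrable_mult[OF finite_variance_pair[OF r]
          finite_variance_pair[OF r], of a b c d]
      by (intro orthogonal_fresh_variable degenerate rm) auto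
    then show ?thesis by simp
  qed
  let ?N = "\<lambda>a b c d. of_bool (a = c) * of_bool (b = d) + of_bool (a = d) * (of_bool (b = c) :: real)"
  have "(\<integral>w. (off_diag r n w)\<^sup>2 \<partial>M) \<le>
      (\<Sum>a<n. \<Sum>b<n. \<Sum>c<n. \<Sum>d<n. ?N a b c d) * (\<integral>z. (r z)\<^sup>2 \<partial>(D \<Otimes>\<^sub>M D))"
  proof (rule off_diag_second_moment[OF r, where P = "\<lambda>a b c d. (a = c \<and> b = d) \<or> (a = d \<and> b = c)"])
    fix a b c d :: nat
    assume *: "a \<noteq> b" "c \<noteq> d" "\<not> ((a = c \<and> b = d) \<or> (a = d \<and> b = c))"
    show "(\<integral>w. r (X a w, X b w) * r (X c w, X d w) \<partial>M) = 0"
    proof (cases "d \<noteq> a \<and> d \<noteq> b")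
      case True
      then show ?thesis using * by (intro fresh) auto
    next
      case False
      then have "(\<integral>w. r (X a w, X b w) * r (X d w, X c w) \<partial>M) = 0" using * by (intro fresh) auto
      moreover have "(\<integral>w. r (X a w, X b w) * r (X c w, X d w) \<partial>M)
          = (\<integral>w. r (X a w, X b w) * r (X d w, X c w) \<partial>M)"
        by (intro Bochner_Integration.integral_cong refl)
            (simp add: sym[OF measurable_space[OF X_measurable[of c]] measurable_space[OF X_measurable[of d]]])
      ultimately show ?thesis by simp
    qed
  qed auto
  also have "(\<Sum>a<n. \<Sum>b<n. \<Sum>c<n. \<Sum>d<n. ?N a b c d) = 2 * (real n)\<^sup>2"
  proof -
    have delta: "(\<Sum>c<n. of_bool (a = c)) = (1::real)" if "a < n" for a
      using that by (simp add: of_bool_def)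
    have 1: "(\<Sum>c<n. \<Sum>d<n. of_bool (a = c) * of_bool (b = d)) = (1::real)" if "a < n" "b < n" for a b
      using delta that by (simp only: sum_distrib_left[symmetric] mult_1_right)
    have 2: "(\<Sum>c<n. \<Sum>d<n. of_bool (a = d) * of_bool (b = c)) = (1::real)" if "a < n" "b < n" for a b
      using delta that by (simp only: sum_distrib_right[symmetric] mult_1_left)
    have "(\<Sum>a<n. \<Sum>b<n. \<Sum>c<n. \<Sum>d<n. ?N a b c d) = (\<Sum>a<n. \<Sum>b<n. 2)"
      by (intro sum.cong refl) (simp only: sum.distrib 1 2 lessThan_iff)
    then show ?thesis by (simp add: power2_eq_square)
  qed
  finally show ?thesis .
qed

lemma L1_mean_bound:
  fixes f :: "'a \<Rightarrow> real"
  assumes f: "integrable D f"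
  shows "(\<integral>w. \<bar>(\<Sum>a<n. f (X a w)) / n\<bar> \<partial>M) \<le> (\<integral>x. \<bar>f x\<bar> \<partial>D)"
proof (cases "n = 0")
  case False
  have "(\<integral>w. \<bar>(\<Sum>a<n. f (X a w)) / n\<bar> \<partial>M) \<le> (\<integral>w. (\<Sum>a<n. \<bar>f (X a w)\<bar>) / n \<partial>M)"
    using integrable_single(1)[OF f]
    by (intro integral_mono Bochner_Integration.integrable_divide Bochner_Integration.integrable_sum
        integrable_abs)
       (auto intro!: divide_right_mono sum_abs)
  also have "\<dots> = (\<Sum>a<n. \<integral>w. \<bar>f (X a w)\<bar> \<partial>M) / n"
    using integrable_single(1)[OF f] by simp
  also have "\<dots> = (\<integral>x. \<bar>f x\<bar> \<partial>D)"
    using False integrable_single(2)[OF integrable_abs[OF f]] by simp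
  finally show ?thesis .
qed simp

lemma L2_mean_bound:
  assumes f: "finite_variance D f" and mean: "(\<integral>x. f x \<partial>D) = 0"
  shows "(\<integral>w. ((\<Sum>a<n. f (X a w)) / n)\<^sup>2 \<partial>M) \<le> (\<integral>x. (f x)\<^sup>2 \<partial>D) / n"
proof -
  have fi: "integrable D f" by (rule D.finite_variance_integrable[OF f])
  note fv = finite_variance_single[OF f]
  have prod0: "(\<integral>w. f (X a w) * f (X b w) \<partial>M) = (if a = b then \<integral>x. (f x)\<^sup>2 \<partial>D else 0)" for a b
  proof (cases "a = b")
    case True
    then show ?thesis
      using integrable_single(2)[of "\<lambda>x. (f x)\<^sup>2" b] f by (simp add: finite_variance_def power2_eq_square)
  next
    case False
    have "indep_vars (\<lambda>_. borel) (\<lambda>i w. f (X i w)) {a, b}"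
      by (rule indep_vars_compose2[OF indep_vars_subset[OF indep]]) (use fi in auto)
    from indep_vars_lebesgue_integral[OF _ this] show ?thesis
      using False integrable_single[OF fi] mean by simp
  qed
  have "(\<integral>w. ((\<Sum>a<n. f (X a w)) / n)\<^sup>2 \<partial>M) = (\<integral>w. (\<Sum>a<n. \<Sum>b<n. f (X a w) * f (X b w)) / (real n)\<^sup>2 \<partial>M)"
    by (simp add: power_divide power2_eq_square[of "sum _ _"] sum_product)
  also have "\<dots> = (\<Sum>a<n. \<Sum>b<n. \<integral>w. f (X a w) * f (X b w) \<partial>M) / (real n)\<^sup>2"
    using finite_variance_integrable_mult[OF fv fv]
    by (simp add: Bochner_Integration.integral_sum Bochner_Integration.integrable_sum)
  also have "\<dots> = (\<integral>x. (f x)\<^sup>2 \<partial>D) / n"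
    by (simp add: prod0 power2_eq_square)
  finally show ?thesis by simp
qed

text \<open>Only integrability is available for the diagonal of the kernel, so the variance bound is
  applied to a truncation, and the truncated part is small in \<open>L\<^sub>1\<close> uniformly in \<open>n\<close>.\<close>
lemma L1_law_of_large_numbers:
  fixes f :: "'a \<Rightarrow> real"
  assumes f: "integrable D f"
  shows "(\<lambda>n. \<integral>w. \<bar>(\<Sum>a<n. f (X a w)) / n - (\<integral>x. f x \<partial>D)\<bar> \<partial>M) \<longlonglongrightarrow> 0"
proof (rule LIMSEQ_I)
  fix \<epsilon> :: real assume \<epsilon>: "0 < \<epsilon>"
  have [measurable]: "f \<in> borel_measurable D" using f by simp
  define t where "t c x = (if \<bar>f x\<bar> \<le> real c then f x else 0)" for c x
  have [measurable]: "t c \<in> borel_measurable D" for c unfolding t_def by measurable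
  have ti: "integrable D (t c)" for c
    by (rule Bochner_Integration.integrable_bound[OF f]) (auto simp: t_def)
  have "(\<lambda>c. \<integral>x. \<bar>f x - t c x\<bar> \<partial>D) \<longlonglongrightarrow> (\<integral>x. 0 \<partial>D)"
  proof (rule integral_dominated_convergence[where w = "\<lambda>x. \<bar>f x\<bar>"])
    show "AE x in D. (\<lambda>c. \<bar>f x - t c x\<bar>) \<longlonglongrightarrow> 0"
    proof (rule AE_I2)
      fix x
      have "\<forall>\<^sub>F c in sequentially. \<bar>f x\<bar> \<le> real c"
        by (rule eventually_sequentiallyI[of "nat \<lceil>\<bar>f x\<bar>\<rceil>"]) linarith
      then have "\<forall>\<^sub>F c in sequentially. \<bar>f x - t c x\<bar> = 0"
        by eventually_elim (simp add: t_def)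
      then show "(\<lambda>c. \<bar>f x - t c x\<bar>) \<longlonglongrightarrow> 0" by (rule tendsto_eventually)
    qed
  qed (use f in \<open>auto simp: t_def\<close>)
  then have "\<forall>\<^sub>F c in sequentially. (\<integral>x. \<bar>f x - t c x\<bar> \<partial>D) < \<epsilon> / 4"
    using \<epsilon> by (intro order_tendstoD) auto
  then obtain c where c: "(\<integral>x. \<bar>f x - t c x\<bar> \<partial>D) < \<epsilon> / 4"
    by (auto simp: eventually_sequentially)
  define m where "m = (\<integral>x. t c x \<partial>D)"
  define g where "g x = t c x - m" for x
  have g: "finite_variance D g"
    unfolding g_def
    by (rule D.finite_variance_bounded[of _ "real c + \<bar>m\<bar>"]) (auto simp: t_def)
  have g0: "(\<integral>x. g x \<partial>D) = 0"
    unfolding g_def using ti by (simp add: m_def D.prob_space)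
  have mm: "\<bar>m - (\<integral>x. f x \<partial>D)\<bar> < \<epsilon> / 4"
  proof -
    have "\<bar>m - (\<integral>x. f x \<partial>D)\<bar> = \<bar>\<integral>x. f x - t c x \<partial>D\<bar>"
      using f ti by (simp add: m_def)
    also have "\<dots> \<le> (\<integral>x. \<bar>f x - t c x\<bar> \<partial>D)" by (rule integral_abs_bound)
    finally show ?thesis using c by simp
  qed
  have "(\<lambda>n. sqrt ((\<integral>x. (g x)\<^sup>2 \<partial>D) / real n)) \<longlonglongrightarrow> sqrt 0"
    by (intro tendsto_real_sqrt lim_const_over_n)
  then have "\<forall>\<^sub>F n in sequentially. sqrt ((\<integral>x. (g x)\<^sup>2 \<partial>D) / real n) < \<epsilon> / 4"
    using \<epsilon> by (intro order_tendstoD) auto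
  then have "\<forall>\<^sub>F n in sequentially. (\<integral>w. \<bar>(\<Sum>a<n. f (X a w)) / n - (\<integral>x. f x \<partial>D)\<bar> \<partial>M) < \<epsilon>"
    using eventually_gt_at_top[of 0]
  proof eventually_elim
    case (elim n)
    let ?A = "\<lambda>w. (\<Sum>a<n. f (X a w) - t c (X a w)) / n" and ?B = "\<lambda>w. (\<Sum>a<n. g (X a w)) / n"
    have ft: "integrable D (\<lambda>x. f x - t c x)" using f ti by simp
    have Ai: "integrable M ?A"
      using integrable_single(1)[OF ft] by simp
    have "finite_variance M (\<lambda>w. 1 / n * (\<Sum>a<n. g (X a w)))"
      by (intro finite_variance_cmult finite_variance_sum finite_variance_single g)
    then have Bfv: "finite_variance M ?B" by simp
    have eq: "(\<Sum>a<n. f (X a w)) / n - (\<integral>x. f x \<partial>D) = ?A w + ?B w + (m - (\<integral>x. f x \<partial>D))" for w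
      using elim(2) by (simp add: g_def sum_subtractf diff_divide_distrib)
    have "\<bar>(\<Sum>a<n. f (X a w)) / n - (\<integral>x. f x \<partial>D)\<bar> \<le> \<bar>?A w\<bar> + \<bar>?B w\<bar> + \<epsilon> / 4" for w
      using mm unfolding eq[of w] by linarith
    then have "(\<integral>w. \<bar>(\<Sum>a<n. f (X a w)) / n - (\<integral>x. f x \<partial>D)\<bar> \<partial>M) \<le> (\<integral>w. \<bar>?A w\<bar> + \<bar>?B w\<bar> + \<epsilon> / 4 \<partial>M)"
      by (intro integral_mono integrable_abs Bochner_Integration.integrable_add Ai
          finite_variance_integrable[OF Bfv] Bochner_Integration.integrable_diff
          Bochner_Integration.integrable_divide Bochner_Integration.integrable_sum
          integrable_single(1)[OF f] integrable_const)
    also have "\<dots> = (\<integral>w. \<bar>?A w\<bar> \<partial>M) + (\<integral>w. \<bar>?B w\<bar> \<partial>M) + \<epsilon> / 4"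
      using integrable_abs[OF Ai] integrable_abs[OF finite_variance_integrable[OF Bfv]]
      by (simp add: prob_space del: abs_divide)
    finally have total: "(\<integral>w. \<bar>(\<Sum>a<n. f (X a w)) / n - (\<integral>x. f x \<partial>D)\<bar> \<partial>M)
        \<le> (\<integral>w. \<bar>?A w\<bar> \<partial>M) + (\<integral>w. \<bar>?B w\<bar> \<partial>M) + \<epsilon> / 4" .
    have A: "(\<integral>w. \<bar>?A w\<bar> \<partial>M) \<le> (\<integral>x. \<bar>f x - t c x\<bar> \<partial>D)"
      by (rule L1_mean_bound[OF ft])
    have B: "(\<integral>w. \<bar>?B w\<bar> \<partial>M) \<le> sqrt ((\<integral>x. (g x)\<^sup>2 \<partial>D) / n)"
      using integral_abs_le_sqrt[OF Bfv] L2_mean_bound[OF g g0, of n]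
      by (meson order_trans real_sqrt_le_iff)
    show ?case using total A B c elim(1) \<epsilon> by linarith
  qed
  then show "\<exists>N. \<forall>n\<ge>N. norm ((\<integral>w. \<bar>(\<Sum>a<n. f (X a w)) / n - (\<integral>x. f x \<partial>D)\<bar> \<partial>M) - 0) < \<epsilon>"
    by (auto simp: eventually_sequentially)
qed

text \<open>The central limit theorem for one function of the observations, evaluated at the frequency
  that undoes the standardization. A function of variance zero vanishes almost surely and is
  treated apart.\<close>
lemma char_normalized_sum:
  assumes g: "finite_variance D g" and g0: "(\<integral>x. g x \<partial>D) = 0"
  shows "(\<lambda>n. \<integral>w. iexp ((\<Sum>a<n. g (X a w)) / sqrt n) \<partial>M)
    \<longlonglongrightarrow> complex_of_real (exp (- (\<integral>x. (g x)\<^sup>2 \<partial>D) / 2))"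
proof (cases "(\<integral>x. (g x)\<^sup>2 \<partial>D) = 0")
  case True
  have "AE x in D. (g x)\<^sup>2 = 0"
    using g True integral_nonneg_eq_0_iff_AE[of D "\<lambda>x. (g x)\<^sup>2"] by (auto simp: finite_variance_def)
  then have "AE w in M. g (X a w) = 0" for a
    using AE_single[of "\<lambda>x. g x = 0" a] by simp
  then have "AE w in M. \<forall>a. g (X a w) = 0" by (simp add: AE_all_countable)
  then have "(\<integral>w. iexp ((\<Sum>a<n. g (X a w)) / sqrt n) \<partial>M) = (\<integral>w. 1 \<partial>M)" for n
    using g by (intro integral_cong_AE) (auto simp: finite_variance_def)
  then show ?thesis using True by (simp add: prob_space)
next
  case False
  define \<sigma> where "\<sigma> = sqrt (\<integral>x. (g x)\<^sup>2 \<partial>D)"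
  have [measurable]: "g \<in> borel_measurable D" using g by (simp add: finite_variance_def)
  have pos: "0 < (\<integral>x. (g x)\<^sup>2 \<partial>D)" using False by (simp add: less_le)
  then have \<sigma>: "0 < \<sigma>" "\<sigma>\<^sup>2 = (\<integral>x. (g x)\<^sup>2 \<partial>D)" by (auto simp: \<sigma>_def)
  have gi: "integrable D g" by (rule D.finite_variance_integrable[OF g])
  have mean: "expectation (\<lambda>w. g (X i w)) = 0" for i
    by (simp add: integrable_single(2)[OF gi] g0)
  have g2: "integrable D (\<lambda>x. (g x)\<^sup>2)" using g by (simp add: finite_variance_def)
  have "weak_conv_m (\<lambda>n. distr M borel (\<lambda>w. (\<Sum>i<n. g (X i w)) / sqrt (n * \<sigma>\<^sup>2))) std_normal_distribution"
  proof (rule central_limit_theorem_zero_mean[where \<mu> = "distr D borel g"])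
    show "indep_vars (\<lambda>i. borel) (\<lambda>i w. g (X i w)) UNIV"
      by (rule indep_vars_compose2[OF indep]) auto
    show "distr M borel (\<lambda>w. g (X n w)) = distr D borel g" for n
    proof -
      have "distr (distr M D (X n)) borel g = distr M borel (\<lambda>w. g (X n w))"
        by (subst distr_distr) (auto simp: comp_def)
      then show ?thesis by (simp add: law)
    qed
    show "variance (\<lambda>w. g (X n w)) = \<sigma>\<^sup>2" for n
      by (simp add: mean \<sigma> integrable_single(2)[OF g2])
  qed (use \<sigma> mean integrable_single(1)[OF g2] in auto)
  then have "(\<lambda>n. char (distr M borel (\<lambda>w. (\<Sum>i<n. g (X i w)) / sqrt (n * \<sigma>\<^sup>2))) \<sigma>)
      \<longlonglongrightarrow> char std_normal_distribution \<sigma>"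
    by (intro levy_continuity1 real_distribution_distr real_dist_normal_dist) auto
  moreover have "char (distr M borel (\<lambda>w. (\<Sum>i<n. g (X i w)) / sqrt (n * \<sigma>\<^sup>2))) \<sigma> =
      (\<integral>w. iexp ((\<Sum>a<n. g (X a w)) / sqrt n) \<partial>M)" for n
  proof -
    have "\<sigma> * ((\<Sum>i<n. g (X i w)) / sqrt (n * \<sigma>\<^sup>2)) = (\<Sum>a<n. g (X a w)) / sqrt n" for w
      using \<sigma>(1) by (simp add: real_sqrt_mult)
    then show ?thesis unfolding char_def by (subst integral_distr) auto
  qed
  ultimately show ?thesis by (simp add: char_std_normal_distribution \<sigma>(2))
qed

end

section \<open>Orders in probability\<close>

lemma norm_integral_le_integral:
  fixes f :: "'a \<Rightarrow> 'b::{banach, second_countable_topology}" and g :: "'a \<Rightarrow> real"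
  assumes "integrable M f" "integrable M g" "\<And>x. x \<in> space M \<Longrightarrow> norm (f x) \<le> g x"
  shows "norm (\<integral>x. f x \<partial>M) \<le> (\<integral>x. g x \<partial>M)"
  by (rule order_trans[OF integral_norm_bound integral_mono]) (use assms in auto)

text \<open>The stochastic order symbols \<open>o\<^sub>P(1)\<close> and \<open>O\<^sub>P(1)\<close>. Measurability is part of the notion,
  because the measure of a nonmeasurable set is 0 by convention and unmeasurable sequences would
  escape the calculus below.\<close>
definition vanishes_in_probability :: "'w measure \<Rightarrow> (nat \<Rightarrow> 'w \<Rightarrow> real) \<Rightarrow> bool" where
  "vanishes_in_probability M Y \<longleftrightarrow> (\<forall>n. Y n \<in> borel_measurable M) \<and> converges_in_probability M Y (\<lambda>_. 0)"

definition bounded_in_probability :: "'w measure \<Rightarrow> (nat \<Rightarrow> 'w \<Rightarrow> real) \<Rightarrow> bool" where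
  "bounded_in_probability M Y \<longleftrightarrow> (\<forall>n. Y n \<in> borel_measurable M) \<and>
    (\<forall>\<eta>>0. \<exists>B>0. \<forall>\<^sub>F n in sequentially. measure M {w \<in> space M. \<bar>Y n w\<bar> > B} < \<eta>)"

context prob_space
begin

lemma vanishes_measurable: "vanishes_in_probability M Y \<Longrightarrow> Y n \<in> borel_measurable M"
  by (simp add: vanishes_in_probability_def)

lemma bounded_measurable: "bounded_in_probability M Y \<Longrightarrow> Y n \<in> borel_measurable M"
  by (simp add: bounded_in_probability_def)

lemma vanishes_tendsto:
  "vanishes_in_probability M Y \<Longrightarrow> \<epsilon> > 0 \<Longrightarrow> (\<lambda>n. measure M {w \<in> space M. \<bar>Y n w\<bar> > \<epsilon>}) \<longlonglongrightarrow> 0"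
  by (simp add: vanishes_in_probability_def converges_in_probability_def)

lemma vanishes_in_probabilityI:
  assumes "\<And>n. Y n \<in> borel_measurable M"
    and "\<And>\<epsilon>. \<epsilon> > 0 \<Longrightarrow> (\<lambda>n. measure M {w \<in> space M. \<bar>Y n w\<bar> > \<epsilon>}) \<longlonglongrightarrow> 0"
  shows "vanishes_in_probability M Y"
  using assms by (simp add: vanishes_in_probability_def converges_in_probability_def)

lemma vanishes_add:
  assumes Y: "vanishes_in_probability M Y" and Z: "vanishes_in_probability M Z"
  shows "vanishes_in_probability M (\<lambda>n w. Y n w + Z n w)"
proof (rule vanishes_in_probabilityI)
  note [measurable] = vanishes_measurable[OF Y] vanishes_measurable[OF Z]
  show "(\<lambda>w. Y n w + Z n w) \<in> borel_measurable M" for n by measurable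
  fix \<epsilon> :: real assume \<epsilon>: "\<epsilon> > 0"
  show "(\<lambda>n. measure M {w \<in> space M. \<bar>Y n w + Z n w\<bar> > \<epsilon>}) \<longlonglongrightarrow> 0"
  proof (rule tendsto_sandwich[OF _ _ tendsto_const])
    show "\<forall>\<^sub>F n in sequentially. measure M {w \<in> space M. \<bar>Y n w + Z n w\<bar> > \<epsilon>} \<le>
      measure M {w \<in> space M. \<bar>Y n w\<bar> > \<epsilon> / 2} + measure M {w \<in> space M. \<bar>Z n w\<bar> > \<epsilon> / 2}"
    proof (rule always_eventually, rule allI)
      fix n
      have "measure M {w \<in> space M. \<bar>Y n w + Z n w\<bar> > \<epsilon>} \<le>
        measure M ({w \<in> space M. \<bar>Y n w\<bar> > \<epsilon> / 2} \<union> {w \<in> space M. \<bar>Z n w\<bar> > \<epsilon> / 2})"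
      proof (rule finite_measure_mono)
        show "{w \<in> space M. \<bar>Y n w + Z n w\<bar> > \<epsilon>} \<subseteq> {w \<in> space M. \<bar>Y n w\<bar> > \<epsilon> / 2} \<union>
            {w \<in> space M. \<bar>Z n w\<bar> > \<epsilon> / 2}"
        proof (safe, rule ccontr)
          fix w assume "\<epsilon> < \<bar>Y n w + Z n w\<bar>" "\<not> \<bar>Z n w\<bar> > \<epsilon> / 2" "\<not> \<bar>Y n w\<bar> > \<epsilon> / 2"
          then show False using abs_triangle_ineq[of "Y n w" "Z n w"] by linarith
        qed
      qed measurable
      also have "\<dots> \<le> measure M {w \<in> space M. \<bar>Y n w\<bar> > \<epsilon> / 2} + measure M {w \<in> space M. \<bar>Z n w\<bar> > \<epsilon> / 2}"
        by (rule measure_Un_le) measurable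
      finally show "measure M {w \<in> space M. \<bar>Y n w + Z n w\<bar> > \<epsilon>} \<le>
        measure M {w \<in> space M. \<bar>Y n w\<bar> > \<epsilon> / 2} + measure M {w \<in> space M. \<bar>Z n w\<bar> > \<epsilon> / 2}" .
    qed
    show "(\<lambda>n. measure M {w \<in> space M. \<bar>Y n w\<bar> > \<epsilon> / 2} + measure M {w \<in> space M. \<bar>Z n w\<bar> > \<epsilon> / 2}) \<longlonglongrightarrow> 0"
      using tendsto_add[OF vanishes_tendsto[OF Y, of "\<epsilon> / 2"] vanishes_tendsto[OF Z, of "\<epsilon> / 2"]] \<epsilon> by simp
  qed simp
qed

lemma vanishes_const:
  assumes "c \<longlonglongrightarrow> (0::real)"
  shows "vanishes_in_probability M (\<lambda>n w. c n)"
proof (rule vanishes_in_probabilityI)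
  fix \<epsilon> :: real assume "\<epsilon> > 0"
  then have "\<forall>\<^sub>F n in sequentially. \<bar>c n\<bar> < \<epsilon>"
    using tendstoD[OF assms, of \<epsilon>] by simp
  then have "\<forall>\<^sub>F n in sequentially. measure M {w \<in> space M. \<bar>c n\<bar> > \<epsilon>} = 0"
    by eventually_elim (simp add: not_less[symmetric])
  then show "(\<lambda>n. measure M {w \<in> space M. \<bar>c n\<bar> > \<epsilon>}) \<longlonglongrightarrow> 0" by (rule tendsto_eventually)
qed simp

lemma vanishes_sum:
  assumes "\<And>i. i \<in> A \<Longrightarrow> vanishes_in_probability M (Y i)"
  shows "vanishes_in_probability M (\<lambda>n w. \<Sum>i\<in>A. Y i n w)"
  using assms
proof (induction A rule: infinite_finite_induct)
  case (insert i A)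
  then show ?case by (simp add: vanishes_add)
qed (simp_all add: vanishes_const)

lemma bounded_mult_vanishes:
  assumes Y: "bounded_in_probability M Y" and Z: "vanishes_in_probability M Z"
  shows "vanishes_in_probability M (\<lambda>n w. Y n w * Z n w)"
proof (rule vanishes_in_probabilityI)
  note [measurable] = bounded_measurable[OF Y] vanishes_measurable[OF Z]
  show "(\<lambda>w. Y n w * Z n w) \<in> borel_measurable M" for n by measurable
  fix \<epsilon> :: real assume \<epsilon>: "\<epsilon> > 0"
  show "(\<lambda>n. measure M {w \<in> space M. \<bar>Y n w * Z n w\<bar> > \<epsilon>}) \<longlonglongrightarrow> 0"
  proof (rule order_tendstoI)
    fix \<eta> :: real assume \<eta>: "0 < \<eta>"
    then obtain B where B: "B > 0" "\<forall>\<^sub>F n in sequentially. measure M {w \<in> space M. \<bar>Y n w\<bar> > B} < \<eta> / 2"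
      using Y unfolding bounded_in_probability_def by (meson half_gt_zero)
    have "\<forall>\<^sub>F n in sequentially. measure M {w \<in> space M. \<bar>Z n w\<bar> > \<epsilon> / B} < \<eta> / 2"
      using order_tendstoD(2)[OF vanishes_tendsto[OF Z, of "\<epsilon> / B"], of "\<eta> / 2"] \<epsilon> B(1) \<eta> by simp
    with B(2) show "\<forall>\<^sub>F n in sequentially. measure M {w \<in> space M. \<bar>Y n w * Z n w\<bar> > \<epsilon>} < \<eta>"
    proof eventually_elim
      case (elim n)
      have "measure M {w \<in> space M. \<bar>Y n w * Z n w\<bar> > \<epsilon>} \<le>
        measure M ({w \<in> space M. \<bar>Y n w\<bar> > B} \<union> {w \<in> space M. \<bar>Z n w\<bar> > \<epsilon> / B})"
      proof (rule finite_measure_mono)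
        show "{w \<in> space M. \<bar>Y n w * Z n w\<bar> > \<epsilon>} \<subseteq> {w \<in> space M. \<bar>Y n w\<bar> > B} \<union> {w \<in> space M. \<bar>Z n w\<bar> > \<epsilon> / B}"
        proof (safe, rule ccontr)
          fix w assume w: "\<epsilon> < \<bar>Y n w * Z n w\<bar>" "\<not> \<bar>Z n w\<bar> > \<epsilon> / B" "\<not> \<bar>Y n w\<bar> > B"
          then have "\<bar>Y n w\<bar> * \<bar>Z n w\<bar> \<le> B * (\<epsilon> / B)" using B(1) by (intro mult_mono) auto
          then show False using w(1) B(1) by (simp add: abs_mult)
        qed
      qed measurable
      also have "\<dots> \<le> measure M {w \<in> space M. \<bar>Y n w\<bar> > B} + measure M {w \<in> space M. \<bar>Z n w\<bar> > \<epsilon> / B}"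
        by (rule measure_Un_le) measurable
      finally show ?case using elim by linarith
    qed
  qed (simp add: less_le_trans[OF _ measure_nonneg])
qed

lemma bounded_mult:
  assumes Y: "bounded_in_probability M Y" and Z: "bounded_in_probability M Z"
  shows "bounded_in_probability M (\<lambda>n w. Y n w * Z n w)"
proof -
  note [measurable] = bounded_measurable[OF Y] bounded_measurable[OF Z]
  have "\<exists>B>0. \<forall>\<^sub>F n in sequentially. measure M {w \<in> space M. \<bar>Y n w * Z n w\<bar> > B} < \<eta>" if \<eta>: "\<eta> > 0" for \<eta>
  proof -
    obtain B where B: "B > 0" "\<forall>\<^sub>F n in sequentially. measure M {w \<in> space M. \<bar>Y n w\<bar> > B} < \<eta> / 2"
      using Y \<eta> unfolding bounded_in_probability_def by (meson half_gt_zero)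
    obtain C where C: "C > 0" "\<forall>\<^sub>F n in sequentially. measure M {w \<in> space M. \<bar>Z n w\<bar> > C} < \<eta> / 2"
      using Z \<eta> unfolding bounded_in_probability_def by (meson half_gt_zero)
    from B(2) C(2) have "\<forall>\<^sub>F n in sequentially. measure M {w \<in> space M. \<bar>Y n w * Z n w\<bar> > B * C} < \<eta>"
    proof eventually_elim
      case (elim n)
      have "measure M {w \<in> space M. \<bar>Y n w * Z n w\<bar> > B * C} \<le>
        measure M ({w \<in> space M. \<bar>Y n w\<bar> > B} \<union> {w \<in> space M. \<bar>Z n w\<bar> > C})"
      proof (rule finite_measure_mono)
        show "{w \<in> space M. \<bar>Y n w * Z n w\<bar> > B * C} \<subseteq> {w \<in> space M. \<bar>Y n w\<bar> > B} \<union> {w \<in> space M. \<bar>Z n w\<bar> > C}"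
        proof (safe, rule ccontr)
          fix w assume w: "B * C < \<bar>Y n w * Z n w\<bar>" "\<not> \<bar>Z n w\<bar> > C" "\<not> \<bar>Y n w\<bar> > B"
          then have "\<bar>Y n w\<bar> * \<bar>Z n w\<bar> \<le> B * C" using B(1) by (intro mult_mono) auto
          then show False using w(1) by (simp add: abs_mult)
        qed
      qed measurable
      also have "\<dots> \<le> measure M {w \<in> space M. \<bar>Y n w\<bar> > B} + measure M {w \<in> space M. \<bar>Z n w\<bar> > C}"
        by (rule measure_Un_le) measurable
      finally show ?case using elim by linarith
    qed
    with B(1) C(1) show ?thesis by (intro exI[of _ "B * C"]) auto
  qed
  then show ?thesis unfolding bounded_in_probability_def by auto
qed

lemma Markov_abs:
  fixes f :: "'a \<Rightarrow> real"
  assumes "integrable M f" "0 < c"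
  shows "measure M {w \<in> space M. \<bar>f w\<bar> > c} \<le> (\<integral>w. \<bar>f w\<bar> \<partial>M) / c"
proof -
  have [measurable]: "f \<in> borel_measurable M" using assms by simp
  have "measure M {w \<in> space M. \<bar>f w\<bar> > c} \<le> measure M {w \<in> space M. \<bar>f w\<bar> \<ge> c}"
    by (rule finite_measure_mono) auto
  also have "\<dots> \<le> (\<integral>w. \<bar>f w\<bar> \<partial>M) / c"
    using assms by (intro integral_Markov_inequality_measure[where A = "{}"]) auto
  finally show ?thesis .
qed

lemma vanishes_of_L1:
  assumes "\<And>n. integrable M (Y n)" "(\<lambda>n. \<integral>w. \<bar>Y n w\<bar> \<partial>M) \<longlonglongrightarrow> 0"
  shows "vanishes_in_probability M Y"
proof (rule vanishes_in_probabilityI)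
  fix \<epsilon> :: real assume \<epsilon>: "\<epsilon> > 0"
  show "(\<lambda>n. measure M {w \<in> space M. \<bar>Y n w\<bar> > \<epsilon>}) \<longlonglongrightarrow> 0"
  proof (rule tendsto_sandwich[OF _ _ tendsto_const])
    show "(\<lambda>n. (\<integral>w. \<bar>Y n w\<bar> \<partial>M) / \<epsilon>) \<longlonglongrightarrow> 0"
      using tendsto_divide[OF assms(2) tendsto_const, of \<epsilon>] \<epsilon> by simp
  qed (use Markov_abs[OF assms(1) \<epsilon>] in auto)
qed (use assms in auto)

lemma bounded_of_L1:
  assumes "\<And>n. integrable M (Y n)" "\<And>n. (\<integral>w. \<bar>Y n w\<bar> \<partial>M) \<le> C"
  shows "bounded_in_probability M Y"
  unfolding bounded_in_probability_def
proof (intro conjI allI impI)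
  fix \<eta> :: real assume \<eta>: "\<eta> > 0"
  let ?B = "(\<bar>C\<bar> + 1) / \<eta>"
  have "measure M {w \<in> space M. \<bar>Y n w\<bar> > ?B} < \<eta>" for n
  proof -
    have "measure M {w \<in> space M. \<bar>Y n w\<bar> > ?B} \<le> (\<integral>w. \<bar>Y n w\<bar> \<partial>M) / ?B"
      using \<eta> by (intro Markov_abs assms) auto
    also have "\<dots> \<le> \<bar>C\<bar> / ?B"
      using \<eta> by (intro divide_right_mono order_trans[OF assms(2)]) auto
    also have "\<dots> < \<eta>" using \<eta> by (simp add: field_simps)
    finally show ?thesis .
  qed
  then show "\<exists>B>0. \<forall>\<^sub>F n in sequentially. measure M {w \<in> space M. \<bar>Y n w\<bar> > B} < \<eta>"
    using \<eta> by (intro exI[of _ ?B]) auto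
qed (use assms in auto)

text \<open>Outside exceptional events of small probability the sequence is dominated by a negligible one.
  The events to be estimated are covered by measurable ones, so the conclusion also applies to a
  statistic whose measurability is known for large \<open>n\<close> only.\<close>
lemma converges_in_probability_dominated:
  fixes Y :: "nat \<Rightarrow> 'a \<Rightarrow> real"
  assumes Z: "vanishes_in_probability M Z"
    and B: "\<And>n. B n \<in> sets M" "(\<lambda>n. measure M (B n)) \<longlonglongrightarrow> 0"
    and le: "\<forall>\<^sub>F n in sequentially. AE w in M. w \<notin> B n \<longrightarrow> \<bar>Y n w\<bar> \<le> \<bar>Z n w\<bar>"
  shows "converges_in_probability M Y (\<lambda>_. 0)"
  unfolding converges_in_probability_def
proof (intro allI impI)
  note [measurable] = vanishes_measurable[OF Z] B(1)
  fix \<epsilon> :: real assume \<epsilon>: "\<epsilon> > 0"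
  show "(\<lambda>n. measure M {w \<in> space M. dist (Y n w) 0 > \<epsilon>}) \<longlonglongrightarrow> 0"
  proof (rule tendsto_sandwich[OF _ _ tendsto_const])
    show "(\<lambda>n. measure M (B n) + measure M {w \<in> space M. \<bar>Z n w\<bar> > \<epsilon>}) \<longlonglongrightarrow> 0"
      using tendsto_add[OF B(2) vanishes_tendsto[OF Z \<epsilon>]] by simp
    from le show "\<forall>\<^sub>F n in sequentially. measure M {w \<in> space M. dist (Y n w) 0 > \<epsilon>}
        \<le> measure M (B n) + measure M {w \<in> space M. \<bar>Z n w\<bar> > \<epsilon>}"
    proof eventually_elim
      case (elim n)
      have "measure M {w \<in> space M. dist (Y n w) 0 > \<epsilon>} \<le> measure M (B n \<union> {w \<in> space M. \<bar>Z n w\<bar> > \<epsilon>})"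
      proof (rule finite_measure_mono_AE)
        show "AE w in M. w \<in> {w \<in> space M. dist (Y n w) 0 > \<epsilon>} \<longrightarrow> w \<in> B n \<union> {w \<in> space M. \<bar>Z n w\<bar> > \<epsilon>}"
          using elim by eventually_elim auto
      qed measurable
      also have "\<dots> \<le> measure M (B n) + measure M {w \<in> space M. \<bar>Z n w\<bar> > \<epsilon>}"
        by (rule measure_Un_le) measurable
      finally show ?case .
    qed
  qed simp
qed

text \<open>Tightness of a weakly convergent sequence: test against continuous functions that vanish on a
  large ball and equal 1 outside a slightly larger one.\<close>
lemma bounded_of_converges_in_distribution:
  fixes R :: "nat \<Rightarrow> 'a \<Rightarrow> 'b::euclidean_space"
  assumes "converges_in_distribution M R L"
  shows "bounded_in_probability M (\<lambda>n w. norm (R n w))"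
  unfolding bounded_in_probability_def
proof (intro conjI allI impI)
  have L: "prob_space L" and sL [measurable_cong]: "sets L = sets borel"
    and R [measurable]: "\<And>n. R n \<in> borel_measurable M"
    and conv: "\<And>f :: 'b \<Rightarrow> real. continuous_on UNIV f \<Longrightarrow> bounded (range f) \<Longrightarrow>
       (\<lambda>n. \<integral>w. f (R n w) \<partial>M) \<longlonglongrightarrow> (\<integral>z. f z \<partial>L)"
    using assms by (auto simp: converges_in_distribution_def)
  interpret L: prob_space L by fact
  show "(\<lambda>w. norm (R n w)) \<in> borel_measurable M" for n by measurable
  fix \<eta> :: real assume \<eta>: "\<eta> > 0"
  define f where "f c z = min 1 (max 0 (norm z - real c))" for c and z :: 'b
  have fm [measurable]: "f c \<in> borel_measurable borel" for c
    unfolding f_def by measurable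
  have fb: "\<bar>f c z\<bar> \<le> 1" "0 \<le> f c z" "f c z \<le> 1" for c z by (auto simp: f_def)
  have "(\<lambda>c. \<integral>z. f c z \<partial>L) \<longlonglongrightarrow> (\<integral>z. 0 \<partial>L)"
  proof (rule integral_dominated_convergence[where w = "\<lambda>_. 1"])
    show "AE z in L. (\<lambda>c. f c z) \<longlonglongrightarrow> 0"
    proof (rule AE_I2)
      fix z
      have "\<forall>\<^sub>F c in sequentially. f c z = 0"
      proof (rule eventually_sequentiallyI[of "nat \<lceil>norm z\<rceil>"])
        fix c assume "nat \<lceil>norm z\<rceil> \<le> c"
        then have "norm z \<le> real c" by linarith
        then show "f c z = 0" by (simp add: f_def)
      qed
      then show "(\<lambda>c. f c z) \<longlonglongrightarrow> 0" by (rule tendsto_eventually)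
    qed
  qed (auto simp: fb)
  then have "\<forall>\<^sub>F c in sequentially. (\<integral>z. f c z \<partial>L) < \<eta>"
    using \<eta> by (intro order_tendstoD) auto
  then obtain c where c: "(\<integral>z. f c z \<partial>L) < \<eta>" by (auto simp: eventually_sequentially)
  have "(\<lambda>n. \<integral>w. f c (R n w) \<partial>M) \<longlonglongrightarrow> (\<integral>z. f c z \<partial>L)"
  proof (rule conv)
    show "continuous_on UNIV (f c)" unfolding f_def by (intro continuous_intros)
    show "bounded (range (f c))" by (rule boundedI[of _ 1]) (use fb in auto)
  qed
  then have "\<forall>\<^sub>F n in sequentially. (\<integral>w. f c (R n w) \<partial>M) < \<eta>"
    by (rule order_tendstoD) (rule c)
  then have "\<forall>\<^sub>F n in sequentially. measure M {w \<in> space M. \<bar>norm (R n w)\<bar> > real c + 1} < \<eta>"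
  proof eventually_elim
    case (elim n)
    have "measure M {w \<in> space M. \<bar>norm (R n w)\<bar> > real c + 1} =
        (\<integral>w. indicator {w \<in> space M. \<bar>norm (R n w)\<bar> > real c + 1} w \<partial>M)"
      by simp
    also have "\<dots> \<le> (\<integral>w. f c (R n w) \<partial>M)"
    proof (rule integral_mono)
      show "integrable M (\<lambda>w. f c (R n w))"
        by (rule integrable_const_bound[of _ 1]) (auto simp: fb)
      show "integrable M (\<lambda>w. indicator {w \<in> space M. \<bar>norm (R n w)\<bar> > real c + 1} w :: real)"
        by (rule integrable_const_bound[of _ 1]) (auto simp: indicator_def)
    qed (auto simp: f_def indicator_def)
    finally show ?case using elim by simp
  qed
  then show "\<exists>B>0. \<forall>\<^sub>F n in sequentially. measure M {w \<in> space M. \<bar>norm (R n w)\<bar> > B} < \<eta>"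
    by (intro exI[of _ "real c + 1"]) auto
qed

end

section \<open>Third order Taylor expansion\<close>

lemma has_derivative_grad:
  fixes f :: "real^'p \<Rightarrow> real"
  assumes "f differentiable (at t)"
  shows "(f has_derivative (\<lambda>h. \<Sum>i\<in>UNIV. h $ i * grad f t $ i)) (at t)"
proof -
  have D: "(f has_derivative frechet_derivative f (at t)) (at t)"
    using assms by (simp add: frechet_derivative_works)
  interpret bounded_linear "frechet_derivative f (at t)"
    by (rule has_derivative_bounded_linear[OF D])
  have "frechet_derivative f (at t) h = (\<Sum>i\<in>UNIV. h $ i * grad f t $ i)" for h
  proof -
    have "frechet_derivative f (at t) h = frechet_derivative f (at t) (\<Sum>i\<in>UNIV. h $ i *\<^sub>R axis i 1)"
      by (simp add: basis_expansion[of h, unfolded scalar_mult_eq_scaleR])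
    also have "\<dots> = (\<Sum>i\<in>UNIV. h $ i * grad f t $ i)"
      by (simp add: sum scaleR grad_def)
    finally show ?thesis .
  qed
  then have "frechet_derivative f (at t) = (\<lambda>h. \<Sum>i\<in>UNIV. h $ i * grad f t $ i)" by (rule ext)
  with D show ?thesis by simp
qed

lemma DERIV_along_line:
  fixes f :: "real^'p \<Rightarrow> real"
  assumes "f differentiable (at (\<theta> + s *\<^sub>R h))"
  shows "DERIV (\<lambda>s. f (\<theta> + s *\<^sub>R h)) s :> (\<Sum>i\<in>UNIV. h $ i * grad f (\<theta> + s *\<^sub>R h) $ i)"
proof -
  have "((\<lambda>s. \<theta> + s *\<^sub>R h) has_derivative (\<lambda>x. x *\<^sub>R h)) (at s)"
    by (auto intro!: derivative_eq_intros)
  from diff_chain_at[OF this has_derivative_grad[OF assms]]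
  show ?thesis
    unfolding has_field_derivative_def comp_def
    by (rule has_derivative_eq_rhs) (simp add: fun_eq_iff sum_distrib_left mult_ac)
qed

text \<open>Taylor's theorem with Lagrange remainder along the segment from \<open>\<theta>\<close> to \<open>\<theta> + h\<close>. The factor
  \<open>1/6\<close> of the remainder is discarded.\<close>
lemma taylor_third_order:
  fixes f :: "real^'p \<Rightarrow> real"
  assumes f: "three_times_differentiable_on f U" and seg: "\<And>s. 0 \<le> s \<Longrightarrow> s \<le> 1 \<Longrightarrow> \<theta> + s *\<^sub>R h \<in> U"
    and B: "\<And>t i j k. t \<in> U \<Longrightarrow> \<bar>grad3 f t $ i $ j $ k\<bar> \<le> B i j k"
  shows "\<bar>f (\<theta> + h) - f \<theta> - (\<Sum>i\<in>UNIV. h $ i * grad f \<theta> $ i)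
      - (\<Sum>i\<in>UNIV. \<Sum>j\<in>UNIV. h $ i * h $ j * grad2 f \<theta> $ i $ j) / 2\<bar>
    \<le> norm h ^ 3 * (\<Sum>i\<in>UNIV. \<Sum>j\<in>UNIV. \<Sum>k\<in>UNIV. B i j k)"
proof -
  let ?p = "\<lambda>s. \<theta> + s *\<^sub>R h"
  let ?d1 = "\<lambda>s. \<Sum>i\<in>UNIV. h $ i * grad f (?p s) $ i"
  let ?d2 = "\<lambda>s. \<Sum>i\<in>UNIV. h $ i * (\<Sum>j\<in>UNIV. h $ j * grad2 f (?p s) $ i $ j)"
  let ?d3 = "\<lambda>s. \<Sum>i\<in>UNIV. h $ i * (\<Sum>j\<in>UNIV. h $ j * (\<Sum>k\<in>UNIV. h $ k * grad3 f (?p s) $ i $ j $ k))"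
  define diff where "diff m = [\<lambda>s. f (?p s), ?d1, ?d2, ?d3] ! m" for m
  have d: "f differentiable (at t)" "(\<lambda>s. grad f s $ i) differentiable (at t)"
    "(\<lambda>s. grad2 f s $ i $ j) differentiable (at t)" if "t \<in> U" for t i j
    using f that by (auto simp: three_times_differentiable_on_def)
  have 0: "DERIV (\<lambda>s. f (?p s)) s :> ?d1 s" if "0 \<le> s" "s \<le> 1" for s
    using d(1)[OF seg[OF that]] by (rule DERIV_along_line)
  have 1: "DERIV ?d1 s :> ?d2 s" if "0 \<le> s" "s \<le> 1" for s
    using DERIV_along_line[OF d(2)[OF seg[OF that]]]
    by (intro DERIV_sum DERIV_cmult) (simp add: grad2_def)
  have 2: "DERIV ?d2 s :> ?d3 s" if "0 \<le> s" "s \<le> 1" for s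
    using DERIV_along_line[OF d(3)[OF seg[OF that]]]
    by (intro DERIV_sum DERIV_cmult) (simp add: grad3_def)
  have "\<exists>t>0. t < 1 \<and> f (?p 1) = (\<Sum>m<3. diff m 0 / fact m * 1 ^ m) + diff 3 t / fact 3 * 1 ^ 3"
  proof (rule Maclaurin[where f = "\<lambda>s. f (?p s)"])
    show "\<forall>m t. m < 3 \<and> 0 \<le> t \<and> t \<le> 1 \<longrightarrow> DERIV (diff m) t :> diff (Suc m) t"
      using 0 1 2 by (auto simp: diff_def less_Suc_eq numeral_3_eq_3 numeral_2_eq_2)
  qed (auto simp: diff_def)
  then obtain t where t: "0 < t" "t < 1"
    and eq: "f (?p 1) = (\<Sum>m<3. diff m 0 / fact m * 1 ^ m) + diff 3 t / fact 3 * 1 ^ 3" by blast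
  have "f (\<theta> + h) - f \<theta> - (\<Sum>i\<in>UNIV. h $ i * grad f \<theta> $ i)
      - (\<Sum>i\<in>UNIV. \<Sum>j\<in>UNIV. h $ i * h $ j * grad2 f \<theta> $ i $ j) / 2 = ?d3 t / 6"
    using eq by (simp add: diff_def numeral_3_eq_3 numeral_2_eq_2 fact_numeral sum_distrib_left mult.assoc)
  also have "\<bar>\<dots>\<bar> \<le> \<bar>?d3 t\<bar>" by simp
  also have "\<bar>?d3 t\<bar> \<le> (\<Sum>i\<in>UNIV. \<Sum>j\<in>UNIV. \<Sum>k\<in>UNIV. norm h ^ 3 * B i j k)"
  proof -
    have "\<bar>h $ i * (h $ j * (h $ k * grad3 f (?p t) $ i $ j $ k))\<bar> \<le> norm h ^ 3 * B i j k" for i j k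
    proof -
      have "\<bar>h $ i\<bar> * (\<bar>h $ j\<bar> * (\<bar>h $ k\<bar> * \<bar>grad3 f (?p t) $ i $ j $ k\<bar>))
          \<le> norm h * (norm h * (norm h * B i j k))"
        using B[OF seg] t by (intro mult_mono component_le_norm_cart) (auto intro!: mult_nonneg_nonneg)
      then show ?thesis by (simp add: abs_mult power3_eq_cube mult.assoc)
    qed
    then show ?thesis
      unfolding sum_distrib_left
      by (intro order_trans[OF sum_abs] sum_mono)
  qed
  finally show ?thesis by (simp add: sum_distrib_left)
qed

section \<open>Weak convergence from exponentials\<close>

text \<open>A continuous function composed with \<open>x \<mapsto> L * arcsin (sin (x / L))\<close> is a continuous function of
  \<open>sin (x / L)\<close>, so Weierstrass approximates it uniformly on the whole line by a polynomial in
  \<open>sin (x / L)\<close>. The composition changes nothing for \<open>\<bar>x\<bar> \<le> L\<close>, and beyond that bound the error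
  \<open>2 * F\<close> is absorbed by \<open>x\<^sup>2\<close>. A quadratic error is harmless for sequences with bounded second
  moments.\<close>
lemma trigonometric_approximation:
  fixes f :: "real \<Rightarrow> complex"
  assumes cont: "continuous_on UNIV f" and bd: "\<And>x. cmod (f x) \<le> F" and \<delta>: "0 < \<delta>"
  obtains a b :: "nat \<Rightarrow> real" and m n :: nat and L :: real where
    "\<forall>x. cmod (f x - (complex_of_real (\<Sum>i\<le>m. a i * sin (x / L) ^ i)
        + \<i> * complex_of_real (\<Sum>i\<le>n. b i * sin (x / L) ^ i))) \<le> \<delta> * (1 + x\<^sup>2)"
proof -
  have F: "0 \<le> F" using bd[of 0] norm_ge_zero order_trans by blast
  \<comment> \<open>large enough that \<open>2 * F \<le> \<delta> * x\<^sup>2\<close> whenever \<open>\<bar>x\<bar> > L\<close>\<close>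
  define L where "L = 1 + 2 * F / \<delta>"
  have L: "L \<ge> 1" "2 * F \<le> \<delta> * L"
    using F \<delta> by (auto simp: L_def field_simps)
  define h where "h v = f (L * arcsin v)" for v
  have contf: "continuous_on S f" for S using cont continuous_on_subset by blast
  have conth: "continuous_on {-1..1} h"
    unfolding h_def by (intro continuous_on_compose2[OF cont] continuous_intros) auto
  obtain p where p: "real_polynomial_function p" "\<And>x. x \<in> {-1..1} \<Longrightarrow> \<bar>Re (h x) - p x\<bar> < \<delta> / 2"
    by (rule Stone_Weierstrass_real_polynomial_function[of "{-1..1::real}" "\<lambda>x. Re (h x)" "\<delta> / 2"])
       (use \<delta> in \<open>auto intro!: continuous_intros conth\<close>)
  obtain q where q: "real_polynomial_function q" "\<And>x. x \<in> {-1..1} \<Longrightarrow> \<bar>Im (h x) - q x\<bar> < \<delta> / 2"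
    by (rule Stone_Weierstrass_real_polynomial_function[of "{-1..1::real}" "\<lambda>x. Im (h x)" "\<delta> / 2"])
       (use \<delta> in \<open>auto intro!: continuous_intros conth\<close>)
  obtain a m where a: "p = (\<lambda>x. \<Sum>i\<le>m. a i * x ^ i)" using p(1) by (auto simp: real_polynomial_function_iff_sum)
  obtain b n where b: "q = (\<lambda>x. \<Sum>i\<le>n. b i * x ^ i)" using q(1) by (auto simp: real_polynomial_function_iff_sum)
  have "cmod (f x - (complex_of_real (p (sin (x / L))) + \<i> * complex_of_real (q (sin (x / L)))))
      \<le> \<delta> * (1 + x\<^sup>2)" for x
  proof -
    let ?v = "sin (x / L)"
    let ?z = "complex_of_real (p ?v) + \<i> * complex_of_real (q ?v)"
    have "cmod (h ?v - ?z) \<le> \<bar>Re (h ?v - ?z)\<bar> + \<bar>Im (h ?v - ?z)\<bar>" by (rule cmod_le)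
    also have "\<dots> \<le> \<delta>" using p(2)[of ?v] q(2)[of ?v] by simp
    finally have 1: "cmod (h ?v - ?z) \<le> \<delta>" .
    have 2: "cmod (f x - h ?v) \<le> \<delta> * x\<^sup>2"
    proof (cases "\<bar>x\<bar> \<le> L")
      case True
      then have "\<bar>x / L\<bar> \<le> 1" using L by simp
      moreover have "1 \<le> pi / 2" using pi_ge_two by simp
      ultimately have "arcsin ?v = x / L" by (intro arcsin_sin) linarith+
      then have "f x = h ?v" using L by (simp add: h_def)
      then show ?thesis using \<delta> by simp
    next
      case False
      have "cmod (f x - h ?v) \<le> cmod (f x) + cmod (h ?v)" by (rule norm_triangle_ineq4)
      also have "\<dots> \<le> 2 * F" using bd[of x] bd[of "L * arcsin ?v"] by (simp add: h_def)
      also have "\<dots> \<le> \<delta> * L" by (rule L)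
      also have "\<dots> \<le> \<delta> * x\<^sup>2"
      proof -
        have "L * 1 \<le> \<bar>x\<bar> * \<bar>x\<bar>" using False L by (intro mult_mono) auto
        then show ?thesis using \<delta> by (simp add: power2_eq_square)
      qed
      finally show ?thesis .
    qed
    have "cmod (f x - ?z) \<le> cmod (f x - h ?v) + cmod (h ?v - ?z)"
      using dist_triangle[of "f x" ?z "h ?v"] unfolding dist_norm .
    also have "\<dots> \<le> \<delta> * x\<^sup>2 + \<delta>" using 1 2 by linarith
    finally show ?thesis by (simp add: algebra_simps)
  qed
  then have "\<forall>x. cmod (f x - (complex_of_real (p (sin (x / L))) + \<i> * complex_of_real
      (q (sin (x / L))))) \<le> \<delta> * (1 + x\<^sup>2)"
    by (rule allI)
  then show thesis
    unfolding a b by (rule that)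
qed

text \<open>A continuity theorem with bounded complex weights \<open>W n\<close>. The test functions for which the
  limit holds form a linear space containing the exponentials, hence all polynomials in
  \<open>sin (x / L)\<close>, and those approximate every bounded continuous function up to a quadratic
  error. The weights make an induction over several coordinates possible: the coordinates not
  currently treated are packed into them.\<close>
lemma (in prob_space) weighted_weak_convergence:
  fixes W :: "nat \<Rightarrow> 'a \<Rightarrow> complex" and S :: "nat \<Rightarrow> 'a \<Rightarrow> real" and \<mu> :: "real measure" and f :: "real \<Rightarrow> complex"
  assumes \<mu>: "real_distribution \<mu>" and \<mu>2: "integrable \<mu> (\<lambda>x. x\<^sup>2)"
    and W [measurable]: "\<And>n. W n \<in> borel_measurable M" and WB: "\<And>n w. cmod (W n w) \<le> B"
    and S [measurable]: "\<And>n. S n \<in> borel_measurable M"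
    and S2: "\<And>n. integrable M (\<lambda>w. (S n w)\<^sup>2)" "\<And>n. (\<integral>w. (S n w)\<^sup>2 \<partial>M) \<le> C"
    and char: "\<And>u. (\<lambda>n. \<integral>w. W n w * iexp (u * S n w) \<partial>M) \<longlonglongrightarrow> c * char \<mu> u"
    and f: "continuous_on UNIV f" "\<And>x. cmod (f x) \<le> F"
  shows "(\<lambda>n. \<integral>w. W n w * f (S n w) \<partial>M) \<longlonglongrightarrow> c * (\<integral>x. f x \<partial>\<mu>)"
proof -
  interpret \<mu>: real_distribution \<mu> by fact
  have B: "0 \<le> B" using WB[of 0] norm_ge_zero order_trans by blast
  have "0 \<le> (\<integral>w. (S 0 w)\<^sup>2 \<partial>M)" by simp
  then have C: "0 \<le> C" using S2(2)[of 0] by linarith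
  define lim where "lim h \<longleftrightarrow> (\<lambda>n. \<integral>w. W n w * h (S n w) \<partial>M) \<longlonglongrightarrow> c * (\<integral>x. h x \<partial>\<mu>)" for h :: "real \<Rightarrow> complex"
  define good where "good h \<longleftrightarrow> h \<in> borel_measurable borel \<and> bounded (range h) \<and> lim h" for h
  have int: "integrable M (\<lambda>w. W n w * h (S n w))" "integrable \<mu> h"
    if h: "h \<in> borel_measurable borel" "bounded (range h)" for h n
  proof -
    note [measurable] = h(1)
    obtain H where H: "\<And>x. cmod (h x) \<le> H" using h(2) by (auto simp: bounded_iff)
    show "integrable M (\<lambda>w. W n w * h (S n w))"
      by (rule integrable_const_bound[of _ "B * H"])
         (auto simp: norm_mult intro!: mult_mono WB H B)
    show "integrable \<mu> h"
      by (rule \<mu>.integrable_const_bound[of _ H]) (auto simp: H)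
  qed
  have good_add: "good (\<lambda>x. h1 x + h2 x)" if "good h1" "good h2" for h1 h2
  proof -
    have *: "h1 \<in> borel_measurable borel" "bounded (range h1)" "h2 \<in> borel_measurable borel"
        "bounded (range h2)"
      using that by (auto simp: good_def)
    have "lim (\<lambda>x. h1 x + h2 x)"
      using that int[OF *(1,2)] int[OF *(3,4)]
      by (auto simp: good_def lim_def algebra_simps intro: tendsto_add)
    then show ?thesis
      using * by (auto simp: good_def bounded_plus_comp)
  qed
  have good_cmult: "good (\<lambda>x. d * h x)" if "good h" for h d
  proof -
    have *: "h \<in> borel_measurable borel" "bounded (range h)"
      using that by (auto simp: good_def)
    obtain H where H: "\<And>x. cmod (h x) \<le> H" using *(2) by (auto simp: bounded_iff)
    have "bounded (range (\<lambda>x. d * h x))"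
      by (rule boundedI[of _ "cmod d * H"]) (auto simp: norm_mult intro!: mult_left_mono H)
    moreover have "lim (\<lambda>x. d * h x)"
      using tendsto_mult[OF tendsto_const[of d], of "\<lambda>n. \<integral>w. W n w * h (S n w) \<partial>M" "c * (\<integral>x. h x \<partial>\<mu>)"]
          that int[OF *]
      by (simp add: good_def lim_def mult.left_commute[of _ d])
    ultimately show ?thesis using * by (simp add: good_def)
  qed
  have good_sum: "good (\<lambda>x. \<Sum>i\<in>A. h i x)" if "\<And>i. good (h i)" for A :: "nat set" and h
  proof (induction A rule: infinite_finite_induct)
    case (insert i A)
    then show ?case using good_add[OF that[of i]] by simp
  qed (simp_all add: good_def lim_def)
  have good_iexp: "good (\<lambda>x. iexp (u * x))" for u
  proof -
    have "bounded (range (\<lambda>x. iexp (u * x)))" by (rule boundedI[of _ 1]) auto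
    then show ?thesis using char[of u] by (simp add: good_def lim_def char_def)
  qed
  have good_sin: "good (\<lambda>x. complex_of_real (sin (x / L) ^ k) * iexp (u * x))" for L k u
  proof (induction k arbitrary: u)
    case 0
    then show ?case using good_iexp by simp
  next
    case (Suc k)
    \<comment> \<open>Euler's formula shifts the frequency by \<open>\<plusminus> 1 / L\<close> for each factor \<open>sin\<close>\<close>
    have step: "complex_of_real (sin (x / L) ^ Suc k) * iexp (u * x) =
       - (\<i> / 2) * (complex_of_real (sin (x / L) ^ k) * iexp ((u + 1 / L) * x))
       + (\<i> / 2) * (complex_of_real (sin (x / L) ^ k) * iexp ((u - 1 / L) * x))" for x
    proof -
      have s: "complex_of_real (sin (x / L)) = - (\<i> / 2) * (iexp (x / L) - iexp (- (x / L)))"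
        by (simp add: sin_exp_eq sin_of_real[symmetric] exp_minus field_simps)
      have e: "iexp ((u + 1 / L) * x) = iexp (u * x) * iexp (x / L)"
        "iexp ((u - 1 / L) * x) = iexp (u * x) * iexp (- (x / L))"
        by (simp_all add: exp_add[symmetric] ring_distribs diff_divide_distrib)
      have ring: "(- c * (P - Q) * r) * E = - c * (r * (E * P)) + c * (r * (E * Q))"
        for c P Q r E :: complex by (simp add: algebra_simps)
      show ?thesis unfolding e power_Suc of_real_mult[of "sin (x / L)"] s by (rule ring)
    qed
    show ?case unfolding step by (intro good_add good_cmult Suc)
  qed
  have good_poly: "good (\<lambda>x. complex_of_real (\<Sum>i\<le>m. a i * sin (x / L) ^ i))" for m L and a :: "nat \<Rightarrow> real"
  proof -
    have "good (\<lambda>x. \<Sum>i\<le>m. complex_of_real (a i) * (complex_of_real (sin (x / L) ^ i) * iexp (0 * x)))"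
      by (intro good_sum good_cmult good_sin)
    then show ?thesis by simp
  qed
  have [measurable]: "f \<in> borel_measurable borel" using f(1) by (rule borel_measurable_continuous_onI)
  have fb: "bounded (range f)" using f(2) by (auto simp: bounded_iff)
  define V where "V = (\<integral>x. x\<^sup>2 \<partial>\<mu>)"
  have V: "0 \<le> V" unfolding V_def by simp
  show ?thesis
  proof (rule tendstoI)
    fix \<epsilon> :: real assume \<epsilon>: "0 < \<epsilon>"
    define K where "K = B * (1 + C) + cmod c * (1 + V) + 1"
    have K: "0 < K" using B C V by (auto simp: K_def intro!: add_nonneg_pos)
    define \<delta> where "\<delta> = \<epsilon> / (2 * K)"
    have \<delta>: "0 < \<delta>" using \<epsilon> K by (simp add: \<delta>_def)
    obtain a b m n L where approx:
      "\<forall>x. cmod (f x - (complex_of_real (\<Sum>i\<le>m. a i * sin (x / L) ^ i)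
        + \<i> * complex_of_real (\<Sum>i\<le>n. b i * sin (x / L) ^ i))) \<le> \<delta> * (1 + x\<^sup>2)"
      by (rule trigonometric_approximation[OF f \<delta>])
    define p where "p x = complex_of_real (\<Sum>i\<le>m. a i * sin (x / L) ^ i)
        + \<i> * complex_of_real (\<Sum>i\<le>n. b i * sin (x / L) ^ i)" for x
    have "good p" unfolding p_def by (intro good_add good_cmult good_poly)
    then have p: "p \<in> borel_measurable borel" "bounded (range p)" "lim p" by (auto simp: good_def)
    note [measurable] = p(1)
    have ap: "cmod (f x - p x) \<le> \<delta> * (1 + x\<^sup>2)" for x using approx by (simp add: p_def)
    have M_bound: "cmod ((\<integral>w. W k w * f (S k w) \<partial>M) - (\<integral>w. W k w * p (S k w) \<partial>M)) \<le> \<delta> * (B * (1 + C))" for k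
    proof -
      have "(\<integral>w. W k w * f (S k w) \<partial>M) - (\<integral>w. W k w * p (S k w) \<partial>M) = (\<integral>w. W k w * (f (S k w) - p (S k w)) \<partial>M)"
        using int(1)[OF _ fb] int(1)[OF p(1,2)] by (simp add: right_diff_distrib)
      also have "cmod \<dots> \<le> (\<integral>w. B * (\<delta> * (1 + (S k w)\<^sup>2)) \<partial>M)"
      proof (rule norm_integral_le_integral)
        show "integrable M (\<lambda>w. W k w * (f (S k w) - p (S k w)))"
          using int(1)[OF _ fb] int(1)[OF p(1,2)] by (simp add: right_diff_distrib)
        show "cmod (W k w * (f (S k w) - p (S k w))) \<le> B * (\<delta> * (1 + (S k w)\<^sup>2))" for w
          unfolding norm_mult by (intro mult_mono WB ap B norm_ge_zero)
      qed (use S2 in auto)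
      also have "\<dots> = B * (\<delta> * (1 + (\<integral>w. (S k w)\<^sup>2 \<partial>M)))"
        using S2(1)[of k] by (simp add: prob_space)
      also have "\<dots> \<le> B * (\<delta> * (1 + C))"
        using S2(2)[of k] B \<delta> by (intro mult_left_mono) auto
      finally show ?thesis by (simp add: mult.left_commute)
    qed
    have \<mu>_bound: "cmod (c * (\<integral>x. f x \<partial>\<mu>) - c * (\<integral>x. p x \<partial>\<mu>)) \<le> \<delta> * (cmod c * (1 + V))"
    proof -
      have "(\<integral>x. f x \<partial>\<mu>) - (\<integral>x. p x \<partial>\<mu>) = (\<integral>x. f x - p x \<partial>\<mu>)"
        using int(2)[OF _ fb] int(2)[OF p(1,2)] by simp
      also have "cmod \<dots> \<le> (\<integral>x. \<delta> * (1 + x\<^sup>2) \<partial>\<mu>)"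
        using int(2)[OF _ fb] int(2)[OF p(1,2)] \<mu>2 by (intro norm_integral_le_integral ap) auto
      also have "\<dots> = \<delta> * (1 + V)" using \<mu>2 \<mu>.prob_space by (simp add: V_def)
      finally have "cmod c * cmod ((\<integral>x. f x \<partial>\<mu>) - (\<integral>x. p x \<partial>\<mu>)) \<le> cmod c * (\<delta> * (1 + V))"
        by (rule mult_left_mono) simp
      then show ?thesis by (simp add: norm_mult[symmetric] right_diff_distrib mult.left_commute)
    qed
    have "\<forall>\<^sub>F k in sequentially. dist (\<integral>w. W k w * p (S k w) \<partial>M) (c * (\<integral>x. p x \<partial>\<mu>)) < \<epsilon> / 2"
      using p(3) \<epsilon> unfolding lim_def by (intro tendstoD) auto
    then show "\<forall>\<^sub>F k in sequentially. dist (\<integral>w. W k w * f (S k w) \<partial>M) (c * (\<integral>x. f x \<partial>\<mu>)) < \<epsilon>"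
    proof eventually_elim
      case (elim k)
      have "dist (\<integral>w. W k w * f (S k w) \<partial>M) (c * (\<integral>x. f x \<partial>\<mu>)) \<le>
          dist (\<integral>w. W k w * f (S k w) \<partial>M) (\<integral>w. W k w * p (S k w) \<partial>M)
          + (dist (\<integral>w. W k w * p (S k w) \<partial>M) (c * (\<integral>x. p x \<partial>\<mu>))
          + dist (c * (\<integral>x. p x \<partial>\<mu>)) (c * (\<integral>x. f x \<partial>\<mu>)))"
        by (meson add_left_mono dist_triangle order_trans)
      also have "\<dots> < \<delta> * (B * (1 + C)) + (\<epsilon> / 2 + \<delta> * (cmod c * (1 + V)))"
        using M_bound[of k] \<mu>_bound elim by (intro add_le_less_mono add_less_le_mono)
            (simp_all add: dist_norm norm_minus_commute)
      also have "\<dots> \<le> \<epsilon> / 2 + \<delta> * K" using \<delta> by (simp add: K_def algebra_simps)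
      also have "\<dots> = \<epsilon>" using K by (simp add: \<delta>_def)
      finally show ?case .
    qed
  qed
qed

text \<open>Convergence of the joint characteristic function implies convergence of expectations of
  products of bounded continuous functions of the single coordinates. The exponentials are
  replaced one coordinate at a time, the remaining factors serving as weight.\<close>
lemma (in prob_space) product_weak_convergence:
  fixes S :: "'i \<Rightarrow> nat \<Rightarrow> 'a \<Rightarrow> real" and \<mu> :: "real measure" and f :: "'i \<Rightarrow> real \<Rightarrow> complex"
  assumes \<mu>: "real_distribution \<mu>" and \<mu>2: "integrable \<mu> (\<lambda>x. x\<^sup>2)" and J: "finite J"
    and S [measurable]: "\<And>j n. j \<in> J \<Longrightarrow> S j n \<in> borel_measurable M"
    and S2: "\<And>j n. j \<in> J \<Longrightarrow> integrable M (\<lambda>w. (S j n w)\<^sup>2)" "\<And>j n. j \<in> J \<Longrightarrow> (\<integral>w. (S j n w)\<^sup>2 \<partial>M) \<le> C"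
    and char: "\<And>u. (\<lambda>n. \<integral>w. iexp (\<Sum>j\<in>J. u j * S j n w) \<partial>M) \<longlonglongrightarrow> (\<Prod>j\<in>J. char \<mu> (u j))"
    and f: "\<And>j. continuous_on UNIV (f j)" "\<And>j x. cmod (f j x) \<le> 1"
  shows "(\<lambda>n. \<integral>w. (\<Prod>j\<in>J. f j (S j n w)) \<partial>M) \<longlonglongrightarrow> (\<Prod>j\<in>J. \<integral>x. f j x \<partial>\<mu>)"
proof -
  have [measurable]: "f j \<in> borel_measurable borel" for j
    using f(1) by (rule borel_measurable_continuous_onI)
  have "(\<lambda>n. \<integral>w. (\<Prod>j\<in>A. f j (S j n w)) * iexp (\<Sum>j\<in>J - A. u j * S j n w) \<partial>M) \<longlonglongrightarrow>
      (\<Prod>j\<in>A. \<integral>x. f j x \<partial>\<mu>) * (\<Prod>j\<in>J - A. char \<mu> (u j))" if "finite A" "A \<subseteq> J" for A u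
    using that
  proof (induction A arbitrary: u rule: finite_induct)
    case empty
    then show ?case using char[of u] by simp
  next
    case (insert j A)
    let ?R = "J - insert j A"
    have j: "j \<in> J" "finite ?R" "j \<notin> A" "j \<notin> ?R" "J - A = insert j ?R" "finite A"
      using insert J by auto
    let ?W = "\<lambda>n w. (\<Prod>j\<in>A. f j (S j n w)) * iexp (\<Sum>j\<in>?R. u j * S j n w)"
    have iexp_measurable: "iexp \<in> borel_measurable borel"
      by (intro borel_measurable_continuous_onI continuous_intros)
    have Wm: "?W n \<in> borel_measurable M" for n
      using insert.prems by (intro borel_measurable_times borel_measurable_prod
        measurable_compose[OF _ iexp_measurable]) (auto intro!: borel_measurable_sum borel_measurable_times)
    have WB: "cmod (?W n w) \<le> 1" for n w
    proof -
      have "(\<Prod>j\<in>A. cmod (f j (S j n w))) \<le> 1"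
        by (rule prod_le_1) (use f(2) in auto)
      then show ?thesis by (simp add: norm_mult prod_norm[symmetric])
    qed
    have "(\<lambda>n. \<integral>w. ?W n w * f j (S j n w) \<partial>M) \<longlonglongrightarrow>
        ((\<Prod>j\<in>A. \<integral>x. f j x \<partial>\<mu>) * (\<Prod>j\<in>?R. char \<mu> (u j))) * (\<integral>x. f j x \<partial>\<mu>)"
    proof (rule weighted_weak_convergence[where W = ?W and S = "S j" and f = "f j" and B = 1 and C
        = C and F = 1])
      show "integrable M (\<lambda>w. (S j n w)\<^sup>2)" "(\<integral>w. (S j n w)\<^sup>2 \<partial>M) \<le> C" "S j n \<in> borel_measurable M" for n
        using S2 S j(1) by auto
      show "continuous_on UNIV (f j)" "cmod (f j x) \<le> 1" for x by (rule f)+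
      show "?W n \<in> borel_measurable M" "cmod (?W n w) \<le> 1" for n w by (rule Wm WB)+
      show "real_distribution \<mu>" "integrable \<mu> (\<lambda>x. x\<^sup>2)" by fact+
      fix v
      have "(\<Sum>i\<in>J - A. (u(j := v)) i * S i n w) = v * S j n w + (\<Sum>i\<in>?R. u i * S i n w)" for n w
        unfolding j(5) using j(2,4) by (subst sum.insert) (auto intro!: sum.cong)
      then have eq1: "(\<Prod>j\<in>A. f j (S j n w)) * iexp (\<Sum>i\<in>J - A. (u(j := v)) i * S i n w)
          = ?W n w * iexp (v * S j n w)" for n w
        by (simp add: exp_add[symmetric] algebra_simps)
      have eq2: "(\<Prod>i\<in>J - A. char \<mu> ((u(j := v)) i)) = (\<Prod>i\<in>?R. char \<mu> (u i)) * char \<mu> v"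
        unfolding j(5) using j(2,4) by (subst prod.insert) (auto intro!: prod.cong)
      show "(\<lambda>n. \<integral>w. ?W n w * iexp (v * S j n w) \<partial>M) \<longlonglongrightarrow>
          (\<Prod>j\<in>A. \<integral>x. f j x \<partial>\<mu>) * (\<Prod>j\<in>?R. char \<mu> (u j)) * char \<mu> v"
        using insert.IH[of "u(j := v)"] insert.prems unfolding eq1 eq2
            by (simp only: mult.assoc insert_subset simp_thms)
    qed
    then show ?case using j(3,6) by (simp add: mult_ac)
  qed
  from this[of J "\<lambda>_. 0"] J show ?thesis by simp
qed

section \<open>The limit distribution as an infinite quadratic form\<close>

text \<open>The series \<open>\<Sum>i. lam i * (z i)\<^sup>2\<close> converges absolutely almost surely, as its expected absolute
  value is \<open>\<Sum>i. \<bar>lam i\<bar>\<close>. Hence its characteristic function is the limit of those of the partial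
  sums, which factorize by independence.\<close>
lemma chi_star_properties:
  assumes lam: "lam summable_on I"
  shows real_distribution_chi_star: "real_distribution (chi_star I lam)"
    and char_chi_star_limit: "(\<lambda>N. \<Prod>i\<in>I \<inter> {..<N}. \<integral>x. iexp (t * (lam i * x\<^sup>2)) \<partial>std_normal_distribution)
      \<longlonglongrightarrow> char (chi_star I lam) t"
proof -
  let ?N = std_normal_distribution
  let ?P = "PiM I (\<lambda>_::nat. ?N)"
  have N: "prob_space ?N" by (rule prob_space_normal_density) simp
  interpret P: product_prob_space "\<lambda>_::nat. ?N" I
    by (intro product_prob_spaceI N)
  have PP: "prob_space ?P" by (rule prob_space_PiM) (rule N)
  define b where "b i z = (if i \<in> I then lam i * (z i)\<^sup>2 else 0)" for i and z :: "nat \<Rightarrow> real"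
  have bm [measurable]: "b i \<in> borel_measurable ?P" for i
    by (cases "i \<in> I") (simp_all add: b_def[abs_def])
  define s where "s z = (\<Sum>\<^sub>\<infinity>i\<in>I. lam i * (z i)\<^sup>2)" for z :: "nat \<Rightarrow> real"
  have s_eq: "s z = (if summable (\<lambda>i. \<bar>b i z\<bar>) then suminf (\<lambda>i. b i z) else 0)" for z
  proof -
    have "s z = infsum (\<lambda>i. b i z) UNIV"
      unfolding s_def by (rule infsum_cong_neutral) (auto simp: b_def)
    also have "\<dots> = (if summable (\<lambda>i. \<bar>b i z\<bar>) then suminf (\<lambda>i. b i z) else 0)"
    proof (cases "summable (\<lambda>i. \<bar>b i z\<bar>)")
      case True
      then have "((\<lambda>i. b i z) has_sum suminf (\<lambda>i. b i z)) UNIV"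
        using norm_summable_imp_has_sum[OF _ summable_sums[OF summable_rabs_cancel[OF True]]] by simp
      then show ?thesis using True by (simp add: infsumI)
    next
      case False
      have "\<not> (\<lambda>i. b i z) summable_on UNIV"
      proof
        assume "(\<lambda>i. b i z) summable_on UNIV"
        then have "(\<lambda>i. \<bar>b i z\<bar>) summable_on UNIV"
          using summable_on_iff_abs_summable_on_real by force
        then show False using False by (auto dest: summable_on_imp_summable)
      qed
      then show ?thesis using False by (simp add: infsum_not_exists)
    qed
    finally show ?thesis .
  qed
  have sm [measurable]: "s \<in> borel_measurable ?P"
  proof -
    have "summable (\<lambda>i. \<bar>b i z\<bar>) \<longleftrightarrow> (\<Sum>i. ennreal \<bar>b i z\<bar>) \<noteq> top" for z
    proof
      show "(\<Sum>i. ennreal \<bar>b i z\<bar>) \<noteq> top" if "summable (\<lambda>i. \<bar>b i z\<bar>)"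
        by (rule ennreal_suminf_neq_top[OF that]) (rule abs_ge_zero)
      show "summable (\<lambda>i. \<bar>b i z\<bar>)" if "(\<Sum>i. ennreal \<bar>b i z\<bar>) \<noteq> top"
        by (rule summable_suminf_not_top[OF _ that]) (rule abs_ge_zero)
    qed
    then have "s = (\<lambda>z. if (\<Sum>i. ennreal \<bar>b i z\<bar>) \<noteq> top then suminf (\<lambda>i. b i z) else 0)"
      by (intro ext) (simp only: s_eq)
    then show ?thesis by simp
  qed
  have chi: "chi_star I lam = distr ?P borel s"
    by (simp add: chi_star_def s_def[abs_def])
  show "real_distribution (chi_star I lam)"
    unfolding chi by (rule prob_space.real_distribution_distr[OF PP]) measurable
  have coord: "integrable ?P (\<lambda>z. (z i)\<^sup>2)" "(\<integral>z. (z i)\<^sup>2 \<partial>?P) = 1" if i: "i \<in> I" for i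
  proof -
    have d: "distr ?P ?N (\<lambda>z. z i) = ?N"
      using distr_PiM_component[of I "\<lambda>_. ?N" i] N i by auto
    have c [measurable]: "(\<lambda>z. z i) \<in> ?P \<rightarrow>\<^sub>M ?N" using i by measurable
    have i2: "integrable ?N (\<lambda>x. x\<^sup>2)" by (rule integrable_std_normal_distribution_moment)
    have "integrable (distr ?P ?N (\<lambda>z. z i)) (\<lambda>x. x\<^sup>2)" using i2 by (simp only: d)
    then show "integrable ?P (\<lambda>z. (z i)\<^sup>2)" by (rule integrable_distr[OF c])
    have "(\<integral>x. x\<^sup>2 \<partial>distr ?P ?N (\<lambda>z. z i)) = (\<integral>z. (z i)\<^sup>2 \<partial>?P)"
      by (rule integral_distr[OF c]) simp
    moreover have "(\<integral>x. x\<^sup>2 \<partial>?N) = 1"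
      using std_normal_distribution_even_moments[of 1] by (simp add: fact_numeral)
    ultimately show "(\<integral>z. (z i)\<^sup>2 \<partial>?P) = 1" by (simp only: d)
  qed
  define l where "l i = (if i \<in> I then \<bar>lam i\<bar> else 0)" for i
  have l: "summable l"
  proof -
    have "(\<lambda>i. \<bar>lam i\<bar>) summable_on I"
      using lam summable_on_iff_abs_summable_on_real by force
    then have "l summable_on UNIV"
      by (rule summable_on_cong_neutral[THEN iffD1, rotated 3]) (auto simp: l_def)
    then show ?thesis by (rule summable_on_imp_summable)
  qed
  have "AE z in ?P. (\<Sum>i. ennreal \<bar>b i z\<bar>) \<noteq> \<infinity>"
  proof (rule nn_integral_noteq_infinite)
    have "(\<integral>\<^sup>+z. ennreal \<bar>b i z\<bar> \<partial>?P) = ennreal (l i)" for i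
    proof (cases "i \<in> I")
      case True
      have "(\<integral>\<^sup>+z. ennreal \<bar>b i z\<bar> \<partial>?P) = ennreal (\<integral>z. \<bar>b i z\<bar> \<partial>?P)"
        using coord(1)[OF True] True
        by (intro nn_integral_eq_integral) (auto simp: b_def[abs_def] abs_mult)
      then show ?thesis
        using True coord(2)[OF True] by (simp add: b_def l_def abs_mult)
    qed (simp add: b_def l_def)
    then have "(\<integral>\<^sup>+z. (\<Sum>i. ennreal \<bar>b i z\<bar>) \<partial>?P) = (\<Sum>i. ennreal (l i))"
      by (subst nn_integral_suminf) auto
    also have "\<dots> \<noteq> \<infinity>"
      unfolding infinity_ennreal_def by (rule ennreal_suminf_neq_top[OF l]) (simp add: l_def)
    finally show "(\<integral>\<^sup>+z. (\<Sum>i. ennreal \<bar>b i z\<bar>) \<partial>?P) \<noteq> \<infinity>" .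
  qed measurable
  then have conv: "AE z in ?P. (\<lambda>n. \<Sum>i<n. b i z) \<longlonglongrightarrow> s z"
  proof eventually_elim
    case (elim z)
    then have "summable (\<lambda>i. \<bar>b i z\<bar>)"
      using summable_iff_suminf_neq_top[of "\<lambda>i. \<bar>b i z\<bar>"] by auto
    then show ?case
      by (simp add: s_eq summable_LIMSEQ summable_rabs_cancel)
  qed
  have "(\<lambda>n. \<integral>z. iexp (t * (\<Sum>i<n. b i z)) \<partial>?P) \<longlonglongrightarrow> (\<integral>z. iexp (t * s z) \<partial>?P)"
  proof (rule integral_dominated_convergence[where w = "\<lambda>_. 1"])
    show "AE z in ?P. (\<lambda>n. iexp (t * (\<Sum>i<n. b i z))) \<longlonglongrightarrow> iexp (t * s z)"
      using conv by eventually_elim (intro tendsto_intros)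
  qed auto
  moreover have "(\<integral>z. iexp (t * s z) \<partial>?P) = char (chi_star I lam) t"
    unfolding chi char_def by (subst integral_distr) auto
  moreover have "(\<integral>z. iexp (t * (\<Sum>i<n. b i z)) \<partial>?P) =
      (\<Prod>i\<in>I \<inter> {..<n}. \<integral>x. iexp (t * (lam i * x\<^sup>2)) \<partial>?N)" for n
  proof -
    let ?F = "I \<inter> {..<n}"
    have F: "finite ?F" "?F \<subseteq> I" by auto
    have "(\<Sum>i<n. b i z) = (\<Sum>i\<in>?F. lam i * (z i)\<^sup>2)" for z
      by (rule sum.mono_neutral_cong_right) (auto simp: b_def)
    then have "(\<integral>z. iexp (t * (\<Sum>i<n. b i z)) \<partial>?P) =
        (\<integral>z. (\<lambda>y. \<Prod>i\<in>?F. iexp (t * (lam i * (y i)\<^sup>2))) (restrict z ?F) \<partial>?P)"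
      by (simp add: sum_distrib_left exp_sum)
    also have "\<dots> = (\<integral>y. (\<Prod>i\<in>?F. iexp (t * (lam i * (y i)\<^sup>2))) \<partial>distr ?P (PiM ?F (\<lambda>_. ?N)) (\<lambda>z. restrict z ?F))"
      by (subst integral_distr) (auto intro!: measurable_restrict_subset)
    also have "\<dots> = (\<integral>y. (\<Prod>i\<in>?F. iexp (t * (lam i * (y i)\<^sup>2))) \<partial>PiM ?F (\<lambda>_. ?N))"
      using P.distr_PiM_restrict_finite[OF F] by simp
    also have "\<dots> = (\<Prod>i\<in>?F. \<integral>x. iexp (t * (lam i * x\<^sup>2)) \<partial>?N)"
    proof (rule P.product_integral_prod[OF F(1)])
      fix i
      show "integrable ?N (\<lambda>x. iexp (t * (lam i * x\<^sup>2)))"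
        by (rule finite_measure.integrable_const_bound[OF prob_space.axioms(1)[OF N], where B = 1]) auto
    qed
    finally show ?thesis .
  qed
  ultimately show "(\<lambda>N. \<Prod>i\<in>I \<inter> {..<N}. \<integral>x. iexp (t * (lam i * x\<^sup>2)) \<partial>?N) \<longlonglongrightarrow> char (chi_star I lam) t"
    by simp
qed

section \<open>Spectral truncation\<close>

lemma iexp_Lipschitz: "cmod (iexp a - iexp b) \<le> \<bar>a - b\<bar>"
proof -
  have "iexp a - iexp b = iexp b * (iexp (a - b) - 1)"
    by (simp add: algebra_simps exp_add[symmetric])
  then have "cmod (iexp a - iexp b) = cmod (iexp (a - b) - 1)"
    by (simp add: norm_mult)
  also have "\<dots> \<le> \<bar>a - b\<bar>"
    using iexp_approx1[of "a - b" 0] by simp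
  finally show ?thesis .
qed

text \<open>Interchange of limits: the approximation error \<open>e N n\<close> is controlled only after letting \<open>n\<close>
  tend to infinity, and its limit \<open>E N\<close> then tends to 0.\<close>
lemma tendsto_by_approximation:
  fixes A :: "nat \<Rightarrow> complex"
  assumes le: "\<And>N. \<forall>\<^sub>F n in sequentially. cmod (A n - A' N n) \<le> e N n"
    and e: "\<And>N. e N \<longlonglongrightarrow> E N" and A': "\<And>N. A' N \<longlonglongrightarrow> c N"
    and E: "E \<longlonglongrightarrow> (0::real)" and c: "c \<longlonglongrightarrow> a"
  shows "A \<longlonglongrightarrow> a"
proof (rule tendstoI)
  fix \<epsilon> :: real assume \<epsilon>: "0 < \<epsilon>"
  have "\<forall>\<^sub>F N in sequentially. E N < \<epsilon> / 4 \<and> dist (c N) a < \<epsilon> / 4"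
    using order_tendstoD(2)[OF E, of "\<epsilon> / 4"] tendstoD[OF c, of "\<epsilon> / 4"] \<epsilon> by (auto simp: eventually_conj_iff)
  then obtain N where N: "E N < \<epsilon> / 4" "dist (c N) a < \<epsilon> / 4"
    by (auto simp: eventually_sequentially)
  have "\<forall>\<^sub>F n in sequentially. dist (A' N n) (c N) < \<epsilon> / 4"
    using \<epsilon> by (intro tendstoD[OF A']) auto
  moreover have "\<forall>\<^sub>F n in sequentially. e N n < \<epsilon> / 4"
    by (rule order_tendstoD(2)[OF e N(1)])
  ultimately show "\<forall>\<^sub>F n in sequentially. dist (A n) a < \<epsilon>"
    using le[of N]
  proof eventually_elim
    case (elim n)
    have "dist (A n) a \<le> dist (A n) (A' N n) + (dist (A' N n) (c N) + dist (c N) a)"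
      by (meson add_left_mono dist_triangle order_trans)
    then show ?case using elim N(2) \<epsilon> by (simp add: dist_norm)
  qed
qed

context prob_space
begin

text \<open>Integrate the eigenvalue equation and interchange the integrals; the symmetric kernel
  integrates to zero in its first argument as well.\<close>
lemma spectral_eigenfunction_centred:
  assumes k: "finite_variance (M \<Otimes>\<^sub>M M) (\<lambda>(x, y). k x y)"
    and sym: "\<And>x y. x \<in> space M \<Longrightarrow> y \<in> space M \<Longrightarrow> k x y = k y x"
    and centred: "\<And>x. x \<in> space M \<Longrightarrow> (\<integral>y. k x y \<partial>M) = 0"
    and sd: "spectral_decomposition M k I lam \<phi>" and i: "i \<in> I" "lam i \<noteq> 0"
  shows "(\<integral>x. \<phi> i x \<partial>M) = 0"
proof -
  interpret MM: pair_prob_space M M ..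
  have \<phi>: "finite_variance M (\<phi> i)"
    and eig: "AE x in M. (\<integral>y. k x y * \<phi> i y \<partial>M) = lam i * \<phi> i x"
    using sd i by (auto simp: spectral_decomposition_def finite_variance_def)
  have [measurable]: "\<phi> i \<in> borel_measurable M" "(\<lambda>(x, y). k x y) \<in> borel_measurable (M \<Otimes>\<^sub>M M)"
    using \<phi> k by (auto simp: finite_variance_def)
  have "finite_variance (M \<Otimes>\<^sub>M M) (\<lambda>(x, y). 1 * \<phi> i y)"
    by (intro MM.finite_variance_product \<phi> finite_variance_bounded[of _ 1]) auto
  from finite_variance_integrable_mult[OF k this]
  have int: "integrable (M \<Otimes>\<^sub>M M) (\<lambda>(x, y). k x y * \<phi> i y)"
    by (simp add: case_prod_beta')
  have "lam i * (\<integral>x. \<phi> i x \<partial>M) = (\<integral>x. lam i * \<phi> i x \<partial>M)" by simp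
  also have "\<dots> = (\<integral>x. (\<integral>y. k x y * \<phi> i y \<partial>M) \<partial>M)"
    by (intro integral_cong_AE) (use eig in auto)
  also have "\<dots> = (\<integral>y. (\<integral>x. k x y * \<phi> i y \<partial>M) \<partial>M)"
    using MM.Fubini_integral[OF int] by simp
  also have "\<dots> = (\<integral>y. (\<integral>x. k y x \<partial>M) * \<phi> i y \<partial>M)"
    by (intro Bochner_Integration.integral_cong refl)
       (simp add: sym cong: Bochner_Integration.integral_cong)
  also have "\<dots> = (\<integral>y. 0 \<partial>M)"
    by (intro Bochner_Integration.integral_cong refl) (simp add: centred)
  finally show ?thesis using i by simp
qed

text \<open>The functions \<open>\<phi> i x * \<phi> i y\<close> are orthonormal in \<open>L\<^sub>2\<close> of the product measure.\<close>
lemma square_norm_rank_one_sum: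
  assumes sd: "spectral_decomposition M k I lam \<phi>" and A: "finite A" "A \<subseteq> I"
  shows "finite_variance (M \<Otimes>\<^sub>M M) (\<lambda>(x, y). \<Sum>i\<in>A. lam i * \<phi> i x * \<phi> i y)"
    and "(\<integral>z. (case z of (x, y) \<Rightarrow> \<Sum>i\<in>A. lam i * \<phi> i x * \<phi> i y)\<^sup>2 \<partial>(M \<Otimes>\<^sub>M M)) = (\<Sum>i\<in>A. (lam i)\<^sup>2)"
proof -
  interpret MM: pair_prob_space M M ..
  have \<phi>: "finite_variance M (\<phi> i)" if "i \<in> I" for i
    using sd that by (auto simp: spectral_decomposition_def finite_variance_def)
  have orth: "(\<integral>x. \<phi> i x * \<phi> j x \<partial>M) = (if i = j then 1 else 0)" if "i \<in> I" "j \<in> I" for i j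
    using sd that by (auto simp: spectral_decomposition_def)
  define r where "r i z = (case z of (x, y) \<Rightarrow> \<phi> i x * \<phi> i y)" for i and z :: "'a \<times> 'a"
  have r: "finite_variance (M \<Otimes>\<^sub>M M) (r i)" if "i \<in> I" for i
    unfolding r_def[abs_def] by (intro MM.finite_variance_product \<phi> that)
  have rr: "(\<integral>z. r i z * r j z \<partial>(M \<Otimes>\<^sub>M M)) = (if i = j then 1 else 0)" if ij: "i \<in> I" "j \<in> I" for i j
  proof -
    have "integrable (M \<Otimes>\<^sub>M M) (\<lambda>z. r i z * r j z)"
      by (intro finite_variance_integrable_mult r ij)
    then have "(\<integral>z. r i z * r j z \<partial>(M \<Otimes>\<^sub>M M)) = (\<integral>x. (\<integral>y. r i (x, y) * r j (x, y) \<partial>M) \<partial>M)"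
      by (rule MM.integral_fst'[symmetric])
    also have "\<dots> = (\<integral>x. (\<integral>y. (\<phi> i x * \<phi> j x) * (\<phi> i y * \<phi> j y) \<partial>M) \<partial>M)"
      by (simp add: r_def mult_ac)
    also have "\<dots> = (if i = j then 1 else 0)"
      by (simp add: orth[OF ij])
    finally show ?thesis .
  qed
  have eq: "(case z of (x, y) \<Rightarrow> \<Sum>i\<in>A. lam i * \<phi> i x * \<phi> i y) = (\<Sum>i\<in>A. lam i * r i z)" for z
    by (simp add: r_def case_prod_beta mult.assoc)
  show "finite_variance (M \<Otimes>\<^sub>M M) (\<lambda>(x, y). \<Sum>i\<in>A. lam i * \<phi> i x * \<phi> i y)"
    unfolding eq using A by (intro finite_variance_sum finite_variance_cmult r) auto
  have "(\<Sum>i\<in>A. lam i * r i z)\<^sup>2 = (\<Sum>i\<in>A. \<Sum>j\<in>A. lam i * lam j * (r i z * r j z))" for z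
    by (simp add: power2_eq_square sum_product mult_ac)
  then have "(\<integral>z. (\<Sum>i\<in>A. lam i * r i z)\<^sup>2 \<partial>(M \<Otimes>\<^sub>M M))
      = (\<integral>z. (\<Sum>i\<in>A. \<Sum>j\<in>A. lam i * lam j * (r i z * r j z)) \<partial>(M \<Otimes>\<^sub>M M))"
    by simp
  also have "\<dots> = (\<Sum>i\<in>A. \<integral>z. (\<Sum>j\<in>A. lam i * lam j * (r i z * r j z)) \<partial>(M \<Otimes>\<^sub>M M))"
    using A by (intro Bochner_Integration.integral_sum Bochner_Integration.integrable_sum integrable_mult_right
        finite_variance_integrable_mult r) auto
  also have "\<dots> = (\<Sum>i\<in>A. \<Sum>j\<in>A. \<integral>z. lam i * lam j * (r i z * r j z) \<partial>(M \<Otimes>\<^sub>M M))"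
    using A by (intro sum.cong refl Bochner_Integration.integral_sum integrable_mult_right
        finite_variance_integrable_mult r) auto
  also have "\<dots> = (\<Sum>i\<in>A. \<Sum>j\<in>A. if i = j then (lam i)\<^sup>2 else 0)"
    using A by (intro sum.cong refl) (auto simp: rr power2_eq_square subset_eq)
  also have "\<dots> = (\<Sum>i\<in>A. (lam i)\<^sup>2)"
    using A by simp
  finally show "(\<integral>z. (case z of (x, y) \<Rightarrow> \<Sum>i\<in>A. lam i * \<phi> i x * \<phi> i y)\<^sup>2 \<partial>(M \<Otimes>\<^sub>M M)) = (\<Sum>i\<in>A. (lam i)\<^sup>2)"
    by (simp only: eq)
qed

text \<open>The spectral expansion is given as an almost everywhere convergent series. Its partial sums
  are Cauchy in \<open>L\<^sub>2\<close>, with the distances given by tails of \<open>\<Sum>i. (lam i)\<^sup>2\<close>, and Fatou's lemma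
  transfers the bound to the pointwise limit.\<close>
lemma spectral_truncation_error:
  assumes k: "finite_variance (M \<Otimes>\<^sub>M M) (\<lambda>(x, y). k x y)"
    and sd: "spectral_decomposition M k I lam \<phi>"
    and tail: "\<And>m. (\<Sum>i\<in>I \<inter> {N..<m}. (lam i)\<^sup>2) \<le> T"
  shows "(\<integral>z. (case z of (x, y) \<Rightarrow> k x y - (\<Sum>i\<in>I \<inter> {..<N}. lam i * \<phi> i x * \<phi> i y))\<^sup>2 \<partial>(M \<Otimes>\<^sub>M M)) \<le> T"
proof -
  interpret MM: pair_prob_space M M ..
  define p where "p m z = (case z of (x, y) \<Rightarrow> \<Sum>i\<in>I \<inter> {..<m}. lam i * \<phi> i x * \<phi> i y)" for m and z :: "'a \<times> 'a"
  define h where "h z = (case z of (x, y) \<Rightarrow> k x y)" for z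
  have T: "0 \<le> T" using tail[of N] by simp
  have p: "finite_variance (M \<Otimes>\<^sub>M M) (p m)" for m
    unfolding p_def[abs_def] by (rule square_norm_rank_one_sum[OF sd]) auto
  have h: "finite_variance (M \<Otimes>\<^sub>M M) h" using k by (simp add: h_def[abs_def])
  have [measurable]: "p m \<in> borel_measurable (M \<Otimes>\<^sub>M M)" "h \<in> borel_measurable (M \<Otimes>\<^sub>M M)" for m
    using p h by (auto simp: finite_variance_def)
  have lim: "AE z in M \<Otimes>\<^sub>M M. (\<lambda>m. p m z) \<longlonglongrightarrow> h z"
  proof -
    have "AE (x, y) in M \<Otimes>\<^sub>M M. ((\<lambda>i. lam i * \<phi> i x * \<phi> i y) has_sum k x y) I"
      using sd by (simp add: spectral_decomposition_def)
    then show ?thesis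
    proof (rule AE_mp, intro AE_I2 impI)
      fix z :: "'a \<times> 'a"
      assume "case z of (x, y) \<Rightarrow> ((\<lambda>i. lam i * \<phi> i x * \<phi> i y) has_sum k x y) I"
      then have "((\<lambda>i. lam i * \<phi> i (fst z) * \<phi> i (snd z)) has_sum h z) I"
        by (simp add: case_prod_beta h_def)
      then have "((\<lambda>i. if i \<in> I then lam i * \<phi> i (fst z) * \<phi> i (snd z) else 0) has_sum h z) UNIV"
        by (rule has_sum_cong_neutral[THEN iffD1, rotated 3]) auto
      then have "(\<lambda>m. \<Sum>i<m. if i \<in> I then lam i * \<phi> i (fst z) * \<phi> i (snd z) else 0) \<longlonglongrightarrow> h z"
        using has_sum_imp_sums sums_def by blast
      moreover have "(\<Sum>i<m. if i \<in> I then lam i * \<phi> i (fst z) * \<phi> i (snd z) else 0) = p m z" for m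
        by (simp add: p_def case_prod_beta sum.If_cases Int_commute)
      ultimately show "(\<lambda>m. p m z) \<longlonglongrightarrow> h z" by simp
    qed
  qed
  have bound: "(\<integral>\<^sup>+z. ennreal ((p m z - p N z)\<^sup>2) \<partial>(M \<Otimes>\<^sub>M M)) \<le> ennreal T" if m: "N \<le> m" for m
  proof -
    have "p m z - p N z = (case z of (x, y) \<Rightarrow> \<Sum>i\<in>I \<inter> {N..<m}. lam i * \<phi> i x * \<phi> i y)" for z
    proof -
      let ?f = "\<lambda>i. lam i * \<phi> i (fst z) * \<phi> i (snd z)"
      have "I \<inter> {..<m} = (I \<inter> {..<N}) \<union> (I \<inter> {N..<m})" using m by auto
      then have "sum ?f (I \<inter> {..<m}) = sum ?f ((I \<inter> {..<N}) \<union> (I \<inter> {N..<m}))"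
        by (rule arg_cong)
      also have "\<dots> = sum ?f (I \<inter> {..<N}) + sum ?f (I \<inter> {N..<m})"
        by (rule sum.union_disjoint) auto
      finally show ?thesis by (simp add: p_def case_prod_beta)
    qed
    then have "(\<integral>z. (p m z - p N z)\<^sup>2 \<partial>(M \<Otimes>\<^sub>M M)) = (\<Sum>i\<in>I \<inter> {N..<m}. (lam i)\<^sup>2)"
      using square_norm_rank_one_sum(2)[OF sd, of "I \<inter> {N..<m}"] by simp
    moreover have "integrable (M \<Otimes>\<^sub>M M) (\<lambda>z. (p m z - p N z)\<^sup>2)"
      using finite_variance_diff[OF p[of m] p[of N]] by (simp add: finite_variance_def)
    ultimately have "(\<integral>\<^sup>+z. ennreal ((p m z - p N z)\<^sup>2) \<partial>(M \<Otimes>\<^sub>M M)) = ennreal (\<Sum>i\<in>I \<inter> {N..<m}. (lam i)\<^sup>2)"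
      by (simp add: nn_integral_eq_integral)
    then show ?thesis using tail[of m] by (simp add: ennreal_leI)
  qed
  have "(\<integral>\<^sup>+z. ennreal ((h z - p N z)\<^sup>2) \<partial>(M \<Otimes>\<^sub>M M))
      = (\<integral>\<^sup>+z. liminf (\<lambda>m. ennreal ((p m z - p N z)\<^sup>2)) \<partial>(M \<Otimes>\<^sub>M M))"
  proof (rule nn_integral_cong_AE)
    show "AE z in M \<Otimes>\<^sub>M M. ennreal ((h z - p N z)\<^sup>2) = liminf (\<lambda>m. ennreal ((p m z - p N z)\<^sup>2))"
      using lim
    proof eventually_elim
      case (elim z)
      then have "(\<lambda>m. ennreal ((p m z - p N z)\<^sup>2)) \<longlonglongrightarrow> ennreal ((h z - p N z)\<^sup>2)"
        by (intro tendsto_intros)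
      then show ?case
        by (metis lim_imp_Liminf trivial_limit_sequentially)
    qed
  qed
  also have "\<dots> \<le> liminf (\<lambda>m. \<integral>\<^sup>+z. ennreal ((p m z - p N z)\<^sup>2) \<partial>(M \<Otimes>\<^sub>M M))"
    by (rule nn_integral_liminf) measurable
  also have "\<dots> \<le> liminf (\<lambda>m. ennreal T)"
    by (rule Liminf_mono) (use bound in \<open>auto simp: eventually_sequentially\<close>)
  also have "\<dots> = ennreal T" by (simp add: Liminf_const)
  finally have le: "(\<integral>\<^sup>+z. ennreal ((h z - p N z)\<^sup>2) \<partial>(M \<Otimes>\<^sub>M M)) \<le> ennreal T" .
  have "integrable (M \<Otimes>\<^sub>M M) (\<lambda>z. (h z - p N z)\<^sup>2)"
    using finite_variance_diff[OF h p[of N]] by (simp add: finite_variance_def)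
  then have "ennreal (\<integral>z. (h z - p N z)\<^sup>2 \<partial>(M \<Otimes>\<^sub>M M)) \<le> ennreal T"
    using le by (simp add: nn_integral_eq_integral)
  then have "(\<integral>z. (h z - p N z)\<^sup>2 \<partial>(M \<Otimes>\<^sub>M M)) \<le> T"
    using T by (simp add: ennreal_le_iff)
  then show ?thesis by (simp add: h_def p_def case_prod_beta)
qed

end

section \<open>Limit law of a degenerate V-statistic\<close>

context iid_sample
begin

text \<open>The finite-rank case. The normalized sums of the \<open>\<phi> j\<close> are treated jointly: a linear
  combination of them is the normalized sum of one function whose variance is \<open>\<Sum>j. (u j)\<^sup>2\<close> by
  orthonormality, so the joint characteristic function tends to that of independent standard
  normals.\<close>
lemma rank_one_sums_char_limit:
  assumes J: "finite J"
    and \<phi>: "\<And>j. j \<in> J \<Longrightarrow> finite_variance D (\<phi> j)"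
    and mean: "\<And>j. j \<in> J \<Longrightarrow> (\<integral>x. \<phi> j x \<partial>D) = 0"
    and orth: "\<And>i j. i \<in> J \<Longrightarrow> j \<in> J \<Longrightarrow> (\<integral>x. \<phi> i x * \<phi> j x \<partial>D) = (if i = j then 1 else 0)"
  shows "(\<lambda>n. \<integral>w. iexp (t * (\<Sum>j\<in>J. lam j * ((\<Sum>a<n. \<phi> j (X a w)) / sqrt n)\<^sup>2)) \<partial>M)
    \<longlonglongrightarrow> (\<Prod>j\<in>J. \<integral>x. iexp (t * (lam j * x\<^sup>2)) \<partial>std_normal_distribution)"
proof -
  define S where "S j n w = (\<Sum>a<n. \<phi> j (X a w)) / sqrt n" for j and n :: nat and w
  have S: "finite_variance M (S j n)" if "j \<in> J" for j n
  proof -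
    have "finite_variance M (\<lambda>w. 1 / sqrt n * (\<Sum>a<n. \<phi> j (X a w)))"
      by (intro finite_variance_cmult finite_variance_sum finite_variance_single \<phi> that)
    then show ?thesis by (simp add: S_def[abs_def])
  qed
  have S2: "(\<integral>w. (S j n w)\<^sup>2 \<partial>M) \<le> 1" if j: "j \<in> J" for j n
  proof (cases "n = 0")
    case False
    have "(S j n w)\<^sup>2 = real n * ((\<Sum>a<n. \<phi> j (X a w)) / n)\<^sup>2" for w
      using False by (simp add: S_def power_divide power2_eq_square)
    then have "(\<integral>w. (S j n w)\<^sup>2 \<partial>M) = real n * (\<integral>w. ((\<Sum>a<n. \<phi> j (X a w)) / n)\<^sup>2 \<partial>M)"
      by simp
    also have "\<dots> \<le> real n * ((\<integral>x. (\<phi> j x)\<^sup>2 \<partial>D) / n)"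
      by (intro mult_left_mono L2_mean_bound \<phi> mean j) auto
    also have "\<dots> = 1" using orth[OF j j] False by (simp add: power2_eq_square)
    finally show ?thesis .
  qed (simp add: S_def)
  have "(\<lambda>n. \<integral>w. (\<Prod>j\<in>J. iexp (t * (lam j * (S j n w)\<^sup>2))) \<partial>M)
      \<longlonglongrightarrow> (\<Prod>j\<in>J. \<integral>x. iexp (t * (lam j * x\<^sup>2)) \<partial>std_normal_distribution)"
  proof (rule product_weak_convergence[where S = S and f = "\<lambda>j x. iexp (t * (lam j * x\<^sup>2))" and C = 1])
    show "real_distribution std_normal_distribution" by (rule real_dist_normal_dist)
    show "integrable std_normal_distribution (\<lambda>x. x\<^sup>2)" by (rule integrable_std_normal_distribution_moment)
    show "S j n \<in> borel_measurable M" "integrable M (\<lambda>w. (S j n w)\<^sup>2)" if "j \<in> J" for j n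
      using S[OF that] by (auto simp: finite_variance_def)
    show "continuous_on UNIV (\<lambda>x. iexp (t * (lam j * x\<^sup>2)))" for j by (intro continuous_intros)
    fix u
    define g where "g x = (\<Sum>j\<in>J. u j * \<phi> j x)" for x
    have g: "finite_variance D g"
      unfolding g_def by (intro finite_variance_sum finite_variance_cmult \<phi>)
    have g0: "(\<integral>x. g x \<partial>D) = 0"
      unfolding g_def using D.finite_variance_integrable[OF \<phi>]
      by (subst Bochner_Integration.integral_sum) (auto simp: mean)
    have g2: "(\<integral>x. (g x)\<^sup>2 \<partial>D) = (\<Sum>j\<in>J. (u j)\<^sup>2)"
    proof -
      have "(g x)\<^sup>2 = (\<Sum>i\<in>J. \<Sum>j\<in>J. u i * u j * (\<phi> i x * \<phi> j x))" for x
        by (simp add: g_def power2_eq_square sum_product mult_ac)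
      then have "(\<integral>x. (g x)\<^sup>2 \<partial>D) = (\<integral>x. (\<Sum>i\<in>J. \<Sum>j\<in>J. u i * u j * (\<phi> i x * \<phi> j x)) \<partial>D)" by simp
      also have "\<dots> = (\<Sum>i\<in>J. \<integral>x. (\<Sum>j\<in>J. u i * u j * (\<phi> i x * \<phi> j x)) \<partial>D)"
        by (intro Bochner_Integration.integral_sum Bochner_Integration.integrable_sum integrable_mult_right
            finite_variance_integrable_mult \<phi>)
      also have "\<dots> = (\<Sum>i\<in>J. \<Sum>j\<in>J. \<integral>x. u i * u j * (\<phi> i x * \<phi> j x) \<partial>D)"
        by (intro sum.cong refl Bochner_Integration.integral_sum integrable_mult_right
            finite_variance_integrable_mult \<phi>)
      also have "\<dots> = (\<Sum>i\<in>J. \<Sum>j\<in>J. if i = j then (u i)\<^sup>2 else 0)"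
        by (intro sum.cong refl) (auto simp: orth power2_eq_square)
      finally show ?thesis using J by simp
    qed
    have "(\<Sum>j\<in>J. u j * S j n w) = (\<Sum>a<n. g (X a w)) / sqrt n" for n w
    proof -
      have "(\<Sum>j\<in>J. u j * S j n w) = (\<Sum>j\<in>J. \<Sum>a<n. u j * \<phi> j (X a w)) / sqrt n"
        by (simp add: S_def sum_distrib_left sum_divide_distrib)
      also have "(\<Sum>j\<in>J. \<Sum>a<n. u j * \<phi> j (X a w)) = (\<Sum>a<n. g (X a w))"
        unfolding g_def by (rule sum.swap)
      finally show ?thesis .
    qed
    moreover have "(\<Prod>j\<in>J. char std_normal_distribution (u j)) = complex_of_real (exp (- (\<integral>x. (g x)\<^sup>2 \<partial>D) / 2))"
    proof -
      have "- (\<integral>x. (g x)\<^sup>2 \<partial>D) / 2 = (\<Sum>j\<in>J. - (u j)\<^sup>2 / 2)"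
        by (simp add: g2 sum_negf sum_divide_distrib)
      then have "exp (- (\<integral>x. (g x)\<^sup>2 \<partial>D) / 2) = (\<Prod>j\<in>J. exp (- (u j)\<^sup>2 / 2))"
        by (simp only: exp_sum[OF J])
      then show ?thesis by (simp only: char_std_normal_distribution of_real_prod)
    qed
    ultimately show "(\<lambda>n. \<integral>w. iexp (\<Sum>j\<in>J. u j * S j n w) \<partial>M) \<longlonglongrightarrow> (\<Prod>j\<in>J. char std_normal_distribution (u j))"
      using char_normalized_sum[OF g g0] by simp
  qed (use J S2 in auto)
  then show ?thesis
    using J by (simp add: S_def sum_distrib_left exp_sum)
qed

text \<open>Subtract from the kernel the terms of its spectral decomposition with index below \<open>N\<close>; the
  terms with eigenvalue 0 contribute nothing, and dropping them leaves only centered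
  eigenfunctions. The diagonal of the difference averages to the rest \<open>m N\<close> of the trace series,
  and this is where the finite trace enters: the almost everywhere expansion carries no
  information about the diagonal. The off-diagonal part, divided by \<open>n\<close>, has second moment at
  most \<open>2 * T N\<close>, where \<open>T N\<close> is the tail of \<open>\<Sum>i. (lam i)\<^sup>2\<close>. Both bounds tend to 0 with growing
  \<open>N\<close>.\<close>
theorem degenerate_V_statistic_char_limit:
  assumes k: "finite_variance (D \<Otimes>\<^sub>M D) (\<lambda>(x, y). k x y)"
    and sym: "\<And>x y. x \<in> space D \<Longrightarrow> y \<in> space D \<Longrightarrow> k x y = k y x"
    and centred: "\<And>x. x \<in> space D \<Longrightarrow> (\<integral>y. k x y \<partial>D) = 0"
    and k_int: "\<And>x. x \<in> space D \<Longrightarrow> integrable D (k x)"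
    and sd: "spectral_decomposition D k I lam \<phi>" and tr: "finite_trace D k I lam"
  shows "(\<lambda>n. \<integral>w. iexp (t * ((\<Sum>a<n. \<Sum>b<n. k (X a w) (X b w)) / n)) \<partial>M) \<longlonglongrightarrow> char (chi_star I lam) t"
proof -
  define J where "J N = {i \<in> I. i < N \<and> lam i \<noteq> 0}" for N
  have J: "finite (J N)" "J N \<subseteq> I" "J N \<subseteq> I \<inter> {..<N}" for N by (auto simp: J_def)
  have \<phi>: "finite_variance D (\<phi> i)" if "i \<in> I" for i
    using sd that by (auto simp: spectral_decomposition_def finite_variance_def)
  have [measurable]: "(\<lambda>(x, y). k x y) \<in> borel_measurable (D \<Otimes>\<^sub>M D)"
    using k by (simp add: finite_variance_def)
  have orth: "(\<integral>x. \<phi> i x * \<phi> j x \<partial>D) = (if i = j then 1 else 0)" if "i \<in> I" "j \<in> I" for i j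
    using sd that by (auto simp: spectral_decomposition_def)
  have mean: "(\<integral>x. \<phi> i x \<partial>D) = 0" if "i \<in> J N" for i N
    using D.spectral_eigenfunction_centred[OF k sym centred sd, of i] that by (auto simp: J_def)
  have J_sum: "(\<Sum>i\<in>J N. lam i * f i) = (\<Sum>i\<in>I \<inter> {..<N}. lam i * f i)" for N f
    by (rule sum.mono_neutral_left) (auto simp: J_def)
  define l where "l i = (if i \<in> I then lam i else 0)" for i
  have "(lam has_sum (\<integral>x. k x x \<partial>D)) I"
    using tr by (simp add: finite_trace_def)
  then have "(l has_sum (\<integral>x. k x x \<partial>D)) UNIV"
    by (rule has_sum_cong_neutral[THEN iffD1, rotated 3]) (auto simp: l_def)
  then have l_sums: "l sums (\<integral>x. k x x \<partial>D)" and "l summable_on UNIV"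
    by (auto intro: has_sum_imp_sums simp: summable_on_def)
  then have "(\<lambda>i. \<bar>l i\<bar>) summable_on UNIV"
    using summable_on_iff_abs_summable_on_real by force
  then have l_abs: "summable (\<lambda>i. \<bar>l i\<bar>)" by (rule summable_on_imp_summable)
  have l2: "summable (\<lambda>i. (l i)\<^sup>2)"
  proof -
    have "(\<lambda>i. \<bar>l i\<bar>) \<longlonglongrightarrow> 0" using l_abs by (rule summable_LIMSEQ_zero)
    then have "\<forall>\<^sub>F i in sequentially. \<bar>l i\<bar> < 1" by (rule order_tendstoD) simp
    then have "\<forall>\<^sub>F i in sequentially. norm ((l i)\<^sup>2) \<le> \<bar>l i\<bar>"
    proof eventually_elim
      case (elim i)
      then have "\<bar>l i\<bar> * \<bar>l i\<bar> \<le> \<bar>l i\<bar> * 1" by (intro mult_left_mono) auto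
      then show ?case by (simp add: power2_eq_square abs_mult)
    qed
    then show ?thesis by (rule summable_comparison_test_ev) (rule l_abs)
  qed
  define m where "m N = (\<integral>x. k x x \<partial>D) - (\<Sum>i<N. l i)" for N
  define T where "T N = (\<Sum>i. (l i)\<^sup>2) - (\<Sum>i<N. (l i)\<^sup>2)" for N
  have m_lim: "m \<longlonglongrightarrow> 0"
    using tendsto_diff[OF tendsto_const l_sums[unfolded sums_def], of "\<integral>x. k x x \<partial>D"]
        by (simp add: m_def[abs_def])
  have T_lim: "T \<longlonglongrightarrow> 0"
    using tendsto_diff[OF tendsto_const summable_LIMSEQ[OF l2], of "\<Sum>i. (l i)\<^sup>2"] by (simp add: T_def[abs_def])
  have l_I: "(\<Sum>i<N. l i) = (\<Sum>i\<in>I \<inter> {..<N}. lam i)" for N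
    by (rule sum.mono_neutral_cong_right) (auto simp: l_def)
  have tail: "(\<Sum>i\<in>I \<inter> {N..<p}. (lam i)\<^sup>2) \<le> T N" for N p
  proof (cases "N \<le> p")
    case True
    have "(\<Sum>i\<in>I \<inter> {N..<p}. (lam i)\<^sup>2) = (\<Sum>i\<in>{N..<p}. (l i)\<^sup>2)"
      by (rule sum.mono_neutral_cong_left) (auto simp: l_def)
    also have "\<dots> = (\<Sum>i<p. (l i)\<^sup>2) - (\<Sum>i<N. (l i)\<^sup>2)"
      using True sum_diff_nat_ivl[of 0 N p "\<lambda>i. (l i)\<^sup>2"] by (simp add: lessThan_atLeast0)
    also have "\<dots> \<le> T N"
      using sum_le_suminf[OF l2, of "{..<p}"] by (simp add: T_def)
    finally show ?thesis .
  next
    case False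
    then show ?thesis using sum_le_suminf[OF l2, of "{..<N}"] by (simp add: T_def)
  qed
  define r where "r N z = (case z of (x, y) \<Rightarrow> k x y - (\<Sum>i\<in>J N. lam i * \<phi> i x * \<phi> i y))" for N and z :: "'a \<times> 'a"
  have r: "finite_variance (D \<Otimes>\<^sub>M D) (r N)" for N
    using finite_variance_diff[OF k D.square_norm_rank_one_sum(1)[OF sd J(1,2)[of N]]]
    by (simp add: r_def[abs_def] case_prod_beta)
  have r2: "(\<integral>z. (r N z)\<^sup>2 \<partial>(D \<Otimes>\<^sub>M D)) \<le> T N" for N
    using D.spectral_truncation_error[OF k sd tail, of N]
    by (simp add: r_def mult.assoc J_sum)
  have r_sym: "r N (x, y) = r N (y, x)" if "x \<in> space D" "y \<in> space D" for N x y
    using sym[OF that] by (simp add: r_def mult.assoc mult.commute[of "\<phi> _ x"])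
  have r_deg: "(\<integral>y. r N (x, y) \<partial>D) = 0" if x: "x \<in> space D" for N x
  proof -
    have "integrable D (\<phi> i)" if "i \<in> J N" for i
      using D.finite_variance_integrable[OF \<phi>] that J(2) by auto
    then have "(\<integral>y. r N (x, y) \<partial>D) = (\<integral>y. k x y \<partial>D) - (\<Sum>i\<in>J N. lam i * \<phi> i x * (\<integral>y. \<phi> i y \<partial>D))"
      using k_int[OF x] by (simp add: r_def Bochner_Integration.integral_sum Bochner_Integration.integrable_sum)
    then show ?thesis using mean by (simp add: centred[OF x])
  qed
  define d where "d N x = r N (x, x)" for N x
  have d: "integrable D (d N)" "(\<integral>x. d N x \<partial>D) = m N" for N
  proof -
    have kd: "integrable D (\<lambda>x. k x x)" using tr by (simp add: finite_trace_def)
    have pp: "integrable D (\<lambda>x. \<phi> i x * \<phi> i x)" if "i \<in> J N" for i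
      using that J(2) by (intro finite_variance_integrable_mult \<phi>) auto
    have eq: "d N = (\<lambda>x. k x x - (\<Sum>i\<in>J N. lam i * (\<phi> i x * \<phi> i x)))"
      by (simp add: d_def r_def mult.assoc fun_eq_iff)
    show "integrable D (d N)"
      unfolding eq using kd pp by (intro Bochner_Integration.integrable_diff
          Bochner_Integration.integrable_sum integrable_mult_right)
    have "(\<integral>x. d N x \<partial>D) = (\<integral>x. k x x \<partial>D) - (\<Sum>i\<in>J N. lam i * (\<integral>x. \<phi> i x * \<phi> i x \<partial>D))"
      unfolding eq using kd pp by (simp add: Bochner_Integration.integral_sum
          Bochner_Integration.integrable_sum)
    also have "(\<Sum>i\<in>J N. lam i * (\<integral>x. \<phi> i x * \<phi> i x \<partial>D)) = (\<Sum>i\<in>J N. lam i * 1)"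
      using J(2)[of N] by (intro sum.cong refl) (auto simp: orth)
    finally show "(\<integral>x. d N x \<partial>D) = m N"
      using J_sum[of "\<lambda>_. 1" N] by (simp add: m_def l_I)
  qed
  \<comment> \<open>\<open>Q N\<close> is the V-statistic of the truncated kernel, \<open>e N\<close> bounds the error of truncation\<close>
  define V where "V n w = (\<Sum>a<n. \<Sum>b<n. k (X a w) (X b w)) / n" for n :: nat and w
  define Q where "Q N n w = (\<Sum>j\<in>J N. lam j * ((\<Sum>a<n. \<phi> j (X a w)) / sqrt n)\<^sup>2)" for N and n :: nat and w
  define e where "e N n = \<bar>t\<bar> * ((\<integral>w. \<bar>(\<Sum>a<n. d N (X a w)) / n - (\<integral>x. d N x \<partial>D)\<bar> \<partial>M) + \<bar>m N\<bar>
      + sqrt (2 * T N))" for N and n :: nat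
  have diff: "V n w - Q N n w = (\<Sum>a<n. d N (X a w)) / n + off_diag (r N) n w / n" for N n w
  proof -
    have square: "(\<Sum>a<n. \<phi> i (X a w))\<^sup>2 = (\<Sum>a<n. \<Sum>b<n. \<phi> i (X a w) * \<phi> i (X b w))" for i
      by (simp only: power2_eq_square sum_product)
    have "(\<Sum>a<n. \<Sum>b<n. r N (X a w, X b w)) =
        (\<Sum>a<n. \<Sum>b<n. k (X a w) (X b w)) - (\<Sum>a<n. \<Sum>b<n. \<Sum>i\<in>J N. lam i * \<phi> i (X a w) * \<phi> i (X b w))"
      by (simp add: r_def sum_subtractf)
    also have "(\<Sum>a<n. \<Sum>b<n. \<Sum>i\<in>J N. lam i * \<phi> i (X a w) * \<phi> i (X b w)) =
        (\<Sum>i\<in>J N. \<Sum>a<n. \<Sum>b<n. lam i * \<phi> i (X a w) * \<phi> i (X b w))"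
      by (simp only: sum.swap[of _ "J N" "{..<n}"])
    also have "\<dots> = (\<Sum>i\<in>J N. lam i * (\<Sum>a<n. \<phi> i (X a w))\<^sup>2)"
      by (simp only: square sum_distrib_left mult.assoc)
    finally have "(\<Sum>a<n. \<Sum>b<n. k (X a w) (X b w)) - (\<Sum>i\<in>J N. lam i * (\<Sum>a<n. \<phi> i (X a w))\<^sup>2)
        = (\<Sum>a<n. d N (X a w)) + off_diag (r N) n w"
      by (simp add: sum_pairs_split d_def)
    then have "((\<Sum>a<n. \<Sum>b<n. k (X a w) (X b w)) - (\<Sum>i\<in>J N. lam i * (\<Sum>a<n. \<phi> i (X a w))\<^sup>2)) / n
        = ((\<Sum>a<n. d N (X a w)) + off_diag (r N) n w) / n" by simp
    moreover have "Q N n w = (\<Sum>i\<in>J N. lam i * (\<Sum>a<n. \<phi> i (X a w))\<^sup>2) / n"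
      by (subst sum_divide_distrib) (simp add: Q_def power_divide)
    ultimately show ?thesis
      by (simp only: V_def diff_divide_distrib add_divide_distrib)
  qed
  have Xk [measurable]: "(\<lambda>w. k (X a w) (X b w)) \<in> borel_measurable M" for a b by measurable
  have Vm [measurable]: "V n \<in> borel_measurable M" for n unfolding V_def[abs_def] by measurable
  have Qm [measurable]: "Q N n \<in> borel_measurable M" for N n
  proof -
    have "(\<lambda>w. \<phi> j (X a w)) \<in> borel_measurable M" if "j \<in> J N" for a j
      using finite_variance_single[OF \<phi>, of j a] that J(2) by (auto simp: finite_variance_def)
    then show ?thesis unfolding Q_def[abs_def] by (intro borel_measurable_sum borel_measurable_times
        borel_measurable_power borel_measurable_divide) auto
  qed
  have e_bound: "cmod ((\<integral>w. iexp (t * V n w) \<partial>M) - (\<integral>w. iexp (t * Q N n w) \<partial>M)) \<le> e N n" if n: "0 < n" for N n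
  proof -
    have dX: "integrable M (\<lambda>w. (\<Sum>a<n. d N (X a w)) / n)"
      using integrable_single(1)[OF d(1)[of N]]
          by (intro Bochner_Integration.integrable_divide Bochner_Integration.integrable_sum)
    have od: "finite_variance M (\<lambda>w. 1 / n * off_diag (r N) n w)"
      by (intro finite_variance_cmult finite_variance_off_diag r)
    then have oi: "integrable M (\<lambda>w. off_diag (r N) n w / n)"
      using finite_variance_integrable[OF od] by simp
    have "integrable M (\<lambda>w. iexp (t * V n w))" "integrable M (\<lambda>w. iexp (t * Q N n w))"
      by (rule integrable_const_bound[of _ 1]; simp)+
    then have "(\<integral>w. iexp (t * V n w) \<partial>M) - (\<integral>w. iexp (t * Q N n w) \<partial>M)
        = (\<integral>w. iexp (t * V n w) - iexp (t * Q N n w) \<partial>M)"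
      and ii: "integrable M (\<lambda>w. iexp (t * V n w) - iexp (t * Q N n w))" by auto
    then have "cmod ((\<integral>w. iexp (t * V n w) \<partial>M) - (\<integral>w. iexp (t * Q N n w) \<partial>M))
        = cmod (\<integral>w. iexp (t * V n w) - iexp (t * Q N n w) \<partial>M)"
      by simp
    also have "\<dots> \<le> (\<integral>w. \<bar>t\<bar> * (\<bar>(\<Sum>a<n. d N (X a w)) / n\<bar> + \<bar>off_diag (r N) n w / n\<bar>) \<partial>M)"
    proof (rule norm_integral_le_integral[OF ii])
      show "integrable M (\<lambda>w. \<bar>t\<bar> * (\<bar>(\<Sum>a<n. d N (X a w)) / n\<bar> + \<bar>off_diag (r N) n w / n\<bar>))"
        by (intro integrable_mult_right Bochner_Integration.integrable_add integrable_abs dX oi)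
      fix w
      have "cmod (iexp (t * V n w) - iexp (t * Q N n w)) \<le> \<bar>t\<bar> * \<bar>V n w - Q N n w\<bar>"
        using iexp_Lipschitz[of "t * V n w" "t * Q N n w"] by (simp add: abs_mult right_diff_distrib[symmetric])
      also have "\<dots> \<le> \<bar>t\<bar> * (\<bar>(\<Sum>a<n. d N (X a w)) / n\<bar> + \<bar>off_diag (r N) n w / n\<bar>)"
        unfolding diff by (intro mult_left_mono abs_triangle_ineq) simp
      finally show "cmod (iexp (t * V n w) - iexp (t * Q N n w))
          \<le> \<bar>t\<bar> * (\<bar>(\<Sum>a<n. d N (X a w)) / n\<bar> + \<bar>off_diag (r N) n w / n\<bar>)" .
    qed
    also have "\<dots> = \<bar>t\<bar> * ((\<integral>w. \<bar>(\<Sum>a<n. d N (X a w)) / n\<bar> \<partial>M) + (\<integral>w. \<bar>off_diag (r N) n w / n\<bar> \<partial>M))"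
      using integrable_abs[OF dX] integrable_abs[OF oi] by (simp del: abs_divide)
    also have "\<dots> \<le> e N n"
      unfolding e_def
    proof (rule mult_left_mono)
      have "(\<integral>w. \<bar>off_diag (r N) n w / n\<bar> \<partial>M) \<le> sqrt (\<integral>w. (off_diag (r N) n w / n)\<^sup>2 \<partial>M)"
        using integral_abs_le_sqrt[OF od] by simp
      also have "\<dots> \<le> sqrt (2 * T N)"
      proof (rule real_sqrt_le_mono)
        have "(\<integral>w. (off_diag (r N) n w / n)\<^sup>2 \<partial>M) = (\<integral>w. (off_diag (r N) n w)\<^sup>2 \<partial>M) / (real n)\<^sup>2"
          by (simp add: power_divide)
        also have "\<dots> \<le> (2 * (real n)\<^sup>2 * (\<integral>z. (r N z)\<^sup>2 \<partial>(D \<Otimes>\<^sub>M D))) / (real n)\<^sup>2"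
          by (intro divide_right_mono off_diag_degenerate_second_moment r r_sym r_deg) auto
        also have "\<dots> \<le> 2 * T N" using n r2[of N] by simp
        finally show "(\<integral>w. (off_diag (r N) n w / n)\<^sup>2 \<partial>M) \<le> 2 * T N" .
      qed
      moreover have "(\<integral>w. \<bar>(\<Sum>a<n. d N (X a w)) / n\<bar> \<partial>M) \<le>
          (\<integral>w. \<bar>(\<Sum>a<n. d N (X a w)) / n - (\<integral>x. d N x \<partial>D)\<bar> + \<bar>m N\<bar> \<partial>M)"
        by (intro integral_mono Bochner_Integration.integrable_add integrable_abs dX
            Bochner_Integration.integrable_diff integrable_const) (use d(2)[of N] in linarith)
      moreover have "\<dots> = (\<integral>w. \<bar>(\<Sum>a<n. d N (X a w)) / n - (\<integral>x. d N x \<partial>D)\<bar> \<partial>M) + \<bar>m N\<bar>"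
        using dX by (simp add: prob_space)
      ultimately show "(\<integral>w. \<bar>(\<Sum>a<n. d N (X a w)) / n\<bar> \<partial>M) + (\<integral>w. \<bar>off_diag (r N) n w / n\<bar> \<partial>M)
          \<le> (\<integral>w. \<bar>(\<Sum>a<n. d N (X a w)) / n - (\<integral>x. d N x \<partial>D)\<bar> \<partial>M) + \<bar>m N\<bar> + sqrt (2 * T N)"
        by linarith
    qed simp
    finally show ?thesis .
  qed
  have chi: "(\<lambda>N. \<Prod>j\<in>J N. \<integral>x. iexp (t * (lam j * x\<^sup>2)) \<partial>std_normal_distribution) \<longlonglongrightarrow> char (chi_star I lam) t"
  proof -
    interpret N: real_distribution std_normal_distribution by (rule real_dist_normal_dist)
    have "(\<Prod>j\<in>J N. \<integral>x. iexp (t * (lam j * x\<^sup>2)) \<partial>std_normal_distribution) =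
        (\<Prod>j\<in>I \<inter> {..<N}. \<integral>x. iexp (t * (lam j * x\<^sup>2)) \<partial>std_normal_distribution)" for N
      using N.prob_space by (intro prod.mono_neutral_left) (auto simp: J_def)
    moreover have "lam summable_on I" using tr by (auto simp: finite_trace_def summable_on_def)
    ultimately show ?thesis using char_chi_star_limit[of lam I t] by simp
  qed
  have "(\<lambda>n. \<integral>w. iexp (t * V n w) \<partial>M) \<longlonglongrightarrow> char (chi_star I lam) t"
  proof (rule tendsto_by_approximation[OF _ _ _ _ chi])
    show "\<forall>\<^sub>F n in sequentially. cmod ((\<integral>w. iexp (t * V n w) \<partial>M) - (\<integral>w. iexp (t * Q N n w) \<partial>M)) \<le> e N n" for N
      using eventually_gt_at_top[of 0] by eventually_elim (rule e_bound)
    show "e N \<longlonglongrightarrow> \<bar>t\<bar> * (0 + \<bar>m N\<bar> + sqrt (2 * T N))" for N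
      unfolding e_def[abs_def] by (intro tendsto_intros L1_law_of_large_numbers d)
    have "(\<lambda>N. \<bar>t\<bar> * (0 + \<bar>m N\<bar> + sqrt (2 * T N))) \<longlonglongrightarrow> \<bar>t\<bar> * (0 + \<bar>0\<bar> + sqrt (2 * 0))"
      by (intro tendsto_intros m_lim T_lim)
    then show "(\<lambda>N. \<bar>t\<bar> * (0 + \<bar>m N\<bar> + sqrt (2 * T N))) \<longlonglongrightarrow> 0" by simp
    show "(\<lambda>n. \<integral>w. iexp (t * Q N n w) \<partial>M) \<longlonglongrightarrow> (\<Prod>j\<in>J N. \<integral>x. iexp (t * (lam j * x\<^sup>2))
        \<partial>std_normal_distribution)" for N
    proof -
      have sub: "j \<in> I" if "j \<in> J N" for j using that J(2) by auto
      show ?thesis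
        unfolding Q_def
        by (rule rank_one_sums_char_limit) (simp_all add: J(1) sub \<phi> orth mean[of _ N])
    qed
  qed
  then show ?thesis by (simp add: V_def)
qed

end

section \<open>Perturbation by an asymptotically negligible term\<close>

context prob_space
begin

lemma bounded_exceeds_diverging:
  assumes Y: "bounded_in_probability M Y" and c: "filterlim c at_top sequentially"
  shows "(\<lambda>n. measure M {w \<in> space M. \<bar>Y n w\<bar> > c n}) \<longlonglongrightarrow> 0"
proof (rule order_tendstoI)
  note [measurable] = bounded_measurable[OF Y]
  fix \<eta> :: real assume "0 < \<eta>"
  then obtain B where B: "\<forall>\<^sub>F n in sequentially. measure M {w \<in> space M. \<bar>Y n w\<bar> > B} < \<eta>"
    using Y unfolding bounded_in_probability_def by blast
  have "\<forall>\<^sub>F n in sequentially. B \<le> c n"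
    using c by (simp add: filterlim_at_top)
  with B show "\<forall>\<^sub>F n in sequentially. measure M {w \<in> space M. \<bar>Y n w\<bar> > c n} < \<eta>"
  proof eventually_elim
    case (elim n)
    have "measure M {w \<in> space M. \<bar>Y n w\<bar> > c n} \<le> measure M {w \<in> space M. \<bar>Y n w\<bar> > B}"
      by (rule finite_measure_mono) (use elim in auto)
    then show ?case using elim by simp
  qed
qed (simp add: less_le_trans[OF _ measure_nonneg])

lemma vanishes_abs:
  assumes "vanishes_in_probability M Y"
  shows "vanishes_in_probability M (\<lambda>n w. \<bar>Y n w\<bar>)"
  using assms vanishes_measurable[OF assms]
  by (auto simp: vanishes_in_probability_def converges_in_probability_def)

text \<open>Slutsky's lemma on the level of characteristic functions.\<close>
lemma char_limit_asymptotically_equal: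
  fixes Y V :: "nat \<Rightarrow> 'a \<Rightarrow> real"
  assumes Y: "\<And>n. Y n \<in> borel_measurable M" and V: "\<And>n. V n \<in> borel_measurable M"
    and YV: "converges_in_probability M (\<lambda>n w. Y n w - V n w) (\<lambda>_. 0)"
    and lim: "(\<lambda>n. \<integral>w. iexp (t * V n w) \<partial>M) \<longlonglongrightarrow> c"
  shows "(\<lambda>n. \<integral>w. iexp (t * Y n w) \<partial>M) \<longlonglongrightarrow> c"
proof -
  note [measurable] = Y V
  have "(\<lambda>n. (\<integral>w. iexp (t * Y n w) \<partial>M) - (\<integral>w. iexp (t * V n w) \<partial>M)) \<longlonglongrightarrow> 0"
  proof (rule tendstoI)
    fix \<epsilon> :: real assume \<epsilon>: "0 < \<epsilon>"
    define \<delta> where "\<delta> = \<epsilon> / (2 * (\<bar>t\<bar> + 1))"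
    have \<delta>: "0 < \<delta>" using \<epsilon> by (simp add: \<delta>_def)
    have t\<delta>: "\<bar>t\<bar> * \<delta> \<le> \<epsilon> / 2" using \<epsilon> by (simp add: \<delta>_def field_simps)
    have "(\<lambda>n. measure M {w \<in> space M. \<bar>Y n w - V n w\<bar> > \<delta>}) \<longlonglongrightarrow> 0"
      using YV \<delta> by (simp add: converges_in_probability_def)
    then have "\<forall>\<^sub>F n in sequentially. measure M {w \<in> space M. \<bar>Y n w - V n w\<bar> > \<delta>} < \<epsilon> / 4"
      using \<epsilon> by (intro order_tendstoD) auto
    then show "\<forall>\<^sub>F n in sequentially. dist ((\<integral>w. iexp (t * Y n w) \<partial>M) - (\<integral>w. iexp (t * V n w) \<partial>M)) 0 < \<epsilon>"
    proof eventually_elim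
      case (elim n)
      let ?A = "{w \<in> space M. \<bar>Y n w - V n w\<bar> > \<delta>}"
      have i: "integrable M (\<lambda>w. iexp (t * Y n w))" "integrable M (\<lambda>w. iexp (t * V n w))"
        by (rule integrable_const_bound[of _ 1]; simp)+
      then have "(\<integral>w. iexp (t * Y n w) \<partial>M) - (\<integral>w. iexp (t * V n w) \<partial>M)
          = (\<integral>w. iexp (t * Y n w) - iexp (t * V n w) \<partial>M)"
        by simp
      also have "cmod \<dots> \<le> (\<integral>w. \<epsilon> / 2 + 2 * indicator ?A w \<partial>M)"
      proof (rule norm_integral_le_integral)
        show "integrable M (\<lambda>w. \<epsilon> / 2 + 2 * indicator ?A w :: real)"
          by (intro Bochner_Integration.integrable_add integrable_const integrable_mult_right
              integrable_real_indicator) (auto simp: emeasure_eq_measure)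
        fix w assume w: "w \<in> space M"
        show "cmod (iexp (t * Y n w) - iexp (t * V n w)) \<le> \<epsilon> / 2 + 2 * indicator ?A w"
        proof (cases "w \<in> ?A")
          case True
          have "cmod (iexp (t * Y n w) - iexp (t * V n w)) \<le> 2"
            using norm_triangle_ineq4[of "iexp (t * Y n w)" "iexp (t * V n w)"] by simp
          then show ?thesis using True \<epsilon> by simp
        next
          case False
          have "cmod (iexp (t * Y n w) - iexp (t * V n w)) \<le> \<bar>t\<bar> * \<bar>Y n w - V n w\<bar>"
            using iexp_Lipschitz[of "t * Y n w" "t * V n w"]
                by (simp add: abs_mult right_diff_distrib[symmetric])
          also have "\<dots> \<le> \<bar>t\<bar> * \<delta>" using False w by (intro mult_left_mono) auto
          finally show ?thesis using t\<delta> by (simp add: indicator_def)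
        qed
      qed (use i in auto)
      also have "\<dots> = \<epsilon> / 2 + 2 * measure M ?A"
        by (subst Bochner_Integration.integral_add)
           (auto simp: prob_space emeasure_eq_measure intro!: integrable_mult_right integrable_real_indicator)
      finally show ?case using elim by simp
    qed
  qed
  from tendsto_add[OF this lim] show ?thesis by simp
qed

end

section \<open>V-statistics with an estimated parameter\<close>

text \<open>Gradients depend only on the germ of a function. This is applied to the symmetry of the
  kernel, which is known for parameters in the model only.\<close>
lemma grad_cong_open:
  assumes "open U" "t \<in> U" "\<And>s. s \<in> U \<Longrightarrow> f s = g s"
  shows "grad f t = grad g t"
proof -
  have "(f has_derivative D) (at t) \<longleftrightarrow> (g has_derivative D) (at t)" for D
    using has_derivative_transform_within_open[of f D t UNIV U g]
      has_derivative_transform_within_open[of g D t UNIV U f] assms by metis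
  then show ?thesis by (simp add: grad_def frechet_derivative_def)
qed

lemma inverse_sqrt_tendsto_0: "(\<lambda>n. 1 / sqrt (real n)) \<longlonglongrightarrow> 0"
  by (intro tendsto_divide_0[OF tendsto_const] filterlim_at_top_imp_at_infinity
      filterlim_compose[OF sqrt_at_top] filterlim_real_sequentially)

text \<open>The deterministic part of the expansion. With \<open>R = sqrt n * norm h\<close>, the powers of \<open>n\<close> are
  distributed so that each term is a product of powers of \<open>R\<close> with a V-statistic in its natural
  normalization: \<open>n\<^sup>-\<^sup>3\<^sup>/\<^sup>2\<close> for the degenerate gradient, \<open>n\<^sup>-\<^sup>2\<close> for the Hessian and for the
  remainder.\<close>
lemma V_statistic_expansion_bound:
  fixes h :: "real^'p" and d c :: "nat \<Rightarrow> nat \<Rightarrow> real"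
  assumes n: "0 < n"
    and e: "\<And>a b. \<bar>d a b - (\<Sum>i\<in>UNIV. h $ i * g i a b) - (\<Sum>i\<in>UNIV. \<Sum>j\<in>UNIV. h $ i * h $ j * q i j a b) / 2\<bar>
      \<le> norm h ^ 3 * c a b"
    and R: "R = sqrt (real n) * norm h"
  shows "\<bar>(\<Sum>a<n. \<Sum>b<n. d a b) / real n\<bar> \<le>
      (\<Sum>i\<in>UNIV. R * \<bar>(\<Sum>a<n. \<Sum>b<n. g i a b) / (real n * sqrt (real n))\<bar>)
      + (\<Sum>i\<in>UNIV. \<Sum>j\<in>UNIV. R * R * \<bar>(\<Sum>a<n. \<Sum>b<n. q i j a b) / (real n)\<^sup>2\<bar>)
      + R * R * R * ((\<Sum>a<n. \<Sum>b<n. c a b) / (real n)\<^sup>2) * (1 / sqrt (real n))"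
proof -
  let ?s = "\<lambda>f. \<Sum>a<n. \<Sum>b<n. (f a b :: real)"
  define r where "r a b = d a b - (\<Sum>i\<in>UNIV. h $ i * g i a b)
      - (\<Sum>i\<in>UNIV. \<Sum>j\<in>UNIV. h $ i * h $ j * q i j a b) / 2" for a b
  have sn: "sqrt (real n) * sqrt (real n) = real n" by simp
  have "?s d = ?s (\<lambda>a b. \<Sum>i\<in>UNIV. h $ i * g i a b)
      + ?s (\<lambda>a b. (\<Sum>i\<in>UNIV. \<Sum>j\<in>UNIV. h $ i * h $ j * q i j a b) / 2) + ?s r"
    by (simp add: r_def sum.distrib[symmetric] sum_subtractf[symmetric])
  also have "?s (\<lambda>a b. \<Sum>i\<in>UNIV. h $ i * g i a b) = (\<Sum>i\<in>UNIV. h $ i * ?s (g i))"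
    by (simp only: sum.swap[of _ UNIV "{..<n}"] sum_distrib_left)
  also have "?s (\<lambda>a b. (\<Sum>i\<in>UNIV. \<Sum>j\<in>UNIV. h $ i * h $ j * q i j a b) / 2) =
      (\<Sum>i\<in>UNIV. \<Sum>j\<in>UNIV. h $ i * h $ j * ?s (q i j)) / 2"
    by (simp only: sum_divide_distrib[symmetric] sum.swap[of _ UNIV "{..<n}"] sum_distrib_left)
  finally have split: "?s d / real n = (\<Sum>i\<in>UNIV. h $ i * ?s (g i)) / real n
      + (\<Sum>i\<in>UNIV. \<Sum>j\<in>UNIV. h $ i * h $ j * ?s (q i j)) / 2 / real n + ?s r / real n"
    by (simp add: add_divide_distrib)
  have scale: "norm h * \<bar>x\<bar> / real n = R * \<bar>x / (real n * sqrt (real n))\<bar>"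
    and scale2: "norm h * norm h * \<bar>x\<bar> / real n = R * R * \<bar>x / (real n)\<^sup>2\<bar>" for x
    using n sn by (simp_all add: R abs_mult power2_eq_square field_simps)
  have first: "\<bar>(\<Sum>i\<in>UNIV. h $ i * ?s (g i)) / real n\<bar> \<le> (\<Sum>i\<in>UNIV. R * \<bar>?s (g i) / (real n * sqrt (real n))\<bar>)"
  proof -
    have "\<bar>\<Sum>i\<in>UNIV. h $ i * ?s (g i)\<bar> \<le> (\<Sum>i\<in>UNIV. norm h * \<bar>?s (g i)\<bar>)"
      by (intro order_trans[OF sum_abs] sum_mono) (simp add: abs_mult mult_right_mono component_le_norm_cart)
    then have "\<bar>(\<Sum>i\<in>UNIV. h $ i * ?s (g i)) / real n\<bar> \<le> (\<Sum>i\<in>UNIV. norm h * \<bar>?s (g i)\<bar>) / real n"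
      by (simp add: divide_right_mono)
    also have "\<dots> = (\<Sum>i\<in>UNIV. norm h * \<bar>?s (g i)\<bar> / real n)"
      by (rule sum_divide_distrib)
    also have "\<dots> = (\<Sum>i\<in>UNIV. R * \<bar>?s (g i) / (real n * sqrt (real n))\<bar>)"
      by (simp only: scale)
    finally show ?thesis .
  qed
  have second: "\<bar>(\<Sum>i\<in>UNIV. \<Sum>j\<in>UNIV. h $ i * h $ j * ?s (q i j)) / 2 / real n\<bar>
      \<le> (\<Sum>i\<in>UNIV. \<Sum>j\<in>UNIV. R * R * \<bar>?s (q i j) / (real n)\<^sup>2\<bar>)"
  proof -
    have half: "\<bar>x / 2 / real n\<bar> \<le> \<bar>x\<bar> / real n" for x :: real using n by (simp add: field_simps)
    have "\<bar>\<Sum>i\<in>UNIV. \<Sum>j\<in>UNIV. h $ i * h $ j * ?s (q i j)\<bar> \<le> (\<Sum>i\<in>UNIV. \<Sum>j\<in>UNIV. norm h * norm h * \<bar>?s (q i j)\<bar>)"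
    proof (intro order_trans[OF sum_abs] sum_mono)
      fix i j
      have "\<bar>h $ i\<bar> * \<bar>h $ j\<bar> \<le> norm h * norm h"
        by (intro mult_mono component_le_norm_cart) auto
      then show "\<bar>h $ i * h $ j * ?s (q i j)\<bar> \<le> norm h * norm h * \<bar>?s (q i j)\<bar>"
        unfolding abs_mult by (rule mult_right_mono) simp
    qed
    then have "\<bar>\<Sum>i\<in>UNIV. \<Sum>j\<in>UNIV. h $ i * h $ j * ?s (q i j)\<bar> / real n
        \<le> (\<Sum>i\<in>UNIV. \<Sum>j\<in>UNIV. norm h * norm h * \<bar>?s (q i j)\<bar>) / real n"
      by (rule divide_right_mono) simp
    also have "\<dots> = (\<Sum>i\<in>UNIV. \<Sum>j\<in>UNIV. norm h * norm h * \<bar>?s (q i j)\<bar> / real n)"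
      by (simp only: sum_divide_distrib)
    also have "\<dots> = (\<Sum>i\<in>UNIV. \<Sum>j\<in>UNIV. R * R * \<bar>?s (q i j) / (real n)\<^sup>2\<bar>)"
      by (simp only: scale2)
    finally show ?thesis using half order_trans by blast
  qed
  have third: "\<bar>?s r / real n\<bar> \<le> R * R * R * (?s c / (real n)\<^sup>2) * (1 / sqrt (real n))"
  proof -
    have "\<bar>?s r\<bar> \<le> ?s (\<lambda>a b. norm h ^ 3 * c a b)"
      unfolding r_def by (intro order_trans[OF sum_abs] sum_mono e)
    then have "\<bar>?s r / real n\<bar> \<le> norm h ^ 3 * ?s c / real n"
      by (simp add: divide_right_mono sum_distrib_left)
    also have "\<dots> = R * R * R * (?s c / (real n)\<^sup>2) * (1 / sqrt (real n))"
      unfolding R using n sn by (simp add: power2_eq_square power3_eq_cube mult_ac)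
    finally show ?thesis .
  qed
  show ?thesis unfolding split using first second third by linarith
qed

context iid_sample
begin

lemma off_diag_L1:
  assumes f: "integrable (D \<Otimes>\<^sub>M D) f"
  shows "integrable M (off_diag f n)" "(\<integral>w. \<bar>off_diag f n w\<bar> \<partial>M) \<le> (real n)\<^sup>2 * (\<integral>z. \<bar>f z\<bar> \<partial>(D \<Otimes>\<^sub>M D))"
proof -
  let ?t = "\<lambda>a b w. if a = b then 0 else f (X a w, X b w)"
  have i: "integrable M (?t a b)" for a b using integrable_pair(1)[OF f] by (cases "a = b") auto
  have le: "(\<integral>w. \<bar>?t a b w\<bar> \<partial>M) \<le> (\<integral>z. \<bar>f z\<bar> \<partial>(D \<Otimes>\<^sub>M D))" for a b
    using integrable_pair(2)[OF integrable_abs[OF f], of a b] by (cases "a = b") auto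
  show "integrable M (off_diag f n)"
    unfolding off_diag_def[abs_def] by (intro Bochner_Integration.integrable_sum i)
  then have "(\<integral>w. \<bar>off_diag f n w\<bar> \<partial>M) \<le> (\<integral>w. (\<Sum>a<n. \<Sum>b<n. \<bar>?t a b w\<bar>) \<partial>M)"
    unfolding off_diag_def
    by (intro integral_mono integrable_abs Bochner_Integration.integrable_sum i)
       (auto intro!: order_trans[OF sum_abs] sum_mono)
  also have "\<dots> = (\<Sum>a<n. \<Sum>b<n. \<integral>w. \<bar>?t a b w\<bar> \<partial>M)"
    using integrable_abs[OF i] by (simp add: Bochner_Integration.integral_sum
        Bochner_Integration.integrable_sum)
  also have "\<dots> \<le> (\<Sum>a<n. \<Sum>b<n. \<integral>z. \<bar>f z\<bar> \<partial>(D \<Otimes>\<^sub>M D))"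
    by (intro sum_mono le)
  finally show "(\<integral>w. \<bar>off_diag f n w\<bar> \<partial>M) \<le> (real n)\<^sup>2 * (\<integral>z. \<bar>f z\<bar> \<partial>(D \<Otimes>\<^sub>M D))"
    by (simp add: power2_eq_square mult.assoc)
qed

lemma diag_L1:
  assumes f: "integrable D f"
  shows "integrable M (\<lambda>w. \<Sum>a<n. f (X a w))" "(\<integral>w. \<bar>\<Sum>a<n. f (X a w)\<bar> \<partial>M) \<le> real n * (\<integral>x. \<bar>f x\<bar> \<partial>D)"
proof -
  show "integrable M (\<lambda>w. \<Sum>a<n. f (X a w))"
    by (intro Bochner_Integration.integrable_sum integrable_single f)
  show "(\<integral>w. \<bar>\<Sum>a<n. f (X a w)\<bar> \<partial>M) \<le> real n * (\<integral>x. \<bar>f x\<bar> \<partial>D)"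
    using L1_mean_bound[OF f, of n] by (cases "n = 0") (auto simp: field_simps)
qed

lemma V_statistic_L1:
  assumes diag: "integrable D (\<lambda>x. r (x, x))" and off: "integrable M (off_diag r n)"
  shows "integrable M (\<lambda>w. \<Sum>a<n. \<Sum>b<n. r (X a w, X b w))"
    and "(\<integral>w. \<bar>\<Sum>a<n. \<Sum>b<n. r (X a w, X b w)\<bar> \<partial>M) \<le>
      real n * (\<integral>x. \<bar>r (x, x)\<bar> \<partial>D) + (\<integral>w. \<bar>off_diag r n w\<bar> \<partial>M)"
proof -
  note d = diag_L1[OF diag, of n]
  show "integrable M (\<lambda>w. \<Sum>a<n. \<Sum>b<n. r (X a w, X b w))"
    unfolding sum_pairs_split by (intro Bochner_Integration.integrable_add d off)
  have "(\<integral>w. \<bar>\<Sum>a<n. \<Sum>b<n. r (X a w, X b w)\<bar> \<partial>M) \<le> (\<integral>w. \<bar>\<Sum>a<n. r (X a w, X a w)\<bar> + \<bar>off_diag r n w\<bar> \<partial>M)"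
    unfolding sum_pairs_split
    by (intro integral_mono integrable_abs Bochner_Integration.integrable_add d off abs_triangle_ineq)
  also have "\<dots> = (\<integral>w. \<bar>\<Sum>a<n. r (X a w, X a w)\<bar> \<partial>M) + (\<integral>w. \<bar>off_diag r n w\<bar> \<partial>M)"
    by (intro Bochner_Integration.integral_add integrable_abs d off)
  finally show "(\<integral>w. \<bar>\<Sum>a<n. \<Sum>b<n. r (X a w, X b w)\<bar> \<partial>M) \<le>
      real n * (\<integral>x. \<bar>r (x, x)\<bar> \<partial>D) + (\<integral>w. \<bar>off_diag r n w\<bar> \<partial>M)"
    using d(2) by linarith
qed

text \<open>The diagonal contributes \<open>n\<close> terms of bounded expectation and the off-diagonal part is
  controlled by its second moment; the normalization \<open>s n\<close> has to beat both.\<close>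
lemma V_statistic_vanishes:
  assumes r: "finite_variance (D \<Otimes>\<^sub>M D) r" and diag: "integrable D (\<lambda>x. r (x, x))"
    and off: "\<And>n. (\<integral>w. (off_diag r n w)\<^sup>2 \<partial>M) \<le> (c n)\<^sup>2" and c: "\<And>n. 0 \<le> c n"
    and s: "\<And>n. 0 \<le> s n" "(\<lambda>n. real n / s n) \<longlonglongrightarrow> 0" "(\<lambda>n. c n / s n) \<longlonglongrightarrow> 0"
  shows "vanishes_in_probability M (\<lambda>n w. (\<Sum>a<n. \<Sum>b<n. r (X a w, X b w)) / s n)"
proof (rule vanishes_of_L1)
  let ?d = "\<integral>x. \<bar>r (x, x)\<bar> \<partial>D"
  have fo: "finite_variance M (off_diag r n)" for n by (rule finite_variance_off_diag[OF r])
  note L = V_statistic_L1[OF diag finite_variance_integrable[OF fo]]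
  show "integrable M (\<lambda>w. (\<Sum>a<n. \<Sum>b<n. r (X a w, X b w)) / s n)" for n
    by (intro Bochner_Integration.integrable_divide L)
  have bound: "(\<integral>w. \<bar>(\<Sum>a<n. \<Sum>b<n. r (X a w, X b w)) / s n\<bar> \<partial>M) \<le> ?d * (real n / s n) + c n / s n" for n
  proof -
    have "(\<integral>w. \<bar>off_diag r n w\<bar> \<partial>M) \<le> c n"
      using integral_abs_le_sqrt[OF fo[of n]] real_sqrt_le_mono[OF off[of n]] c[of n] by simp
    then have "(\<integral>w. \<bar>\<Sum>a<n. \<Sum>b<n. r (X a w, X b w)\<bar> \<partial>M) / s n \<le> (real n * ?d + c n) / s n"
      using L(2)[of n] s(1)[of n] by (intro divide_right_mono) auto
    then show ?thesis
      using s(1)[of n] by (simp add: add_divide_distrib mult.commute)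
  qed
  have "(\<lambda>n. ?d * (real n / s n) + c n / s n) \<longlonglongrightarrow> ?d * 0 + 0"
    by (intro tendsto_add tendsto_mult tendsto_const s)
  then have lim: "(\<lambda>n. ?d * (real n / s n) + c n / s n) \<longlonglongrightarrow> 0" by simp
  show "(\<lambda>n. \<integral>w. \<bar>(\<Sum>a<n. \<Sum>b<n. r (X a w, X b w)) / s n\<bar> \<partial>M) \<longlonglongrightarrow> 0"
    by (rule tendsto_sandwich[OF _ _ tendsto_const lim]) (use bound in auto)
qed

lemma degenerate_V_statistic_vanishes:
  assumes r: "finite_variance (D \<Otimes>\<^sub>M D) r" and diag: "integrable D (\<lambda>x. r (x, x))"
    and sym: "\<And>x y. x \<in> space D \<Longrightarrow> y \<in> space D \<Longrightarrow> r (x, y) = r (y, x)"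
    and degenerate: "\<And>x. x \<in> space D \<Longrightarrow> (\<integral>y. r (x, y) \<partial>D) = 0"
  shows "vanishes_in_probability M (\<lambda>n w. (\<Sum>a<n. \<Sum>b<n. r (X a w, X b w)) / (real n * sqrt (real n)))"
proof (rule V_statistic_vanishes[OF r diag])
  define V where "V = (\<integral>z. (r z)\<^sup>2 \<partial>(D \<Otimes>\<^sub>M D))"
  have V: "0 \<le> V" by (simp add: V_def)
  show "(\<integral>w. (off_diag r n w)\<^sup>2 \<partial>M) \<le> (real n * sqrt (2 * V))\<^sup>2" for n
    using off_diag_degenerate_second_moment[OF r sym degenerate, of n] V
    by (simp add: V_def power_mult_distrib mult_ac)
  have "real n / (real n * sqrt (real n)) = 1 / sqrt (real n)" for n by (cases "n = 0") auto
  then show "(\<lambda>n. real n / (real n * sqrt (real n))) \<longlonglongrightarrow> 0"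
    using inverse_sqrt_tendsto_0 by simp
  have "real n * sqrt (2 * V) / (real n * sqrt (real n)) = sqrt (2 * V) * (1 / sqrt (real n))" for n
    by (cases "n = 0") auto
  then show "(\<lambda>n. real n * sqrt (2 * V) / (real n * sqrt (real n))) \<longlonglongrightarrow> 0"
    using tendsto_mult_right_zero[OF inverse_sqrt_tendsto_0, of "sqrt (2 * V)"] by simp
  show "0 \<le> real n * sqrt (2 * V)" for n using V by simp
qed simp

lemma centred_V_statistic_vanishes:
  assumes r: "finite_variance (D \<Otimes>\<^sub>M D) r" and diag: "integrable D (\<lambda>x. r (x, x))"
    and mean: "(\<integral>z. r z \<partial>(D \<Otimes>\<^sub>M D)) = 0"
  shows "vanishes_in_probability M (\<lambda>n w. (\<Sum>a<n. \<Sum>b<n. r (X a w, X b w)) / (real n)\<^sup>2)"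
proof (rule V_statistic_vanishes[OF r diag])
  define V where "V = (\<integral>z. (r z)\<^sup>2 \<partial>(D \<Otimes>\<^sub>M D))"
  have V: "0 \<le> V" by (simp add: V_def)
  show "(\<integral>w. (off_diag r n w)\<^sup>2 \<partial>M) \<le> (real n * sqrt (real n) * (2 * sqrt V))\<^sup>2" for n
  proof -
    have "(real n * sqrt (real n) * (2 * sqrt V))\<^sup>2 = 4 * real n ^ 3 * V"
      using V by (simp add: power_mult_distrib power3_eq_cube power2_eq_square[of "real n"])
    then show ?thesis
      using off_diag_centred_second_moment[OF r mean, of n] by (simp add: V_def)
  qed
  have "real n / (real n)\<^sup>2 = 1 / real n" for n by (simp add: power2_eq_square)
  then show "(\<lambda>n. real n / (real n)\<^sup>2) \<longlonglongrightarrow> 0"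
    using lim_1_over_n by simp
  have "real n * sqrt (real n) * (2 * sqrt V) / (real n)\<^sup>2 = 2 * sqrt V * (1 / sqrt (real n))" for n
  proof (cases "n = 0")
    case False
    have "sqrt (real n) * sqrt (real n) = real n" by simp
    with False show ?thesis by (simp add: power2_eq_square field_simps)
  qed simp
  then show "(\<lambda>n. real n * sqrt (real n) * (2 * sqrt V) / (real n)\<^sup>2) \<longlonglongrightarrow> 0"
    using tendsto_mult_right_zero[OF inverse_sqrt_tendsto_0, of "2 * sqrt V"] by simp
  show "0 \<le> real n * sqrt (real n) * (2 * sqrt V)" for n using V by simp
qed simp

lemma integrable_V_statistic_bounded:
  assumes r: "integrable (D \<Otimes>\<^sub>M D) r" and s: "integrable D s"
  shows "bounded_in_probability M (\<lambda>n w. ((\<Sum>a<n. s (X a w)) + off_diag r n w) / (real n)\<^sup>2)"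
proof (rule bounded_of_L1)
  let ?d = "\<integral>x. \<bar>s x\<bar> \<partial>D" and ?o = "\<integral>z. \<bar>r z\<bar> \<partial>(D \<Otimes>\<^sub>M D)"
  note d = diag_L1[OF s] and o = off_diag_L1[OF r]
  show "integrable M (\<lambda>w. ((\<Sum>a<n. s (X a w)) + off_diag r n w) / (real n)\<^sup>2)" for n
    by (intro Bochner_Integration.integrable_divide Bochner_Integration.integrable_add d o)
  fix n :: nat
  show "(\<integral>w. \<bar>((\<Sum>a<n. s (X a w)) + off_diag r n w) / (real n)\<^sup>2\<bar> \<partial>M) \<le> ?d + ?o"
  proof (cases "n = 0")
    case False
    have "(\<integral>w. \<bar>(\<Sum>a<n. s (X a w)) + off_diag r n w\<bar> \<partial>M) \<le> (\<integral>w. \<bar>\<Sum>a<n. s (X a w)\<bar> + \<bar>off_diag r n w\<bar> \<partial>M)"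
      by (intro integral_mono integrable_abs Bochner_Integration.integrable_add d o abs_triangle_ineq)
    also have "\<dots> = (\<integral>w. \<bar>\<Sum>a<n. s (X a w)\<bar> \<partial>M) + (\<integral>w. \<bar>off_diag r n w\<bar> \<partial>M)"
      by (intro Bochner_Integration.integral_add integrable_abs d o)
    also have "\<dots> \<le> real n * ?d + (real n)\<^sup>2 * ?o" using d(2) o(2) by (intro add_mono)
    also have "\<dots> \<le> (real n)\<^sup>2 * ?d + (real n)\<^sup>2 * ?o"
      using False by (intro add_right_mono mult_right_mono) (auto simp: power2_eq_square)
    finally show ?thesis using False by (simp add: field_simps)
  qed simp
qed

text \<open>In the Taylor expansion the scaled estimation error \<open>R\<close> is bounded in probability; it
  multiplies a negligible V-statistic in the first two terms and \<open>1 / sqrt n\<close> in the third. The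
  expansion is valid as long as the estimator lies in a closed ball inside \<open>U\<close>, which fails with
  vanishing probability. Pairs with equal indices need their own dominating functions for the
  third derivatives, as the diagonal may be a null set of the product law.\<close>
theorem V_statistic_plug_in:
  fixes \<kappa> :: "real^'p \<Rightarrow> 'a \<Rightarrow> 'a \<Rightarrow> real" and \<theta>hat :: "nat \<Rightarrow> 'w \<Rightarrow> real^'p"
  assumes U: "open U" "\<theta> \<in> U"
    and smooth: "\<And>x y. x \<in> space D \<Longrightarrow> y \<in> space D \<Longrightarrow> three_times_differentiable_on (\<lambda>t. \<kappa> t x y) U"
    and sym: "\<And>t x y. t \<in> U \<Longrightarrow> x \<in> space D \<Longrightarrow> y \<in> space D \<Longrightarrow> \<kappa> t x y = \<kappa> t y x"
    and grad_centred: "\<And>x i. x \<in> space D \<Longrightarrow> (\<integral>y. grad (\<lambda>t. \<kappa> t x y) \<theta> $ i \<partial>D) = 0"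
    and hess_centred: "\<And>i j. (\<integral>(x, y). grad2 (\<lambda>t. \<kappa> t x y) \<theta> $ i $ j \<partial>(D \<Otimes>\<^sub>M D)) = 0"
    and moments:
      "\<And>i. finite_variance (D \<Otimes>\<^sub>M D) (\<lambda>(x, y). grad (\<lambda>t. \<kappa> t x y) \<theta> $ i)"
      "\<And>i j. finite_variance (D \<Otimes>\<^sub>M D) (\<lambda>(x, y). grad2 (\<lambda>t. \<kappa> t x y) \<theta> $ i $ j)"
      "\<And>i. integrable D (\<lambda>x. grad (\<lambda>t. \<kappa> t x x) \<theta> $ i)"
      "\<And>i j. integrable D (\<lambda>x. grad2 (\<lambda>t. \<kappa> t x x) \<theta> $ i $ j)"
    and remainder:
      "\<And>i j k. \<exists>H. integrable (D \<Otimes>\<^sub>M D) H \<and>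
         (AE (x, y) in D \<Otimes>\<^sub>M D. \<forall>t\<in>U. \<bar>grad3 (\<lambda>s. \<kappa> s x y) t $ i $ j $ k\<bar> \<le> H (x, y))"
      "\<And>i j k. \<exists>H. integrable D H \<and>
         (AE x in D. \<forall>t\<in>U. \<bar>grad3 (\<lambda>s. \<kappa> s x x) t $ i $ j $ k\<bar> \<le> H x)"
    and rate: "bounded_in_probability M (\<lambda>n w. norm (sqrt (real n) *\<^sub>R (\<theta>hat n w - \<theta>)))"
    and Y: "\<forall>\<^sub>F n in sequentially. AE w in M. Y n w =
      ((\<Sum>a<n. \<Sum>b<n. \<kappa> (\<theta>hat n w) (X a w) (X b w)) - (\<Sum>a<n. \<Sum>b<n. \<kappa> \<theta> (X a w) (X b w))) / real n"
  shows "converges_in_probability M Y (\<lambda>_. 0)"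
proof -
  define H where "H i j k = (SOME H. integrable (D \<Otimes>\<^sub>M D) H \<and>
     (AE (x, y) in D \<Otimes>\<^sub>M D. \<forall>t\<in>U. \<bar>grad3 (\<lambda>s. \<kappa> s x y) t $ i $ j $ k\<bar> \<le> H (x, y)))" for i j k
  have H: "integrable (D \<Otimes>\<^sub>M D) (H i j k)"
    "AE (x, y) in D \<Otimes>\<^sub>M D. \<forall>t\<in>U. \<bar>grad3 (\<lambda>s. \<kappa> s x y) t $ i $ j $ k\<bar> \<le> H i j k (x, y)" for i j k
    using someI_ex[OF remainder(1)[of i j k], folded H_def] by blast+
  define H' where "H' i j k = (SOME H. integrable D H \<and>
     (AE x in D. \<forall>t\<in>U. \<bar>grad3 (\<lambda>s. \<kappa> s x x) t $ i $ j $ k\<bar> \<le> H x))" for i j k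
  have H': "integrable D (H' i j k)"
    "AE x in D. \<forall>t\<in>U. \<bar>grad3 (\<lambda>s. \<kappa> s x x) t $ i $ j $ k\<bar> \<le> H' i j k x" for i j k
    using someI_ex[OF remainder(2)[of i j k], folded H'_def] by blast+
  \<comment> \<open>one dominating function for all entries, off and on the diagonal\<close>
  define h where "h z = (\<Sum>i\<in>UNIV. \<Sum>j\<in>UNIV. \<Sum>k\<in>UNIV. H i j k z)" for z
  define h' where "h' x = (\<Sum>i\<in>UNIV. \<Sum>j\<in>UNIV. \<Sum>k\<in>UNIV. H' i j k x)" for x
  have h: "integrable (D \<Otimes>\<^sub>M D) h" "integrable D h'"
    unfolding h_def h'_def by (intro Bochner_Integration.integrable_sum H H')+
  obtain \<delta> where \<delta>: "0 < \<delta>" "cball \<theta> \<delta> \<subseteq> U" using U open_contains_cball by blast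
  define g where "g i z = (case z of (x, y) \<Rightarrow> grad (\<lambda>t. \<kappa> t x y) \<theta> $ i)" for i and z :: "'a \<times> 'a"
  define g2 where "g2 i j z = (case z of (x, y) \<Rightarrow> grad2 (\<lambda>t. \<kappa> t x y) \<theta> $ i $ j)" for i j and z :: "'a \<times> 'a"
  define R where "R n w = norm (sqrt (real n) *\<^sub>R (\<theta>hat n w - \<theta>))" for n w
  define V where "V i n w = (\<Sum>a<n. \<Sum>b<n. g i (X a w, X b w)) / (real n * sqrt (real n))" for i
      and n :: nat and w
  define W where "W i j n w = (\<Sum>a<n. \<Sum>b<n. g2 i j (X a w, X b w)) / (real n)\<^sup>2" for i j and n :: nat and w
  define B where "B n w = ((\<Sum>a<n. h' (X a w)) + off_diag h n w) / (real n)\<^sup>2" for n :: nat and w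
  define Z where "Z n w = (\<Sum>i\<in>UNIV. R n w * \<bar>V i n w\<bar>) + (\<Sum>i\<in>UNIV. \<Sum>j\<in>UNIV. R n w * R n w * \<bar>W i j n w\<bar>)
      + R n w * R n w * R n w * B n w * (1 / sqrt (real n))" for n w
  have R: "bounded_in_probability M R" using rate by (simp add: R_def[abs_def])
  have V: "vanishes_in_probability M (V i)" for i
    unfolding V_def[abs_def]
  proof (rule degenerate_V_statistic_vanishes)
    show "finite_variance (D \<Otimes>\<^sub>M D) (g i)" using moments(1) by (simp add: g_def[abs_def])
    show "integrable D (\<lambda>x. g i (x, x))" using moments(3) by (simp add: g_def)
    show "g i (x, y) = g i (y, x)" if "x \<in> space D" "y \<in> space D" for x y
      using grad_cong_open[OF U sym[OF _ that]] by (simp add: g_def)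
    show "(\<integral>y. g i (x, y) \<partial>D) = 0" if "x \<in> space D" for x
      using grad_centred[OF that] by (simp add: g_def)
  qed
  have W: "vanishes_in_probability M (W i j)" for i j
    unfolding W_def[abs_def]
  proof (rule centred_V_statistic_vanishes)
    show "finite_variance (D \<Otimes>\<^sub>M D) (g2 i j)" using moments(2) by (simp add: g2_def[abs_def])
    show "integrable D (\<lambda>x. g2 i j (x, x))" using moments(4) by (simp add: g2_def)
    show "(\<integral>z. g2 i j z \<partial>(D \<Otimes>\<^sub>M D)) = 0" using hess_centred by (simp add: g2_def)
  qed
  have B: "bounded_in_probability M B"
    unfolding B_def[abs_def] by (rule integrable_V_statistic_bounded[OF h])
  have "(\<lambda>n. 1 / sqrt (real n)) \<longlonglongrightarrow> 0"
    by (intro tendsto_divide_0[OF tendsto_const] filterlim_at_top_imp_at_infinity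
          filterlim_compose[OF sqrt_at_top] filterlim_real_sequentially)
  then have Z: "vanishes_in_probability M Z"
    unfolding Z_def[abs_def]
    by (intro vanishes_add vanishes_sum bounded_mult_vanishes bounded_mult R B vanishes_abs V W vanishes_const)
  note [measurable] = bounded_measurable[OF R]
  show ?thesis
  proof (rule converges_in_probability_dominated[OF Z, where B
      = "\<lambda>n. {w \<in> space M. \<bar>R n w\<bar> > sqrt (real n) * \<delta>}"])
    show "{w \<in> space M. \<bar>R n w\<bar> > sqrt (real n) * \<delta>} \<in> events" for n by measurable
    show "(\<lambda>n. prob {w \<in> space M. \<bar>R n w\<bar> > sqrt (real n) * \<delta>}) \<longlonglongrightarrow> 0"
      using \<delta> by (intro bounded_exceeds_diverging R filterlim_at_top_mult_tendsto_pos[OF tendsto_const]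
          filterlim_compose[OF sqrt_at_top] filterlim_real_sequentially)
    have Hoff: "AE w in M. \<forall>i j k. \<forall>a b. a \<noteq> b \<longrightarrow>
        (\<forall>t\<in>U. \<bar>grad3 (\<lambda>s. \<kappa> s (X a w) (X b w)) t $ i $ j $ k\<bar> \<le> H i j k (X a w, X b w))"
      unfolding AE_all_countable
      using AE_pair[OF H(2)] by (auto simp: eventually_all_finite)
    have Hdiag: "AE w in M. \<forall>i j k. \<forall>a.
        (\<forall>t\<in>U. \<bar>grad3 (\<lambda>s. \<kappa> s (X a w) (X a w)) t $ i $ j $ k\<bar> \<le> H' i j k (X a w))"
      unfolding AE_all_countable
      using AE_single[OF H'(2)] by (auto simp: eventually_all_finite)
    show "\<forall>\<^sub>F n in sequentially. AE w in M. w \<notin> {w \<in> space M. \<bar>R n w\<bar> > sqrt (real n) * \<delta>} \<longrightarrow> \<bar>Y n w\<bar> \<le> \<bar>Z n w\<bar>"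
      using Y eventually_gt_at_top[of 0]
    proof eventually_elim
      case (elim n)
      show ?case
        using elim(1) Hoff Hdiag AE_space
      proof eventually_elim
        case (elim w)
        note Yw = elim(1)
        have X: "X a w \<in> space D" for a using measurable_space[OF X_measurable elim(4)] .
        let ?u = "\<theta>hat n w - \<theta>"
        have n: "0 < n" by fact
        have Ru: "R n w = sqrt (real n) * norm ?u" by (simp add: R_def)
        show ?case
        proof (intro impI)
          assume "w \<notin> {w \<in> space M. \<bar>R n w\<bar> > sqrt (real n) * \<delta>}"
          then have "sqrt (real n) * norm ?u \<le> sqrt (real n) * \<delta>" using elim(4) by (simp add: Ru)
          then have u: "norm ?u \<le> \<delta>" using n by simp
          have seg: "\<theta> + s *\<^sub>R ?u \<in> U" if "0 \<le> s" "s \<le> 1" for s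
          proof -
            have "s * norm ?u \<le> 1 * \<delta>" using that u by (intro mult_mono) auto
            then have "\<theta> + s *\<^sub>R ?u \<in> cball \<theta> \<delta>" using that by (simp add: dist_norm)
            then show ?thesis using \<delta>(2) by blast
          qed
          define C where "C a b i j k = (if a = b then H' i j k (X a w) else H i j k (X a w, X b w))"
              for a b i j k
          have e: "\<bar>\<kappa> (\<theta>hat n w) (X a w) (X b w) - \<kappa> \<theta> (X a w) (X b w)
              - (\<Sum>i\<in>UNIV. ?u $ i * g i (X a w, X b w))
              - (\<Sum>i\<in>UNIV. \<Sum>j\<in>UNIV. ?u $ i * ?u $ j * g2 i j (X a w, X b w)) / 2\<bar>
              \<le> norm ?u ^ 3 * (\<Sum>i\<in>UNIV. \<Sum>j\<in>UNIV. \<Sum>k\<in>UNIV. C a b i j k)" for a b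
          proof -
            have "\<bar>grad3 (\<lambda>s. \<kappa> s (X a w) (X b w)) t $ i $ j $ k\<bar> \<le> C a b i j k" if "t \<in> U" for t i j k
              using elim(2,3) that by (auto simp: C_def)
            from taylor_third_order[OF smooth[OF X X] seg this] show ?thesis
              by (simp add: g_def g2_def)
          qed
          have sumC: "(\<Sum>a<n. \<Sum>b<n. \<Sum>i\<in>UNIV. \<Sum>j\<in>UNIV. \<Sum>k\<in>UNIV. C a b i j k) / (real n)\<^sup>2 = B n w"
          proof -
            have "(\<Sum>i\<in>UNIV. \<Sum>j\<in>UNIV. \<Sum>k\<in>UNIV. C a b i j k)
                = (if a = b then h' (X a w) else h (X a w, X b w))" for a b
              by (simp add: C_def h_def h'_def)
            moreover have "(\<Sum>b<n. if a = b then h' (X a w) else h (X a w, X b w)) =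
                h' (X a w) + (\<Sum>b<n. if a = b then 0 else h (X a w, X b w))" if "a < n" for a
              using that by (subst (1 2) sum.remove[of _ a]) (auto intro!: sum.cong)
            ultimately show ?thesis by (simp add: B_def off_diag_def sum.distrib)
          qed
          from V_statistic_expansion_bound[where g = "\<lambda>i a b. g i (X a w, X b w)"
              and q = "\<lambda>i j a b. g2 i j (X a w, X b w)"
              and d = "\<lambda>a b. \<kappa> (\<theta>hat n w) (X a w) (X b w) - \<kappa> \<theta> (X a w) (X b w)"
              and c = "\<lambda>a b. \<Sum>i\<in>UNIV. \<Sum>j\<in>UNIV. \<Sum>k\<in>UNIV. C a b i j k", OF n e Ru]
          have "\<bar>Y n w\<bar> \<le> Z n w"
            unfolding Yw Z_def V_def W_def sumC by (simp only: sum_subtractf)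
          then show "\<bar>Y n w\<bar> \<le> \<bar>Z n w\<bar>" by linarith
        qed
      qed
    qed
  qed
qed

end

section \<open>Limit of the quadratic distance\<close>

theorem theorem4:
  fixes \<nu> :: "'a measure"
    and \<Omega> U :: "(real^'p) set"
    and \<theta> :: "real^'p"
    and g :: "real^'p \<Rightarrow> 'a \<Rightarrow> real"
    and G :: "real^'p \<Rightarrow> 'a measure"
    and u :: "real^'p \<Rightarrow> 'a \<Rightarrow> real^'p"
    and K :: "real^'p \<Rightarrow> 'a \<Rightarrow> 'a \<Rightarrow> real"
    and M :: "'w measure"
    and X :: "nat \<Rightarrow> 'w \<Rightarrow> 'a"
    and \<theta>hat :: "nat \<Rightarrow> 'w \<Rightarrow> real^'p"
  assumes g_measurable: "\<And>t. t \<in> \<Omega> \<Longrightarrow> g t \<in> borel_measurable \<nu>"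
    and g_nonneg: "\<And>t x. t \<in> \<Omega> \<Longrightarrow> x \<in> space \<nu> \<Longrightarrow> 0 \<le> g t x"
    and G_density: "\<And>t. t \<in> \<Omega> \<Longrightarrow> G t = density \<nu> (\<lambda>x. ennreal (g t x))"
    and G_prob: "\<And>t. t \<in> \<Omega> \<Longrightarrow> prob_space (G t)"
    and score: "\<And>t x. t \<in> \<Omega> \<Longrightarrow> x \<in> space \<nu> \<Longrightarrow> 0 < g t x \<Longrightarrow>
      ((\<lambda>s. ln (g s x)) has_derivative (\<lambda>h. u t x \<bullet> h)) (at t within \<Omega>)"
    and score_measurable: "\<And>t. t \<in> \<Omega> \<Longrightarrow> u t \<in> borel_measurable \<nu>"
    and score_mean: "\<And>t. t \<in> \<Omega> \<Longrightarrow> integrable (G t) (u t) \<and> (\<integral>x. u t x \<partial>G t) = 0"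
    and info_finite: "\<And>t i j. t \<in> \<Omega> \<Longrightarrow>
      integrable (G t) (\<lambda>x. ext_score (u t) x $ i * ext_score (u t) x $ j)"
    and info_invertible: "\<And>t. t \<in> \<Omega> \<Longrightarrow> invertible (ext_info (G t) (u t))"
    and K_measurable: "\<And>t. t \<in> \<Omega> \<Longrightarrow> (\<lambda>(x, y). K t x y) \<in> borel_measurable (\<nu> \<Otimes>\<^sub>M \<nu>)"
    and K_bounded: "\<And>t. t \<in> \<Omega> \<Longrightarrow> \<exists>B. \<forall>x\<in>space \<nu>. \<forall>y\<in>space \<nu>. \<bar>K t x y\<bar> \<le> B"
    and K_sym: "\<And>t x y. t \<in> \<Omega> \<Longrightarrow> x \<in> space \<nu> \<Longrightarrow> y \<in> space \<nu> \<Longrightarrow> K t x y = K t y x"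
    and K_cnd: "\<And>t. t \<in> \<Omega> \<Longrightarrow> cond_nonneg_definite \<nu> (K t)"
    and M_prob: "prob_space M"
    and X_indep: "prob_space.indep_vars M (\<lambda>_. \<nu>) X UNIV"
    and X_distr: "\<And>i. distr M \<nu> (X i) = G \<theta>"
    and mle: "\<forall>\<^sub>F n in sequentially. AE w in M.
      is_mle \<Omega> g n (\<lambda>i. X i w) (\<theta>hat n w) \<and> (\<Sum>i<n. u (\<theta>hat n w) (X i w)) = 0"
    and statistic_measurable: "\<forall>\<^sub>F n in sequentially.
      (\<lambda>w. qdist (K (\<theta>hat n w)) (empirical \<nu> n (\<lambda>i. X i w)) (G (\<theta>hat n w))) \<in> borel_measurable M"
    and nbhd: "open U" "\<theta> \<in> U" "U \<subseteq> \<Omega>"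
    and cond_i: "\<exists>L. converges_in_distribution M (\<lambda>n w. sqrt (real n) *\<^sub>R (\<theta>hat n w - \<theta>)) L"
    and cond_ii_smooth: "\<And>x y. x \<in> space \<nu> \<Longrightarrow> y \<in> space \<nu> \<Longrightarrow>
      three_times_differentiable_on (\<lambda>t. scen G u K t x y) U"
    \<comment> \<open>the parameter gradient of an integrand f times the density g is (grad f + f u) g\<close>
    and cond_ii_once: "\<And>t x. t \<in> U \<Longrightarrow> x \<in> space \<nu> \<Longrightarrow>
      integrable (G t) (\<lambda>y. grad (\<lambda>s. scen G u K s x y) t + scen G u K t x y *\<^sub>R u t y) \<and>
      GDERIV (\<lambda>s. \<integral>y. scen G u K s x y \<partial>G s) t :>
        (\<integral>y. grad (\<lambda>s. scen G u K s x y) t + scen G u K t x y *\<^sub>R u t y \<partial>G t)"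
    and cond_ii_twice: "\<And>x i. x \<in> space \<nu> \<Longrightarrow>
      integrable (G \<theta>) (\<lambda>y. grad2 (\<lambda>s. scen G u K s x y) \<theta> $ i +
                            (grad (\<lambda>s. scen G u K s x y) \<theta> $ i) *\<^sub>R u \<theta> y) \<and>
      GDERIV (\<lambda>t. \<integral>y. grad (\<lambda>s. scen G u K s x y) t $ i \<partial>G t) \<theta> :>
        (\<integral>y. grad2 (\<lambda>s. scen G u K s x y) \<theta> $ i +
              (grad (\<lambda>s. scen G u K s x y) \<theta> $ i) *\<^sub>R u \<theta> y \<partial>G \<theta>)"
    and cond_iii:
      "\<And>i. finite_variance (G \<theta> \<Otimes>\<^sub>M G \<theta>) (\<lambda>(x, y). grad (\<lambda>t. scen G u K t x y) \<theta> $ i)"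
      "\<And>i j. finite_variance (G \<theta> \<Otimes>\<^sub>M G \<theta>) (\<lambda>(x, y). grad2 (\<lambda>t. scen G u K t x y) \<theta> $ i $ j)"
      "\<And>i. finite_variance (G \<theta>) (\<lambda>x. grad (\<lambda>t. scen G u K t x x) \<theta> $ i)"
      "\<And>i j. finite_variance (G \<theta>) (\<lambda>x. grad2 (\<lambda>t. scen G u K t x x) \<theta> $ i $ j)"
    and cond_iv:
      "\<And>i j k. \<exists>H. integrable (G \<theta> \<Otimes>\<^sub>M G \<theta>) H \<and>
         (AE (x, y) in G \<theta> \<Otimes>\<^sub>M G \<theta>. \<forall>t\<in>U. \<bar>grad3 (\<lambda>s. scen G u K s x y) t $ i $ j $ k\<bar> \<le> H (x, y))"
      "\<And>i j k. \<exists>H. integrable (G \<theta>) H \<and>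
         (AE x in G \<theta>. \<forall>t\<in>U. \<bar>grad3 (\<lambda>s. scen G u K s x x) t $ i $ j $ k\<bar> \<le> H x)"
  shows "converges_in_probability M
      (\<lambda>n w. real n *
        (qdist (K (\<theta>hat n w)) (empirical \<nu> n (\<lambda>i. X i w)) (G (\<theta>hat n w))
         - dint (scen G u K \<theta>) (empirical \<nu> n (\<lambda>i. X i w)) (empirical \<nu> n (\<lambda>i. X i w))))
      (\<lambda>_. 0) \<and>
    (\<forall>I lam \<phi>.
      spectral_decomposition (G \<theta>) (scen G u K \<theta>) I lam \<phi> \<and>
      finite_trace (G \<theta>) (scen G u K \<theta>) I lam \<longrightarrow>
      weak_conv_m
        (\<lambda>n. distr M borel (\<lambda>w. real n *
           qdist (K (\<theta>hat n w)) (empirical \<nu> n (\<lambda>i. X i w)) (G (\<theta>hat n w))))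
        (chi_star I lam))"
proof -
  interpret M: prob_space M by (rule M_prob)
  have \<theta>\<Omega>: "\<theta> \<in> \<Omega>" using nbhd by auto
  have sets_G: "sets (G t) = sets \<nu>" and space_G: "space (G t) = space \<nu>" if "t \<in> \<Omega>" for t
    using that by (simp_all add: G_density)
  let ?D = "G \<theta>" and ?\<kappa> = "scen G u K"
  have model: "score_model (G t) (u t) (K t)" if t: "t \<in> \<Omega>" for t
  proof -
    interpret prob_space "G t" by (rule G_prob[OF t])
    note sets_G[OF t, measurable_cong]
    have "(\<lambda>(x, y). K t x y) \<in> borel_measurable (G t \<Otimes>\<^sub>M G t)"
      using K_measurable[OF t] measurable_cong_sets[OF
          sets_pair_measure_cong[OF sets_G[OF t] sets_G[OF t]] refl] by blast
    moreover have "u t \<in> borel_measurable (G t)"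
      using score_measurable[OF t] measurable_cong_sets[OF sets_G[OF t] refl] by blast
    ultimately show ?thesis
      using score_mean[OF t] info_finite[OF t] info_invertible[OF t] K_bounded[OF t] K_sym[OF t]
      by unfold_locales (auto simp: space_G[OF t])
  qed
  have X_meas: "X i \<in> M \<rightarrow>\<^sub>M \<nu>" for i
    using X_indep by (simp add: M.indep_vars_def)
  interpret iid_sample M ?D X
  proof
    show "M.indep_vars (\<lambda>_. ?D) X UNIV"
    proof -
      have "M.indep_vars (\<lambda>_. ?D) (\<lambda>i w. id (X i w)) UNIV"
        by (rule M.indep_vars_compose2[OF X_indep])
            (simp add: measurable_def sets_G[OF \<theta>\<Omega>] space_G[OF \<theta>\<Omega>] sets.Int_space_eq2)
      then show ?thesis by simp
    qed
    show "distr M ?D (X i) = ?D" for i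
    proof -
      have "distr M ?D (X i) = distr M \<nu> (X i)"
        by (rule distr_cong) (simp_all add: sets_G[OF \<theta>\<Omega>])
      then show ?thesis by (simp add: X_distr)
    qed
  qed
  interpret \<theta>: score_model ?D "u \<theta>" "K \<theta>" by (rule model[OF \<theta>\<Omega>])
  have spD: "space ?D = space \<nu>" by (rule space_G[OF \<theta>\<Omega>])
  have X_space: "X a w \<in> space \<nu>" if "w \<in> space M" for a w
    using measurable_space[OF X_meas that] .
  have sym: "?\<kappa> t x y = ?\<kappa> t y x" if "t \<in> \<Omega>" "x \<in> space \<nu>" "y \<in> space \<nu>" for t x y
    using score_model.scen_kernel_sym[OF model[OF that(1)]] that by (simp add: scen_def space_G)
  have centred: "(\<integral>y. ?\<kappa> t x y \<partial>G t) = 0" if "t \<in> \<Omega>" "x \<in> space \<nu>" for t x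
    using score_model.scen_kernel_centred[OF model[OF that(1)]] that by (simp add: scen_def space_G)
  have orth: "integrable (G t) (\<lambda>y. ?\<kappa> t x y * u t y $ i)" "(\<integral>y. ?\<kappa> t x y * u t y $ i \<partial>G t) = 0"
    if t: "t \<in> \<Omega>" and x: "x \<in> space \<nu>" for t x i
  proof -
    interpret t: score_model "G t" "u t" "K t" by (rule model[OF t])
    have xt: "x \<in> space (G t)" using x by (simp add: space_G[OF t])
    show "integrable (G t) (\<lambda>y. ?\<kappa> t x y * u t y $ i)"
      using finite_variance_integrable_mult[OF t.finite_variance_scen_section[OF xt]
          t.finite_variance_e[of "Some i"]]
      by (simp add: scen_def)
    show "(\<integral>y. ?\<kappa> t x y * u t y $ i \<partial>G t) = 0"
      using t.scen_kernel_score_orthogonal[OF xt, of "Some i"] by (simp add: scen_def)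
  qed
  \<comment> \<open>the centering identities hold on all of \<open>U\<close>, so their gradients vanish\<close>
  have gradient_zero: "d = 0"
    if F: "GDERIV F t :> d" and t: "t \<in> U" and z: "\<And>s. s \<in> U \<Longrightarrow> F s = 0" for F t and d :: "real^'p"
  proof -
    have "((\<lambda>s. 0) has_derivative (\<lambda>h. h \<bullet> d)) (at t)"
      using has_derivative_transform_within_open[OF F[unfolded gderiv_def] nbhd(1) t] z by auto
    from has_derivative_unique[OF this has_derivative_const] have "(\<lambda>h. h \<bullet> d) = (\<lambda>h. 0)" .
    from fun_cong[OF this, of d] show ?thesis by simp
  qed
  have vec_int: "(\<integral>y. f y \<partial>N) $ i = (\<integral>y. f y $ i \<partial>N)" "integrable N (\<lambda>y. f y $ i)"
    if "integrable N f" for f :: "'a \<Rightarrow> real^'p" and N i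
    using integral_bounded_linear[OF bounded_linear_vec_nth that, of i]
      integrable_bounded_linear[OF bounded_linear_vec_nth that, of i] by simp_all
  have grad_centred: "integrable (G t) (\<lambda>y. grad (\<lambda>s. ?\<kappa> s x y) t $ i)"
      "(\<integral>y. grad (\<lambda>s. ?\<kappa> s x y) t $ i \<partial>G t) = 0"
    if t: "t \<in> U" and x: "x \<in> space \<nu>" for t x i
  proof -
    have t\<Omega>: "t \<in> \<Omega>" using t nbhd by auto
    let ?f = "\<lambda>y. grad (\<lambda>s. ?\<kappa> s x y) t + ?\<kappa> t x y *\<^sub>R u t y"
    have f: "integrable (G t) ?f" using cond_ii_once[OF t x] by simp
    have f0: "(\<integral>y. ?f y \<partial>G t) = 0"
      by (rule gradient_zero[OF conjunct2[OF cond_ii_once[OF t x]] t]) (use centred x nbhd in auto)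
    have eq: "grad (\<lambda>s. ?\<kappa> s x y) t $ i = ?f y $ i - ?\<kappa> t x y * u t y $ i" for y by simp
    show "integrable (G t) (\<lambda>y. grad (\<lambda>s. ?\<kappa> s x y) t $ i)"
      unfolding eq by (intro Bochner_Integration.integrable_diff vec_int(2)[OF f] orth t\<Omega> x)
    show "(\<integral>y. grad (\<lambda>s. ?\<kappa> s x y) t $ i \<partial>G t) = 0"
      unfolding eq Bochner_Integration.integral_diff[OF vec_int(2)[OF f] orth(1)[OF t\<Omega> x]]
      using vec_int(1)[OF f, of i] f0 orth(2)[OF t\<Omega> x] by simp
  qed
  define g where "g i x y = grad (\<lambda>t. ?\<kappa> t x y) \<theta> $ i" for i x y
  define g2 where "g2 i j x y = grad2 (\<lambda>t. ?\<kappa> t x y) \<theta> $ i $ j" for i j x y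
  have g_sym: "g i x y = g i y x" if "x \<in> space \<nu>" "y \<in> space \<nu>" for i x y
  proof -
    have "grad (\<lambda>t. ?\<kappa> t x y) \<theta> = grad (\<lambda>t. ?\<kappa> t y x) \<theta>"
      by (rule grad_cong_open[OF nbhd(1,2)]) (rule sym[OF subsetD[OF nbhd(3)] that])
    then show ?thesis by (simp add: g_def)
  qed
  have g_fv: "finite_variance (?D \<Otimes>\<^sub>M ?D) (\<lambda>(x, y). g i x y)" for i
    using cond_iii(1) by (simp add: g_def)
  have g2_fv: "finite_variance (?D \<Otimes>\<^sub>M ?D) (\<lambda>(x, y). g2 i j x y)" for i j
    using cond_iii(2) by (simp add: g2_def)
  have hess_centred: "(\<integral>(x, y). g2 i j x y \<partial>(?D \<Otimes>\<^sub>M ?D)) = 0" for i j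
  proof -
    \<comment> \<open>differentiating the centering of the gradient kernel; the score term integrates to zero because
      the gradient kernel is symmetric\<close>
    have row_zero: "(\<integral>y. g2 i j x y + g i x y * u \<theta> y $ j \<partial>?D) = 0" if x: "x \<in> space \<nu>" for x
    proof -
      let ?f = "\<lambda>y. grad2 (\<lambda>s. ?\<kappa> s x y) \<theta> $ i + (grad (\<lambda>s. ?\<kappa> s x y) \<theta> $ i) *\<^sub>R u \<theta> y"
      have f: "integrable ?D ?f" using cond_ii_twice[OF x] by simp
      have f0: "(\<integral>y. ?f y \<partial>?D) = 0"
        by (rule gradient_zero[OF conjunct2[OF cond_ii_twice[OF x]] nbhd(2)])
            (use grad_centred(2)[OF _ x] in auto)
      show ?thesis using vec_int(1)[OF f, of j] f0 by (simp add: g2_def g_def)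
    qed
    have "finite_variance ?D (\<lambda>_. 1)" by (rule D.finite_variance_bounded[of _ 1]) auto
    moreover have "finite_variance ?D (\<lambda>y. u \<theta> y $ j)"
      using \<theta>.finite_variance_e[of "Some j"] by simp
    ultimately have "finite_variance (?D \<Otimes>\<^sub>M ?D) (\<lambda>(x, y). 1 * u \<theta> y $ j)"
      by (rule DD.finite_variance_product(1))
    from finite_variance_integrable_mult[OF g_fv this]
    have gu: "integrable (?D \<Otimes>\<^sub>M ?D) (\<lambda>(x, y). g i x y * u \<theta> y $ j)" by (simp add: case_prod_beta')
    have g2i: "integrable (?D \<Otimes>\<^sub>M ?D) (\<lambda>(x, y). g2 i j x y)"
      by (rule DD.P.finite_variance_integrable[OF g2_fv])
    have "(\<integral>(x, y). g i x y * u \<theta> y $ j \<partial>(?D \<Otimes>\<^sub>M ?D)) = (\<integral>y. (\<integral>x. g i x y * u \<theta> y $ j \<partial>?D) \<partial>?D)"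
      using DD.integral_snd[OF gu] by simp
    also have "\<dots> = (\<integral>y. 0 \<partial>?D)"
    proof (intro Bochner_Integration.integral_cong refl)
      fix y assume y: "y \<in> space ?D"
      have "(\<integral>x. g i x y * u \<theta> y $ j \<partial>?D) = (\<integral>x. g i y x \<partial>?D) * u \<theta> y $ j"
        using y by (subst Bochner_Integration.integral_mult_left_zero[symmetric],
          intro Bochner_Integration.integral_cong refl) (simp add: g_sym spD)
      also have "\<dots> = 0" using grad_centred(2)[OF nbhd(2), of y i] y by (simp add: g_def spD)
      finally show "(\<integral>x. g i x y * u \<theta> y $ j \<partial>?D) = 0" .
    qed
    finally have gu0: "(\<integral>(x, y). g i x y * u \<theta> y $ j \<partial>(?D \<Otimes>\<^sub>M ?D)) = 0" by simp
    have sum_int: "integrable (?D \<Otimes>\<^sub>M ?D) (\<lambda>(x, y). g2 i j x y + g i x y * u \<theta> y $ j)"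
      using Bochner_Integration.integrable_add[OF g2i gu] by (simp add: case_prod_beta')
    have "(\<integral>(x, y). g2 i j x y + g i x y * u \<theta> y $ j \<partial>(?D \<Otimes>\<^sub>M ?D))
        = (\<integral>x. (\<integral>y. g2 i j x y + g i x y * u \<theta> y $ j \<partial>?D) \<partial>?D)"
      using DD.integral_fst'[OF sum_int] by simp
    also have "\<dots> = (\<integral>x. 0 \<partial>?D)"
      by (intro Bochner_Integration.integral_cong refl) (simp add: row_zero spD)
    finally have "(\<integral>(x, y). g2 i j x y + g i x y * u \<theta> y $ j \<partial>(?D \<Otimes>\<^sub>M ?D)) = 0" by simp
    moreover have "(\<integral>(x, y). g2 i j x y + g i x y * u \<theta> y $ j \<partial>(?D \<Otimes>\<^sub>M ?D)) =
        (\<integral>(x, y). g2 i j x y \<partial>(?D \<Otimes>\<^sub>M ?D)) + (\<integral>(x, y). g i x y * u \<theta> y $ j \<partial>(?D \<Otimes>\<^sub>M ?D))"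
      using Bochner_Integration.integral_add[OF g2i gu] by (simp add: case_prod_beta')
    ultimately show ?thesis using gu0 by simp
  qed
  have qdist_eq: "\<forall>\<^sub>F n in sequentially. AE w in M.
      qdist (K (\<theta>hat n w)) (empirical \<nu> n (\<lambda>i. X i w)) (G (\<theta>hat n w)) =
      (\<Sum>a<n. \<Sum>b<n. ?\<kappa> (\<theta>hat n w) (X a w) (X b w)) / (real n)\<^sup>2"
    using mle eventually_gt_at_top[of 0]
  proof eventually_elim
    case (elim n)
    show ?case
      using elim(1) AE_space
    proof eventually_elim
      case (elim w)
      have t: "\<theta>hat n w \<in> \<Omega>" using elim by (simp add: is_mle_def)
      show ?case
        using score_model.qdist_empirical_eq_scen[OF model[OF t] \<open>0 < n\<close>, of \<nu> "\<lambda>i. X i w"] elim t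
        by (simp add: scen_def space_G sets_G X_space)
    qed
  qed
  have dint_eq: "dint (?\<kappa> \<theta>) (empirical \<nu> n (\<lambda>i. X i w)) (empirical \<nu> n (\<lambda>i. X i w)) =
      (\<Sum>a<n. \<Sum>b<n. ?\<kappa> \<theta> (X a w) (X b w)) / (real n)\<^sup>2" if w: "w \<in> space M" for n w
  proof -
    have \<kappa>_meas: "(\<lambda>(x, y). ?\<kappa> \<theta> x y) \<in> borel_measurable (\<nu> \<Otimes>\<^sub>M \<nu>)"
      using \<theta>.scen_kernel_measurable measurable_cong_sets[OF
          sets_pair_measure_cong[OF sets_G[OF \<theta>\<Omega>] sets_G[OF \<theta>\<Omega>]] refl]
      by (simp add: scen_def) blast
    have row: "?\<kappa> \<theta> x \<in> borel_measurable \<nu>" if "x \<in> space \<nu>" for x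
      using measurable_Pair2[OF \<kappa>_meas that] by simp
    have col: "(\<lambda>x. ?\<kappa> \<theta> x y) \<in> borel_measurable \<nu>" if "y \<in> space \<nu>" for y
      using measurable_Pair1[OF \<kappa>_meas that] by simp
    let ?E = "empirical \<nu> n (\<lambda>i. X i w)"
    have "dint (?\<kappa> \<theta>) ?E ?E = (\<integral>x. (\<Sum>b<n. ?\<kappa> \<theta> x (X b w)) / real n \<partial>?E)"
      unfolding dint_def
    proof (intro Bochner_Integration.integral_cong refl)
      fix x assume "x \<in> space ?E"
      then have "x \<in> space \<nu>" by (simp add: empirical_def)
      then show "(\<integral>y. ?\<kappa> \<theta> x y \<partial>?E) = (\<Sum>b<n. ?\<kappa> \<theta> x (X b w)) / real n"
        by (intro integral_empirical X_space[OF w] row)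
    qed
    also have "\<dots> = (\<Sum>a<n. (\<Sum>b<n. ?\<kappa> \<theta> (X a w) (X b w)) / real n) / real n"
      by (intro integral_empirical X_space[OF w] borel_measurable_divide borel_measurable_sum col
          borel_measurable_const)
    finally show ?thesis by (simp add: sum_divide_distrib[symmetric] power2_eq_square)
  qed
  let ?Q = "\<lambda>n w. qdist (K (\<theta>hat n w)) (empirical \<nu> n (\<lambda>i. X i w)) (G (\<theta>hat n w))"
  let ?V = "\<lambda>n w. (\<Sum>a<n. \<Sum>b<n. ?\<kappa> \<theta> (X a w) (X b w)) / real n"
  have part1: "converges_in_probability M
      (\<lambda>n w. real n * (?Q n w - dint (?\<kappa> \<theta>) (empirical \<nu> n (\<lambda>i. X i w)) (empirical \<nu> n (\<lambda>i. X i w)))) (\<lambda>_. 0)"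
  proof (rule V_statistic_plug_in[where \<kappa> = ?\<kappa> and \<theta>hat = \<theta>hat, OF nbhd(1,2)])
    show "three_times_differentiable_on (\<lambda>t. ?\<kappa> t x y) U" if "x \<in> space ?D" "y \<in> space ?D" for x y
      using cond_ii_smooth that by (simp add: spD)
    show "?\<kappa> t x y = ?\<kappa> t y x" if "t \<in> U" "x \<in> space ?D" "y \<in> space ?D" for t x y
      using sym that nbhd(3) by (auto simp: spD)
    show "(\<integral>y. grad (\<lambda>t. ?\<kappa> t x y) \<theta> $ i \<partial>?D) = 0" if "x \<in> space ?D" for x i
      using grad_centred(2)[OF nbhd(2)] that by (simp add: spD)
    show "(\<integral>(x, y). grad2 (\<lambda>t. ?\<kappa> t x y) \<theta> $ i $ j \<partial>(?D \<Otimes>\<^sub>M ?D)) = 0" for i j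
      using hess_centred by (simp add: g2_def)
    show "finite_variance (?D \<Otimes>\<^sub>M ?D) (\<lambda>(x, y). grad (\<lambda>t. ?\<kappa> t x y) \<theta> $ i)"
      "finite_variance (?D \<Otimes>\<^sub>M ?D) (\<lambda>(x, y). grad2 (\<lambda>t. ?\<kappa> t x y) \<theta> $ i $ j)" for i j
      by (rule cond_iii)+
    show "integrable ?D (\<lambda>x. grad (\<lambda>t. ?\<kappa> t x x) \<theta> $ i)"
        "integrable ?D (\<lambda>x. grad2 (\<lambda>t. ?\<kappa> t x x) \<theta> $ i $ j)" for i j
      by (rule D.finite_variance_integrable, rule cond_iii)+
    show "bounded_in_probability M (\<lambda>n w. norm (sqrt (real n) *\<^sub>R (\<theta>hat n w - \<theta>)))"
      using cond_i M.bounded_of_converges_in_distribution by blast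
    show "\<forall>\<^sub>F n in sequentially. AE w in M.
        real n * (?Q n w - dint (?\<kappa> \<theta>) (empirical \<nu> n (\<lambda>i. X i w)) (empirical \<nu> n (\<lambda>i. X i w))) =
        ((\<Sum>a<n. \<Sum>b<n. ?\<kappa> (\<theta>hat n w) (X a w) (X b w)) - (\<Sum>a<n. \<Sum>b<n. ?\<kappa> \<theta> (X a w) (X b w))) / real n"
      using qdist_eq eventually_gt_at_top[of 0]
    proof eventually_elim
      case (elim n)
      show ?case
        using elim(1) AE_space
      proof eventually_elim
        case (elim w)
        then show ?case using \<open>0 < n\<close>
          by (simp add: dint_eq diff_divide_distrib[symmetric] power2_eq_square)
      qed
    qed
  qed (rule cond_iv)+
  have part2: "weak_conv_m (\<lambda>n. distr M borel (\<lambda>w. real n * ?Q n w)) (chi_star I lam)"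
    if sd: "spectral_decomposition ?D (?\<kappa> \<theta>) I lam \<phi>" and tr: "finite_trace ?D (?\<kappa> \<theta>) I lam" for I lam \<phi>
  proof -
    \<comment> \<open>the statistic is known to be measurable for large \<open>n\<close> only, while the continuity theorem
      wants distributions throughout\<close>
    define Y where "Y n = (if ?Q n \<in> borel_measurable M then (\<lambda>w. real n * ?Q n w) else (\<lambda>_. 0))" for n
    have Y_meas [measurable]: "Y n \<in> borel_measurable M" for n by (simp add: Y_def)
    have Y_eq: "\<forall>\<^sub>F n in sequentially. Y n = (\<lambda>w. real n * ?Q n w)"
      using statistic_measurable by eventually_elim (simp add: Y_def)
    have V_meas: "?V n \<in> borel_measurable M" for n
    proof -
      have "(\<lambda>w. ?\<kappa> \<theta> (X a w) (X b w)) \<in> borel_measurable M" for a b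
      proof -
        have "(\<lambda>w. (X a w, X b w)) \<in> M \<rightarrow>\<^sub>M ?D \<Otimes>\<^sub>M ?D" by measurable
        from measurable_compose[OF this \<theta>.scen_kernel_measurable] show ?thesis by (simp add: scen_def)
      qed
      then show ?thesis by (intro borel_measurable_divide borel_measurable_sum) auto
    qed
    have YV: "converges_in_probability M (\<lambda>n w. Y n w - ?V n w) (\<lambda>_. 0)"
      unfolding converges_in_probability_def
    proof (intro allI impI)
      fix \<epsilon> :: real assume "0 < \<epsilon>"
      let ?d = "\<lambda>n w. real n * (?Q n w - dint (?\<kappa> \<theta>) (empirical \<nu> n (\<lambda>i. X i w)) (empirical \<nu> n (\<lambda>i. X i w)))"
      have "(\<lambda>n. measure M {w \<in> space M. dist (?d n w) 0 > \<epsilon>}) \<longlonglongrightarrow> 0"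
        using part1 \<open>0 < \<epsilon>\<close> by (simp add: converges_in_probability_def)
      moreover have "\<forall>\<^sub>F n in sequentially. measure M {w \<in> space M. dist (?d n w) 0 > \<epsilon>} =
          measure M {w \<in> space M. dist (Y n w - ?V n w) 0 > \<epsilon>}"
        using Y_eq eventually_gt_at_top[of 0]
      proof eventually_elim
        case (elim n)
        have "?d n w = Y n w - ?V n w" if "w \<in> space M" for w
          using elim dint_eq[OF that, of n] by (simp add: right_diff_distrib power2_eq_square)
        then show ?case by (intro arg_cong[where f = "measure M"] Collect_cong) auto
      qed
      ultimately show "(\<lambda>n. measure M {w \<in> space M. dist (Y n w - ?V n w) 0 > \<epsilon>}) \<longlonglongrightarrow> 0"
        by (rule Lim_transform_eventually)
    qed
    have chi: "real_distribution (chi_star I lam)"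
      using tr by (intro real_distribution_chi_star) (auto simp: finite_trace_def summable_on_def)
    have "weak_conv_m (\<lambda>n. distr M borel (Y n)) (chi_star I lam)"
    proof (rule levy_continuity)
      show "real_distribution (distr M borel (Y n))" for n
        by (rule M.real_distribution_distr) (rule Y_meas)
      show "real_distribution (chi_star I lam)" by (rule chi)
      fix t
      have "(\<lambda>n. \<integral>w. iexp (t * ?V n w) \<partial>M) \<longlonglongrightarrow> char (chi_star I lam) t"
      proof (rule degenerate_V_statistic_char_limit[OF _ _ _ _ sd tr])
        show "finite_variance (?D \<Otimes>\<^sub>M ?D) (\<lambda>(x, y). ?\<kappa> \<theta> x y)"
          using \<theta>.finite_variance_scen_kernel by (simp add: scen_def)
        show "?\<kappa> \<theta> x y = ?\<kappa> \<theta> y x" if "x \<in> space ?D" "y \<in> space ?D" for x y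
          using sym[OF \<theta>\<Omega>] that by (simp add: spD)
        show "(\<integral>y. ?\<kappa> \<theta> x y \<partial>?D) = 0" if "x \<in> space ?D" for x
          using centred[OF \<theta>\<Omega>] that by (simp add: spD)
        show "integrable ?D (?\<kappa> \<theta> x)" if "x \<in> space ?D" for x
          using D.finite_variance_integrable[OF \<theta>.finite_variance_scen_section[OF that]] by (simp add: scen_def)
      qed
      from M.char_limit_asymptotically_equal[OF Y_meas V_meas YV this]
      have "(\<lambda>n. \<integral>w. iexp (t * Y n w) \<partial>M) \<longlonglongrightarrow> char (chi_star I lam) t" .
      moreover have "char (distr M borel (Y n)) t = (\<integral>w. iexp (t * Y n w) \<partial>M)" for n
        unfolding char_def by (rule integral_distr) auto
      ultimately show "(\<lambda>n. char (distr M borel (Y n)) t) \<longlonglongrightarrow> char (chi_star I lam) t" by simp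
    qed
    then have "(\<lambda>n. cdf (distr M borel (Y n)) x) \<longlonglongrightarrow> cdf (chi_star I lam) x"
      if "isCont (cdf (chi_star I lam)) x" for x
      using that by (simp add: weak_conv_m_def weak_conv_def)
    moreover have "\<forall>\<^sub>F n in sequentially. cdf (distr M borel (Y n)) x
        = cdf (distr M borel (\<lambda>w. real n * ?Q n w)) x" for x
      using Y_eq by eventually_elim simp
    ultimately show ?thesis
      unfolding weak_conv_m_def weak_conv_def by (blast intro: Lim_transform_eventually)
  qed
  from part1 part2 show ?thesis by blast
qed

end
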